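(* Let $V_0$ be a (simple) Euclidean Jordan algebra of dimension $n$, rank $r$ and Peirce multiplicity $d$, and let $T_\Omega=V_0+i\Omega$ be the corresponding tube domain. Let $\nu_1,\nu_2$ be real numbers with $\nu_1,\nu_2>1+d(r-1)=\frac{2n}{r}-1$, and let $F_1\in H^2_{\nu_1}(T_\Omega)$ and $F_2\in H^2_{\nu_2}(T_\Omega)$. Then the point-wise product $F_1\cdot F_2$ belongs to $H^2_{\nu_1+\nu_2}(T_\Omega)$.
   Context: A Euclidean Jordan algebra $V_0$ is a finite-dimensional real Jordan algebra (commutative product with $x\cdot(x^2\cdot y)=x^2\cdot(x\cdot y)$) for which the form $\beta(x,y)=\mathrm{Tr}\,L(x\cdot y)$ is positive definite, where $L(x)y=x\cdot y$; it has an identity element. Its rank $r$ is the degree of the minimal polynomial $\lambda^r-a_1(x)\lambda^{r-1}+\cdots+(-1)^ra_r(x)$ of a regular element $x$; $\Delta(x)=a_r(x)$ is the Jordan determinant, and $\mathrm{tr}(x)=a_1(x)$ is the Jordan trace. The Peirce multiplicity $d$ is determined by $n=r+\frac d2 r(r-1)$, where $n=\dim V_0$ (if $r=1$, then $d(r-1)=0$). The set $\Omega=\{x^2 : x\in V_0\text{ invertible}\}$ is an open convex self-dual cone, $V=V_0\otimes\mathbb{C}$ is the complexification, and $T_\Omega=V_0+i\Omega\subset V$. For real $\nu$, $H^2_\nu(T_\Omega)$ is the space of holomorphic functions $f:T_\Omega\to\mathbb{C}$ such that $$\|f\|_\nu^2=\int_{T_\Omega}|f(x+iy)|^2\,\Delta(y)^{\nu-\frac{2n}{r}}\,dx\,dy<\infty,$$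 where $dx,dy$ are Euclidean (Lebesgue) measures on $V_0$. *)

theory Defs
  imports "HOL-Analysis.Analysis" "HOL-Computational_Algebra.Polynomial"
begin

section \<open>Euclidean Jordan algebras\<close>

text \<open>
  The underlying vector space \<open>V\<^sub>0\<close> is a type of class \<open>euclidean_space\<close>. The inner product of that
  class is not related to the Jordan product; it only normalises Lebesgue measure.
\<close>

definition op_trace :: "('a::euclidean_space \<Rightarrow> 'a) \<Rightarrow> real" where
  "op_trace f = (\<Sum>b\<in>Basis. f b \<bullet> b)"

locale jordan_algebra =
  fixes jmul :: "'a::euclidean_space \<Rightarrow> 'a \<Rightarrow> 'a"  (infixl "\<odot>" 70)
  assumes bilinear_jmul: "bilinear (\<odot>)"
    and jmul_commute: "x \<odot> y = y \<odot> x"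
    and jordan_identity: "x \<odot> ((x \<odot> x) \<odot> y) = (x \<odot> x) \<odot> (x \<odot> y)"
begin

definition trace_form :: "'a \<Rightarrow> 'a \<Rightarrow> real" where
  "trace_form x y = op_trace (\<lambda>z. (x \<odot> y) \<odot> z)"

definition ideal :: "'a set \<Rightarrow> bool" where
  "ideal I \<longleftrightarrow> subspace I \<and> (\<forall>x. \<forall>y\<in>I. x \<odot> y \<in> I)"

definition unit :: 'a where
  "unit = (THE e. \<forall>x. e \<odot> x = x)"

primrec jpower :: "'a \<Rightarrow> nat \<Rightarrow> 'a" where
  "jpower x 0 = unit"
| "jpower x (Suc k) = x \<odot> jpower x k"

definition jpoly :: "real poly \<Rightarrow> 'a \<Rightarrow> 'a" where
  "jpoly p x = (\<Sum>k\<le>degree p. coeff p k *\<^sub>R jpower x k)"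

definition minimal_poly :: "'a \<Rightarrow> real poly" where
  "minimal_poly x = (THE p. lead_coeff p = 1 \<and> jpoly p x = 0 \<and>
     (\<forall>q. q \<noteq> 0 \<and> jpoly q x = 0 \<longrightarrow> degree p \<le> degree q))"

definition rank :: nat where
  "rank = Max (range (\<lambda>x. degree (minimal_poly x)))"

definition regular :: "'a \<Rightarrow> bool" where
  "regular x \<longleftrightarrow> degree (minimal_poly x) = rank"

text \<open>
  The minimal polynomial yields \<open>a\<^sub>r(x)\<close> only for regular \<open>x\<close>; on all of \<open>V\<^sub>0\<close> the determinant is the
  polynomial function extending it, which is unique because the regular elements are dense.
\<close>

definition det :: "'a \<Rightarrow> real" where
  "det = (THE f. real_polynomial_function f \<and>
     (\<forall>x. regular x \<longrightarrow> f x = (-1) ^ rank * coeff (minimal_poly x) 0))"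

text \<open>
  The inverse is sought in the associative subalgebra \<open>\<real>[x]\<close>, as usual for Jordan algebras: in \<open>V\<^sub>0\<close>
  itself the equation \<open>x \<odot> y = unit\<close> need not determine \<open>y\<close>.
\<close>

definition invertible :: "'a \<Rightarrow> bool" where
  "invertible x \<longleftrightarrow> (\<exists>p. x \<odot> jpoly p x = unit)"

definition cone :: "'a set" where
  "cone = {x \<odot> x |x. invertible x}"

end

locale euclidean_jordan_algebra = jordan_algebra +
  assumes trace_form_pos: "x \<noteq> 0 \<Longrightarrow> trace_form x x > 0"

text \<open>
  The algebra is nonzero since every type of class \<open>euclidean_space\<close> has positive dimension, and its
  product is nonzero by positivity of the trace form.
\<close>

locale simple_euclidean_jordan_algebra = euclidean_jordan_algebra +
  assumes simple: "ideal I \<Longrightarrow> I = {0} \<or> I = UNIV"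


section \<open>Existence of the identity element\<close>

lemma op_trace_commute:
  fixes f g :: "'a::euclidean_space \<Rightarrow> 'a"
  assumes "linear f" "linear g"
  shows "op_trace (\<lambda>x. f (g x)) = op_trace (\<lambda>x. g (f x))"
proof -
  have *: "op_trace (\<lambda>x. u (v x)) = (\<Sum>b\<in>Basis. \<Sum>c\<in>Basis. (v b \<bullet> c) * (u c \<bullet> b))"
    if "linear u" for u v :: "'a \<Rightarrow> 'a"
  proof -
    have "u (v b) \<bullet> b = (\<Sum>c\<in>Basis. (v b \<bullet> c) * (u c \<bullet> b))" for b
    proof -
      have "u (v b) = u (\<Sum>c\<in>Basis. (v b \<bullet> c) *\<^sub>R c)"
        by (simp add: euclidean_representation)
      also have "\<dots> = (\<Sum>c\<in>Basis. (v b \<bullet> c) *\<^sub>R u c)"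
        by (simp add: linear_sum[OF that] linear_cmul[OF that])
      finally show ?thesis by (simp add: inner_sum_left)
    qed
    then show ?thesis by (simp add: op_trace_def)
  qed
  show ?thesis
    unfolding *[OF assms(1)] *[OF assms(2)]
    by (subst sum.swap) (simp add: mult.commute)
qed

lemma op_trace_add: "op_trace (\<lambda>x. f x + g x) = op_trace f + op_trace g"
  by (simp add: op_trace_def inner_add_left sum.distrib)

context jordan_algebra
begin

lemmas jmul_add_left = bilinear_ladd[OF bilinear_jmul]
lemmas jmul_add_right = bilinear_radd[OF bilinear_jmul]
lemmas jmul_minus_left = bilinear_lneg[OF bilinear_jmul]
lemmas jmul_minus_right = bilinear_rneg[OF bilinear_jmul]

lemma linear_jmul: "linear (\<lambda>y. x \<odot> y)"
  using bilinear_jmul by (simp add: bilinear_def)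

lemma jordan_identity_polar1:
  "z \<odot> ((x \<odot> x) \<odot> y) + 2 *\<^sub>R (x \<odot> ((x \<odot> z) \<odot> y)) =
   (x \<odot> x) \<odot> (z \<odot> y) + 2 *\<^sub>R ((x \<odot> z) \<odot> (x \<odot> y))"
proof -
  note dist = jmul_add_left jmul_add_right jmul_minus_left jmul_minus_right
  have zx: "z \<odot> x = x \<odot> z" by (rule jmul_commute)
  note p = jordan_identity[of "x + z" y, unfolded dist zx]
  note m = jordan_identity[of "x + - z" y, unfolded dist zx]
  show ?thesis
  proof (rule vector_eq_rdot[THEN iffD1], intro allI)
    fix w :: 'a
    have e: "u = v \<Longrightarrow> u \<bullet> w = v \<bullet> w" for u v by simp
    show "(z \<odot> ((x \<odot> x) \<odot> y) + 2 *\<^sub>R (x \<odot> ((x \<odot> z) \<odot> y))) \<bullet> w =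
      ((x \<odot> x) \<odot> (z \<odot> y) + 2 *\<^sub>R ((x \<odot> z) \<odot> (x \<odot> y))) \<bullet> w"
      using e[OF p] e[OF m] e[OF jordan_identity[of x y]] e[OF jordan_identity[of z y]]
      by (simp add: inner_add_left inner_diff_left)
  qed
qed

lemma jordan_identity_polar:
  "z \<odot> ((x \<odot> w) \<odot> y) + x \<odot> ((w \<odot> z) \<odot> y) + w \<odot> ((x \<odot> z) \<odot> y) =
   (x \<odot> w) \<odot> (z \<odot> y) + (w \<odot> z) \<odot> (x \<odot> y) + (x \<odot> z) \<odot> (w \<odot> y)"
proof (rule vector_eq_rdot[THEN iffD1], intro allI)
  fix v :: 'a
  have e: "u = u' \<Longrightarrow> u \<bullet> v = u' \<bullet> v" for u u' by simp
  have wx: "w \<odot> x = x \<odot> w" by (rule jmul_commute)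
  show "(z \<odot> ((x \<odot> w) \<odot> y) + x \<odot> ((w \<odot> z) \<odot> y) + w \<odot> ((x \<odot> z) \<odot> y)) \<bullet> v =
   ((x \<odot> w) \<odot> (z \<odot> y) + (w \<odot> z) \<odot> (x \<odot> y) + (x \<odot> z) \<odot> (w \<odot> y)) \<bullet> v"
    using e[OF jordan_identity_polar1[of z "x + w" y, unfolded jmul_add_left jmul_add_right wx]]
      e[OF jordan_identity_polar1[of z x y]] e[OF jordan_identity_polar1[of z w y]]
    by (simp add: inner_add_left)
qed

lemma trace_form_assoc: "trace_form (x \<odot> y) z = trace_form x (y \<odot> z)"
proof -
  note lin = linear_jmul
  have lin2: "linear (\<lambda>w. a \<odot> (b \<odot> w))" for a b
    using linear_compose[OF lin lin] by (simp add: o_def)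
  have key: "op_trace (\<lambda>w. c \<odot> (b \<odot> (a \<odot> w))) + op_trace (\<lambda>w. a \<odot> (b \<odot> (c \<odot> w)))
      + op_trace (\<lambda>w. ((a \<odot> c) \<odot> b) \<odot> w)
    = op_trace (\<lambda>w. (c \<odot> b) \<odot> (a \<odot> w)) + op_trace (\<lambda>w. (a \<odot> b) \<odot> (c \<odot> w))
      + op_trace (\<lambda>w. (a \<odot> c) \<odot> (b \<odot> w))" for a b c
  proof -
    have "c \<odot> (b \<odot> (a \<odot> w)) + a \<odot> (b \<odot> (c \<odot> w)) + ((a \<odot> c) \<odot> b) \<odot> w
      = (c \<odot> b) \<odot> (a \<odot> w) + (a \<odot> b) \<odot> (c \<odot> w) + (a \<odot> c) \<odot> (b \<odot> w)" for w
    proof -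
      have "b \<odot> (a \<odot> w) = (a \<odot> w) \<odot> b" "b \<odot> (c \<odot> w) = (w \<odot> c) \<odot> b"
        "((a \<odot> c) \<odot> b) \<odot> w = w \<odot> ((a \<odot> c) \<odot> b)"
        "(c \<odot> b) \<odot> (a \<odot> w) = (a \<odot> w) \<odot> (c \<odot> b)"
        "(a \<odot> b) \<odot> (c \<odot> w) = (w \<odot> c) \<odot> (a \<odot> b)" "b \<odot> w = w \<odot> b"
        by (metis jmul_commute)+
      with jordan_identity_polar[of c a w b] show ?thesis by simp
    qed
    then show ?thesis
      by (simp flip: op_trace_add)
  qed
  have "op_trace (\<lambda>w. ((x \<odot> y) \<odot> z) \<odot> w) = op_trace (\<lambda>w. ((z \<odot> y) \<odot> x) \<odot> w)"
    using key[of x z y] key[of z x y]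
      op_trace_commute[OF lin lin2, of y z x] op_trace_commute[OF lin lin2, of x z y]
      op_trace_commute[OF lin lin2, of y x z] op_trace_commute[OF lin lin2, of z x y]
    by (simp add: jmul_commute)
  then show ?thesis
    by (simp add: trace_form_def jmul_commute)
qed

end

context euclidean_jordan_algebra
begin

lemma ex1_unit: "\<exists>!e. \<forall>x. e \<odot> x = x"
proof -
  have scaleL: "(c *\<^sub>R x) \<odot> y = c *\<^sub>R (x \<odot> y)" and scaleR: "x \<odot> (c *\<^sub>R y) = c *\<^sub>R (x \<odot> y)"
    for c x y
    using bilinear_lmul[OF bilinear_jmul] bilinear_rmul[OF bilinear_jmul] by auto
  define t where "t x = op_trace (\<lambda>z. x \<odot> z)" for x
  have lin_t: "linear t"
    by (rule linearI)
      (simp_all add: t_def op_trace_def jmul_add_left inner_add_left sum.distrib scaleL sum_distrib_left)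
  have tf: "trace_form x y = t (x \<odot> y)" for x y
    by (simp add: trace_form_def t_def)
  have lin1: "linear (\<lambda>x. trace_form x y)" and lin2: "linear (\<lambda>y. trace_form x y)" for x y
    unfolding tf
    by (rule linearI; simp add: jmul_add_left jmul_add_right scaleL scaleR
        linear_add[OF lin_t] linear_cmul[OF lin_t])+
  define T where "T v = (\<Sum>b\<in>Basis. trace_form v b *\<^sub>R b)" for v
  have lin_T: "linear T"
    by (rule linearI)
      (simp_all add: T_def linear_add[OF lin1] linear_cmul[OF lin1] scaleR_add_left sum.distrib
        scaleR_sum_right)
  have T_inner: "T v \<bullet> w = trace_form v w" for v w
  proof -
    have "trace_form v w = trace_form v (\<Sum>b\<in>Basis. (w \<bullet> b) *\<^sub>R b)"
      by (simp add: euclidean_representation)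
    also have "\<dots> = (\<Sum>b\<in>Basis. (w \<bullet> b) * trace_form v b)"
      by (simp add: linear_sum[OF lin2] linear_cmul[OF lin2])
    also have "\<dots> = T v \<bullet> w"
      by (simp add: T_def inner_sum_left inner_commute[of w] mult.commute)
    finally show ?thesis by simp
  qed
  have nondeg: "v = 0" if "\<And>w. trace_form v w = 0" for v
    using trace_form_pos[of v] that[of v] by fastforce
  have "inj T"
    unfolding linear_injective_0[OF lin_T]
    using nondeg T_inner by (metis inner_zero_left)
  then have "surj T"
    by (rule linear_inj_imp_surj[OF lin_T])
  then obtain e where e: "T e = (\<Sum>b\<in>Basis. t b *\<^sub>R b)"
    by (metis surjD)
  have te: "trace_form e w = t w" for w
  proof -
    have "trace_form e w = (\<Sum>b\<in>Basis. (w \<bullet> b) * t b)"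
      by (simp flip: T_inner add: e inner_sum_left inner_commute[of w] mult.commute)
    also have "\<dots> = t (\<Sum>b\<in>Basis. (w \<bullet> b) *\<^sub>R b)"
      by (simp add: linear_sum[OF lin_t] linear_cmul[OF lin_t])
    finally show ?thesis by (simp add: euclidean_representation)
  qed
  have unit: "e \<odot> x = x" for x
  proof -
    have "trace_form (e \<odot> x - x) w = 0" for w
      by (simp add: linear_diff[OF lin1] trace_form_assoc te tf[of x])
    then show ?thesis using nondeg by (metis eq_iff_diff_eq_0)
  qed
  show ?thesis
    by (rule ex1I[of _ e]) (use unit jmul_commute in metis)+
qed

lemma unit_left: "unit \<odot> x = x"
  using theI'[OF ex1_unit] unfolding unit_def by blast

end


section \<open>Weighted Bergman spaces on the tube domain\<close>

text \<open>
  The complexification \<open>V\<^sub>0 \<otimes> \<complex>\<close> is modelled by pairs, \<open>(x, y)\<close> standing for \<open>x + iy\<close>. Under this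
  identification \<open>lborel\<close> on pairs is the product measure \<open>dx dy\<close>.
\<close>

definition cscale :: "complex \<Rightarrow> 'a::real_vector \<times> 'a \<Rightarrow> 'a \<times> 'a" where
  "cscale c z = (Re c *\<^sub>R fst z - Im c *\<^sub>R snd z, Re c *\<^sub>R snd z + Im c *\<^sub>R fst z)"

definition complexification_holomorphic_on ::
    "('a::euclidean_space \<times> 'a \<Rightarrow> complex) \<Rightarrow> ('a \<times> 'a) set \<Rightarrow> bool" where
  "complexification_holomorphic_on f S \<longleftrightarrow>
     (\<forall>z\<in>S. \<exists>D. (f has_derivative D) (at z) \<and> (\<forall>c v. D (cscale c v) = c * D v))"

context jordan_algebra
begin

definition tube_domain :: "('a \<times> 'a) set" where
  "tube_domain = {(x, y) |x y. y \<in> cone}"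

text \<open>
  The values of \<open>f\<close> outside the tube domain are irrelevant to \<open>bergman_norm_sq\<close> and \<open>bergman_space\<close>.
\<close>

definition bergman_norm_sq :: "real \<Rightarrow> ('a \<times> 'a \<Rightarrow> complex) \<Rightarrow> ennreal" where
  "bergman_norm_sq \<nu> f =
     (\<integral>\<^sup>+ z \<in> tube_domain.
        ennreal ((cmod (f z))\<^sup>2 * det (snd z) powr (\<nu> - 2 * real DIM('a) / real rank)) \<partial>lborel)"

definition bergman_space :: "real \<Rightarrow> ('a \<times> 'a \<Rightarrow> complex) set" where
  "bergman_space \<nu> =
     {f. complexification_holomorphic_on f tube_domain \<and> bergman_norm_sq \<nu> f < \<infinity>}"

end

end

theory Submission
  imports Defs "HOL-Complex_Analysis.Complex_Analysis"
begin

text \<open>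
  A function \<open>F\<close> in \<open>H\<^sup>2\<^sub>\<nu>(T\<^sub>\<Omega>)\<close> satisfies \<open>|F(x + iy)|\<^sup>2 \<Delta>(y)\<^sup>\<nu> \<le> C\<close> on the tube domain, and multiplying
  the integrand of \<open>\<parallel>F\<^sub>2\<parallel>\<^sup>2\<close> by such a bounded function for \<open>F\<^sub>1\<close> gives the claim. For the bound, write
  \<open>y = A e\<close> with \<open>A = exp L(log y)\<close>, an automorphism of the cone with \<open>det A = \<Delta>(y)\<close> to the power
  \<open>n/r\<close> and \<open>\<Delta>(A w) = \<Delta>(y) \<Delta>(w)\<close>. The mean value property on \<open>x + iy + A(B)\<close>, for a small ball \<open>B\<close>
  around \<open>0\<close> in \<open>V\<close>, compares \<open>|F(x + iy)|\<^sup>2\<close> with the integral of \<open>|F|\<^sup>2\<close> over a set of volume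
  proportional to \<open>\<Delta>(y)\<close> to the power \<open>2n/r\<close>, on which \<open>\<Delta>\<close> is comparable to \<open>\<Delta>(y)\<close>.

  Simplicity of the algebra enters through the identity \<open>Tr L(x) = (n/r) tr(x)\<close>, that is, all primitive
  idempotents have the same trace. It also shows that the Jordan determinant is a polynomial, because
  by Newton's identities it is a polynomial in the traces of powers.
\<close>


section \<open>Self-adjoint maps and changes of variables\<close>

text \<open>Two scalar products are in play. Lebesgue measure is normalised by the inner product of
  the type class, while L(x) is self-adjoint for the trace form. Eigenbases of L(x) are therefore
  images of \<open>Basis\<close> under a linear map T that need not be orthogonal, and the Jacobian
  of T D T^-1 is found by cancelling that of T. The map exp L(log y) is the quadratic representation
  P(y^(1/2)). Its exponential form makes it a limit of powers of resolvents (1 - L(x)/k)^-1, whose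
  positivity can be tested with the trace form. Positivity rests on one inequality: the trace form
  of two idempotents is nonnegative and vanishes only if their product does. The mean value
  inequality is a one-variable statement averaged over a ball of V: multiplication by e^(it)
  preserves such a ball and commutes with A acting on both components. The bound carries the
  exponent nu because the weight contributes nu - 2n/r and the Jacobian of A on V contributes
  2n/r.\<close>

lemma linear_coeff_zero_if_quadratic_nonpos:
  fixes a b :: real
  assumes "\<And>t. a * t + b * t\<^sup>2 \<le> 0"
  shows "a = 0"
proof (rule ccontr)
  assume "a \<noteq> 0"
  \<comment> \<open>Since k + b > 0, the quadratic takes the positive value a^2 (k + b) / k^2 at t =
    a / k.\<close>
  define k where "k = \<bar>b\<bar> + 1"
  have k: "k > 0" "k + b > 0" by (auto simp: k_def)
  have "a * (a / k) + b * (a / k)\<^sup>2 = a\<^sup>2 / k\<^sup>2 * (k + b)"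
    using k by (simp add: field_simps power2_eq_square)
  moreover have "a\<^sup>2 / k\<^sup>2 * (k + b) > 0" using k \<open>a \<noteq> 0\<close> by simp
  ultimately show False using assms[of "a / k"] by linarith
qed

text \<open>Rayleigh quotient: at a maximum over the compact unit sphere of \<open>W\<close> the
  first variation vanishes in every direction of \<open>W\<close>. As \<open>W\<close> is invariant,
  the residual \<open>M v0 - l *\<^sub>R v0\<close> lies in \<open>W\<close> and is thus
  \<open>B\<close>-orthogonal to itself. The sphere is that of the norm, not of \<open>B\<close>;
  homogeneity of the quotient bridges the two.\<close>

lemma selfadjoint_eigenvector:
  fixes B :: "'a::euclidean_space \<Rightarrow> 'a \<Rightarrow> real"
  assumes B: "bilinear B" and sym: "\<And>u v. B u v = B v u"
    and pos: "\<And>u. u \<noteq> 0 \<Longrightarrow> B u u > 0"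
    and M: "linear M" and sa: "\<And>u v. B (M u) v = B u (M v)"
    and W: "subspace W" "W \<noteq> {0}" and inv: "\<And>v. v \<in> W \<Longrightarrow> M v \<in> W"
  obtains v l where "v \<in> W" "B v v = 1" "M v = l *\<^sub>R v"
proof -
  have bb: "bounded_bilinear B" using B by (simp add: bilinear_conv_bounded_bilinear)
  have contM: "continuous_on S M" for S
    using M by (simp add: linear_continuous_on linear_linear)
  define S where "S = W \<inter> sphere 0 1"
  have "compact S" unfolding S_def
    by (rule closed_Int_compact) (use W in \<open>auto intro: closed_subspace\<close>)
  obtain w where w: "w \<in> W" "w \<noteq> 0" using W subspace_0 by blast
  then have "(1 / norm w) *\<^sub>R w \<in> S" using W by (auto simp: S_def subspace_scale)
  then have "S \<noteq> {}" by auto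
  have "B u u \<noteq> 0" if "u \<in> S" for u using pos[of u] that by (force simp: S_def)
  then have cont: "continuous_on S (\<lambda>u. B (M u) u / B u u)"
    by (intro continuous_intros bounded_bilinear.continuous_on[OF bb] contM) auto
  obtain v0 where v0: "v0 \<in> S" and max: "\<And>u. u \<in> S \<Longrightarrow> B (M u) u / B u u \<le> B (M v0) v0 / B v0 v0"
    using continuous_attains_sup[OF \<open>compact S\<close> \<open>S \<noteq> {}\<close> cont] by blast
  define l where "l = B (M v0) v0 / B v0 v0"
  have v0nz: "v0 \<noteq> 0" and v0W: "v0 \<in> W" using v0 by (auto simp: S_def)
  note simps = bilinear_ladd[OF B] bilinear_radd[OF B] bilinear_lmul[OF B] bilinear_rmul[OF B]
    bilinear_lsub[OF B] bilinear_rsub[OF B] linear_add[OF M] linear_cmul[OF M]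
    bilinear_lzero[OF B] bilinear_rzero[OF B]
  have ray: "B (M u) u \<le> l * B u u" if "u \<in> W" for u
  proof (cases "u = 0")
    case False
    have "(1 / norm u) *\<^sub>R u \<in> S" using False that W by (auto simp: S_def subspace_scale)
    from max[OF this] show ?thesis using False pos[of u] by (simp add: simps l_def[symmetric] field_simps)
  qed (simp add: simps linear_0[OF M])
  have orth: "B (M v0 - l *\<^sub>R v0) w = 0" if "w \<in> W" for w
  proof -
    \<comment> \<open>The bound \<open>ray\<close> at \<open>v0 + t *\<^sub>R w\<close>, with
      equality at t = 0, is a quadratic inequality in t without constant term.\<close>
    have "(2 * B (M v0 - l *\<^sub>R v0) w) * t + (B (M w) w - l * B w w) * t\<^sup>2 \<le> 0" for t
    proof -
      have "v0 + t *\<^sub>R w \<in> W" using v0W that W by (simp add: subspace_add subspace_scale)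
      from ray[OF this] have "B (M v0) v0 + 2 * t * B (M v0) w + t\<^sup>2 * B (M w) w
        \<le> l * (B v0 v0 + 2 * t * B v0 w + t\<^sup>2 * B w w)"
        by (simp add: simps sa[of w v0] sym[of w v0] sym[of w "M v0"] algebra_simps power2_eq_square)
      moreover have "B (M v0) v0 = l * B v0 v0" using pos[OF v0nz] by (simp add: l_def)
      ultimately show ?thesis by (simp add: simps algebra_simps)
    qed
    from linear_coeff_zero_if_quadratic_nonpos[OF this] show ?thesis by simp
  qed
  have "M v0 - l *\<^sub>R v0 \<in> W" using v0W inv W by (simp add: subspace_diff subspace_scale)
  from orth[OF this] pos[of "M v0 - l *\<^sub>R v0"] have eig: "M v0 = l *\<^sub>R v0" by (cases "M v0 - l *\<^sub>R v0 = 0") auto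
  define c where "c = 1 / sqrt (B v0 v0)"
  show ?thesis
  proof
    show "c *\<^sub>R v0 \<in> W" using v0W W by (simp add: subspace_scale)
    show "B (c *\<^sub>R v0) (c *\<^sub>R v0) = 1" using pos[OF v0nz] by (simp add: c_def simps)
    show "M (c *\<^sub>R v0) = l *\<^sub>R (c *\<^sub>R v0)" by (simp add: simps eig)
  qed
qed

text \<open>Induction on the number of \<open>B\<close>-orthonormal eigenvectors: the
  \<open>B\<close>-orthogonal complement of those found is invariant by self-adjointness and nonzero
  while their number is below the dimension, so it contains a further one. \<open>T\<close> sends
  the standard basis to the eigenbasis.\<close>

lemma selfadjoint_eigenbasis:
  fixes B :: "'a::euclidean_space \<Rightarrow> 'a \<Rightarrow> real"
  assumes B: "bilinear B" and sym: "\<And>u v. B u v = B v u"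
    and pos: "\<And>u. u \<noteq> 0 \<Longrightarrow> B u u > 0"
    and M: "linear M" and sa: "\<And>u v. B (M u) v = B u (M v)"
  obtains T :: "'a \<Rightarrow> 'a" and m :: "'a \<Rightarrow> real" where "linear T" "\<And>u v. B (T u) (T v) = u \<bullet> v"
    "\<And>b. b \<in> Basis \<Longrightarrow> M (T b) = m b *\<^sub>R T b"
proof -
  note simps = bilinear_ladd[OF B] bilinear_radd[OF B] bilinear_lmul[OF B] bilinear_rmul[OF B]
    bilinear_lsub[OF B] bilinear_rsub[OF B] linear_add[OF M] linear_cmul[OF M]
    bilinear_lzero[OF B] bilinear_rzero[OF B]
  have Bl: "linear (\<lambda>x. B x y)" and Br: "linear (B x)" for x y
    using B by (auto simp: bilinear_def)
  have ex: "\<exists>E. finite E \<and> card E = k \<and> (\<forall>u\<in>E. \<forall>v\<in>E. B u v = (if u = v then 1 else 0)) \<and>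
        (\<forall>u\<in>E. \<exists>l. M u = l *\<^sub>R u)" if "k \<le> DIM('a)" for k
    using that
  proof (induction k)
    case 0
    show ?case by (rule exI[of _ "{}"]) simp
  next
    case (Suc k)
    then obtain E where E: "finite E" "card E = k" "\<forall>u\<in>E. \<forall>v\<in>E. B u v = (if u = v then 1 else 0)"
      "\<forall>u\<in>E. \<exists>l. M u = l *\<^sub>R u" by auto
    define W where "W = {v. \<forall>u\<in>E. B u v = 0}"
    have subW: "subspace W" by (auto simp: W_def subspace_def simps)
    have "dim (span E) \<le> k" using dim_le_card[OF _ E(1), of E] E(2) by (simp add: span_superset)
    then have "span E \<noteq> UNIV" using Suc.prems by (metis dim_UNIV not_less_eq_eq)
    then obtain w where w: "w \<notin> span E" by auto
    \<comment> \<open>Gram-Schmidt on a vector outside the span yields a nonzero element of the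
      complement.\<close>
    define v where "v = w - (\<Sum>u\<in>E. B u w *\<^sub>R u)"
    have "v \<noteq> 0"
    proof
      assume "v = 0"
      then have "w = (\<Sum>u\<in>E. B u w *\<^sub>R u)" by (simp add: v_def)
      also have "\<dots> \<in> span E" by (intro span_sum span_scale span_base)
      finally show False using w by simp
    qed
    moreover have "v \<in> W"
    proof -
      have "B u v = 0" if "u \<in> E" for u
      proof -
        have "B u (\<Sum>x\<in>E. B x w *\<^sub>R x) = (\<Sum>x\<in>E. B x w * B u x)"
          by (simp add: linear_sum[OF Br] simps)
        also have "\<dots> = (\<Sum>x\<in>E. if x = u then B x w else 0)"
          using E(3) that by (intro sum.cong) auto
        also have "\<dots> = B u w" using E(1) that by simp
        finally show ?thesis by (simp add: v_def simps)
      qed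
      then show ?thesis by (simp add: W_def)
    qed
    ultimately have "W \<noteq> {0}" by auto
    have inv: "M x \<in> W" if "x \<in> W" for x
    proof -
      have "B u (M x) = 0" if u: "u \<in> E" for u
      proof -
        obtain l where "M u = l *\<^sub>R u" using E(4) u by blast
        then show ?thesis using \<open>x \<in> W\<close> u by (simp add: sa[symmetric] simps W_def)
      qed
      then show ?thesis by (simp add: W_def)
    qed
    obtain x l where x: "x \<in> W" "B x x = 1" "M x = l *\<^sub>R x"
      using selfadjoint_eigenvector[OF B sym pos M sa subW \<open>W \<noteq> {0}\<close> inv] by blast
    have xE: "B x u = 0" "B u x = 0" if "u \<in> E" for u using x(1) that sym by (auto simp: W_def)
    have "x \<notin> E" using xE x(2) by force
    show ?case
      by (rule exI[of _ "insert x E"]) (use E x xE \<open>x \<notin> E\<close> in auto)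
  qed
  obtain E where E: "finite E" "card E = DIM('a)" "\<forall>u\<in>E. \<forall>v\<in>E. B u v = (if u = v then 1 else 0)"
      "\<forall>u\<in>E. \<exists>l. M u = l *\<^sub>R u" using ex[of "DIM('a)"] by auto
  obtain g where g: "bij_betw g (Basis :: 'a set) E"
    using finite_same_card_bij[OF finite_Basis E(1)] E(2) by auto
  have gE: "g b \<in> E" if "b \<in> Basis" for b using g that by (auto simp: bij_betw_def)
  have gB: "B (g b) (g c) = (if b = c then 1 else 0)" if "b \<in> Basis" "c \<in> Basis" for b c
    using E(3) gE that bij_betw_imp_inj_on[OF g] by (auto simp: inj_on_eq_iff)
  define T where "T v = (\<Sum>b\<in>Basis. (v \<bullet> b) *\<^sub>R g b)" for v
  have linT: "linear T"
    by (rule linearI) (simp_all add: T_def inner_add_left scaleR_add_left sum.distrib scaleR_sum_right)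
  have Tb: "T b = g b" if "b \<in> Basis" for b
  proof -
    have "T b = (\<Sum>c\<in>Basis. if c = b then g c else 0)"
      unfolding T_def using that by (intro sum.cong) (auto simp: inner_Basis)
    then show ?thesis using that by simp
  qed
  have "\<forall>b\<in>Basis. \<exists>l. M (T b) = l *\<^sub>R T b" using E(4) gE Tb by simp
  then obtain m where m: "\<And>b. b \<in> Basis \<Longrightarrow> M (T b) = m b *\<^sub>R T b" by metis
  have BT: "B (T u) (T v) = u \<bullet> v" for u v
  proof -
    have "B (T u) (T v) = (\<Sum>b\<in>Basis. \<Sum>c\<in>Basis. (u \<bullet> b) * (v \<bullet> c) * B (g b) (g c))"
      unfolding T_def
      by (subst linear_sum[OF Bl])
        (simp add: linear_sum[OF Br] simps sum_distrib_left ac_simps)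
    also have "\<dots> = (\<Sum>b\<in>Basis. \<Sum>c\<in>Basis. if c = b then (u \<bullet> b) * (v \<bullet> c) else 0)"
      by (intro sum.cong) (auto simp: gB)
    also have "\<dots> = (\<Sum>b\<in>Basis. (u \<bullet> b) * (v \<bullet> b))" by simp
    also have "\<dots> = u \<bullet> v" by (rule euclidean_inner[symmetric])
    finally show ?thesis .
  qed
  show ?thesis by (rule that[OF linT BT m])
qed

section \<open>Linear changes of variables for Lebesgue measure\<close>

lemma nn_integral_lborel_translate:
  fixes f :: "'a::euclidean_space \<Rightarrow> ennreal"
  assumes [measurable]: "f \<in> borel_measurable borel"
  shows "(\<integral>\<^sup>+x. f (a + x) \<partial>lborel) = (\<integral>\<^sup>+x. f x \<partial>lborel)"
  by (subst (2) lborel_distr_plus[of a, symmetric]) (simp add: nn_integral_distr)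

lemma nn_integral_lborel_reflect:
  fixes f :: "'a::euclidean_space \<Rightarrow> ennreal"
  assumes [measurable]: "f \<in> borel_measurable borel"
  shows "(\<integral>\<^sup>+x. f (- x) \<partial>lborel) = (\<integral>\<^sup>+x. f x \<partial>lborel)"
  by (subst (2) lborel_affine[of "-1" 0]) (simp_all add: nn_integral_distr nn_integral_density)

lemma linear_measurable_borel:
  "linear T \<Longrightarrow> T \<in> borel_measurable borel" for T :: "'a::euclidean_space \<Rightarrow> 'b::euclidean_space"
  by (intro borel_measurable_continuous_onI linear_continuous_on) (simp add: linear_linear)

text \<open>The uniqueness argument for Haar measure: the double integral of f(T x) g(T x + y) is
  evaluated in both orders, using translation and reflection invariance. It makes the ratio of the
  integrals of f(T x) and f(x) the same for every f.\<close>

lemma nn_integral_lborel_linear_aux: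
  fixes T :: "'a::euclidean_space \<Rightarrow> 'a" and f g :: "'a \<Rightarrow> ennreal"
  assumes T: "linear T" "inj T"
    and [measurable]: "f \<in> borel_measurable borel" "g \<in> borel_measurable borel"
  shows "(\<integral>\<^sup>+x. f (T x) \<partial>lborel) * (\<integral>\<^sup>+x. g x \<partial>lborel) =
         (\<integral>\<^sup>+x. g (T x) \<partial>lborel) * (\<integral>\<^sup>+x. f x \<partial>lborel)"
proof -
  note [measurable] = linear_measurable_borel[OF T(1)]
  have surj: "surj T" by (rule linear_inj_imp_surj[OF T])
  obtain S where S: "\<And>y. T (S y) = y" using surj by (metis surj_def)
  have "(\<integral>\<^sup>+x. f (T x) \<partial>lborel) * (\<integral>\<^sup>+x. g x \<partial>lborel) = (\<integral>\<^sup>+x. f (T x) * (\<integral>\<^sup>+y. g y \<partial>lborel) \<partial>lborel)"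
    by (simp add: nn_integral_multc)
  also have "\<dots> = (\<integral>\<^sup>+x. f (T x) * (\<integral>\<^sup>+y. g (T x + y) \<partial>lborel) \<partial>lborel)"
    by (simp add: nn_integral_lborel_translate)
  also have "\<dots> = (\<integral>\<^sup>+x. \<integral>\<^sup>+y. f (T x) * g (T x + y) \<partial>lborel \<partial>lborel)"
    by (rule nn_integral_cong) (subst nn_integral_cmult; simp)
  also have "\<dots> = (\<integral>\<^sup>+y. \<integral>\<^sup>+x. f (T x) * g (T x + y) \<partial>lborel \<partial>lborel)"
    by (rule lborel_pair.Fubini'[symmetric]) measurable
  \<comment> \<open>Here x is translated by \<open>S y\<close>, a preimage of y under
    \<open>T\<close>.\<close>
  also have "\<dots> = (\<integral>\<^sup>+y. \<integral>\<^sup>+x. f (T x - y) * g (T x) \<partial>lborel \<partial>lborel)"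
  proof (rule nn_integral_cong)
    fix y :: 'a
    show "(\<integral>\<^sup>+x. f (T x) * g (T x + y) \<partial>lborel) = (\<integral>\<^sup>+x. f (T x - y) * g (T x) \<partial>lborel)"
      using nn_integral_lborel_translate[of "\<lambda>x. f (T x - y) * g (T x)" "S y"]
      by (simp add: linear_add[OF T(1)] S algebra_simps)
  qed
  also have "\<dots> = (\<integral>\<^sup>+x. \<integral>\<^sup>+y. f (T x - y) * g (T x) \<partial>lborel \<partial>lborel)"
    by (rule lborel_pair.Fubini') measurable
  also have "\<dots> = (\<integral>\<^sup>+x. (\<integral>\<^sup>+y. f (T x - y) \<partial>lborel) * g (T x) \<partial>lborel)"
    by (rule nn_integral_cong) (subst nn_integral_multc; simp)
  also have "\<dots> = (\<integral>\<^sup>+x. (\<integral>\<^sup>+y. f y \<partial>lborel) * g (T x) \<partial>lborel)"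
  proof (rule nn_integral_cong)
    fix x
    have "(\<integral>\<^sup>+y. f (T x - y) \<partial>lborel) = (\<integral>\<^sup>+y. f (T x + y) \<partial>lborel)"
      using nn_integral_lborel_reflect[of "\<lambda>y. f (T x + y)"] by simp
    then show "(\<integral>\<^sup>+y. f (T x - y) \<partial>lborel) * g (T x) = (\<integral>\<^sup>+y. f y \<partial>lborel) * g (T x)"
      by (simp add: nn_integral_lborel_translate)
  qed
  also have "\<dots> = (\<integral>\<^sup>+x. g (T x) \<partial>lborel) * (\<integral>\<^sup>+x. f x \<partial>lborel)"
    by (simp add: nn_integral_cmult mult.commute)
  finally show ?thesis .
qed

lemma emeasure_lborel_ball_pos_finite:
  "r > 0 \<Longrightarrow> 0 < emeasure lborel (ball (x::'a::euclidean_space) r) \<and> emeasure lborel (ball x r) < \<infinity>"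
  by (simp add: emeasure_ball unit_ball_vol_pos)

text \<open>Comparison with the indicator of the unit ball gives \<open>c\<close> as the volume of
  the preimage of the ball divided by that of the ball, that is 1/|det T|. The preimage contains a
  ball and lies in one, so \<open>c\<close> is positive and finite.\<close>

lemma nn_integral_lborel_linear:
  fixes T :: "'a::euclidean_space \<Rightarrow> 'a"
  assumes T: "linear T" "inj T"
  obtains c where "0 < c" "c < \<infinity>"
    "\<And>f. f \<in> borel_measurable borel \<Longrightarrow> (\<integral>\<^sup>+x. f (T x) \<partial>lborel) = c * (\<integral>\<^sup>+x. f x \<partial>lborel)"
proof -
  note [measurable] = linear_measurable_borel[OF T(1)]
  let ?V = "emeasure lborel (ball (0::'a) 1)"
  let ?W = "emeasure lborel (T -` ball 0 1)"
  have op: "open (T -` ball 0 1)"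
    by (rule open_vimage[OF open_ball linear_continuous_on[OF T(1)[unfolded linear_conv_bounded_linear]]])
  obtain e where e: "e > 0" "ball 0 e \<subseteq> T -` ball 0 1"
    using op open_contains_ball[of "T -` ball 0 1"] linear_0[OF T(1)] by force
  obtain B where B: "B > 0" "\<And>x. B * norm x \<le> norm (T x)"
    using linear_inj_bounded_below_pos[OF T] by blast
  have sub: "T -` ball 0 1 \<subseteq> ball 0 (1 / B)"
  proof
    fix x assume "x \<in> T -` ball 0 1"
    then have "B * norm x < 1" using B(2)[of x] by auto
    then show "x \<in> ball 0 (1 / B)" using B(1) by (simp add: field_simps)
  qed
  have W: "0 < ?W" "?W < \<infinity>"
  proof -
    have "emeasure lborel (ball (0::'a) e) \<le> ?W" using e op by (intro emeasure_mono) auto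
    then show "0 < ?W" using emeasure_lborel_ball_pos_finite[OF e(1), of "0::'a"] by auto
    have "?W \<le> emeasure lborel (ball (0::'a) (1/B))" using sub by (intro emeasure_mono) auto
    then show "?W < \<infinity>" using emeasure_lborel_ball_pos_finite[of "1/B" "0::'a"] B(1)
      by (auto intro: le_less_trans)
  qed
  have V: "0 < ?V" "?V < \<infinity>" using emeasure_lborel_ball_pos_finite[of 1 "0::'a"] by auto
  have WT: "(\<integral>\<^sup>+x. indicator (ball 0 1) (T x) \<partial>lborel) = ?W"
  proof -
    have "(\<integral>\<^sup>+x. indicator (ball 0 1) (T x) \<partial>lborel) = (\<integral>\<^sup>+x. indicator (T -` ball 0 1) x \<partial>lborel)"
      by (rule nn_integral_cong) (simp add: indicator_def)
    then show ?thesis using op by simp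
  qed
  show ?thesis
  proof
    show "0 < ?W / ?V" using W V by (simp add: ennreal_zero_less_divide)
    show "?W / ?V < \<infinity>"
      using W(2) V(1) ennreal_divide_eq_top_iff[of ?W ?V]
      unfolding infinity_ennreal_def less_top[symmetric] by (auto simp: zero_less_iff_neq_zero)
    fix f :: "'a \<Rightarrow> ennreal" assume [measurable]: "f \<in> borel_measurable borel"
    have "(\<integral>\<^sup>+x. f (T x) \<partial>lborel) * ?V = ?W * (\<integral>\<^sup>+x. f x \<partial>lborel)"
      using nn_integral_lborel_linear_aux[OF T, of f "indicator (ball 0 1)"] WT
      by (simp add: borel_measurable_indicator)
    then have *: "(\<integral>\<^sup>+x. f (T x) \<partial>lborel) * ?V / ?V = ?W * (\<integral>\<^sup>+x. f x \<partial>lborel) / ?V" by simp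
    then show "(\<integral>\<^sup>+x. f (T x) \<partial>lborel) = ?W / ?V * (\<integral>\<^sup>+x. f x \<partial>lborel)"
      unfolding ennreal_mult_divide_eq[OF V(1)[THEN less_imp_neq, symmetric] V(2)[unfolded infinity_ennreal_def, THEN less_imp_neq]]
      by (simp add: ennreal_times_divide mult.commute)
  qed
qed

text \<open>The unit ball is its own preimage, which forces the constant to be 1.\<close>

lemma nn_integral_lborel_isometry:
  fixes R :: "'a::euclidean_space \<Rightarrow> 'a"
  assumes R: "linear R" and n: "\<And>x. norm (R x) = norm x"
    and [measurable]: "f \<in> borel_measurable borel"
  shows "(\<integral>\<^sup>+x. f (R x) \<partial>lborel) = (\<integral>\<^sup>+x. f x \<partial>lborel)"
proof -
  have inj: "inj R" unfolding linear_injective_0[OF R] using n by (metis norm_eq_zero)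
  obtain c where c: "\<And>f. f \<in> borel_measurable borel \<Longrightarrow> (\<integral>\<^sup>+x. f (R x) \<partial>lborel) = c * (\<integral>\<^sup>+x. f x \<partial>lborel)"
    using nn_integral_lborel_linear[OF R inj] by metis
  let ?V = "emeasure lborel (ball (0::'a) 1)"
  have "(\<integral>\<^sup>+x. indicator (ball 0 1) (R x) \<partial>lborel) = (\<integral>\<^sup>+x. indicator (ball (0::'a) 1) x \<partial>lborel)"
    by (rule nn_integral_cong) (simp add: indicator_def n)
  then have "?V = c * ?V" using c[of "indicator (ball 0 1)"]
    by (simp add: borel_measurable_indicator)
  then have "?V * 1 = ?V * c" by (simp add: mult.commute)
  then have "c = 1"
    unfolding ennreal_mult_cancel_left
    using emeasure_lborel_ball_pos_finite[of 1 "0::'a"] by auto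
  then show ?thesis using c[of f] by simp
qed

text \<open>For T D T^-1 with D diagonal in the standard basis, the constant \<open>c\<close> of T
  occurs on both sides and cancels, which leaves the Jacobian of D.\<close>

lemma nn_integral_lborel_diagonalizable:
  fixes T :: "'a::euclidean_space \<Rightarrow> 'a"
  assumes T: "linear T" "inj T" and d: "\<And>b. b \<in> Basis \<Longrightarrow> d b > 0"
    and f[measurable]: "f \<in> borel_measurable borel"
  shows "(\<integral>\<^sup>+x. f x \<partial>lborel) =
    ennreal (\<Prod>b\<in>Basis. d b) * (\<integral>\<^sup>+x. f (T (\<Sum>b\<in>Basis. (d b * (inv T x \<bullet> b)) *\<^sub>R b)) \<partial>lborel)"
proof -
  note [measurable] = linear_measurable_borel[OF T(1)]
  obtain c where c: "0 < c" "c < \<infinity>" "\<And>f. f \<in> borel_measurable borel \<Longrightarrow> (\<integral>\<^sup>+x. f (T x) \<partial>lborel) = c * (\<integral>\<^sup>+x. f x \<partial>lborel)"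
    by (rule nn_integral_lborel_linear[OF T]) (rule that)
  define D where "D x = (\<Sum>b\<in>Basis. (d b * (x \<bullet> b)) *\<^sub>R b)" for x :: 'a
  have [measurable]: "D \<in> borel_measurable borel" by (simp add: D_def[abs_def])
  have "linear (inv T)" using T by (simp add: inj_linear_imp_inv_linear)
  note [measurable] = linear_measurable_borel[OF this]
  have pd: "(\<Prod>b\<in>Basis. \<bar>d b\<bar>) = (\<Prod>b\<in>Basis. d b)" by (intro prod.cong) (simp_all add: d abs_of_pos)
  have dn: "d b \<noteq> 0" if "b \<in> Basis" for b using d[OF that] by simp
  have D: "(\<integral>\<^sup>+x. g x \<partial>lborel) = ennreal (\<Prod>b\<in>Basis. d b) * (\<integral>\<^sup>+x. g (D x) \<partial>lborel)"
    if [measurable]: "g \<in> borel_measurable borel" for g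
    by (subst lborel_affine_euclidean[of d 0])
      (simp_all add: nn_integral_density nn_integral_distr D_def dn pd nn_integral_cmult)
  have "c * (\<integral>\<^sup>+x. f x \<partial>lborel) = (\<integral>\<^sup>+x. f (T x) \<partial>lborel)" by (simp add: c(3))
  also have "\<dots> = ennreal (\<Prod>b\<in>Basis. d b) * (\<integral>\<^sup>+x. f (T (D x)) \<partial>lborel)" by (rule D) measurable
  also have "(\<integral>\<^sup>+x. f (T (D x)) \<partial>lborel) = (\<integral>\<^sup>+x. f (T (D (inv T (T x)))) \<partial>lborel)"
    using T(2) by simp
  also have "\<dots> = c * (\<integral>\<^sup>+x. f (T (D (inv T x))) \<partial>lborel)" by (rule c(3)) measurable
  finally have "c * (\<integral>\<^sup>+x. f x \<partial>lborel) = c * (ennreal (\<Prod>b\<in>Basis. d b) * (\<integral>\<^sup>+x. f (T (D (inv T x))) \<partial>lborel))"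
    by (simp add: ac_simps)
  then show ?thesis
    unfolding D_def ennreal_mult_cancel_left using c(1,2) by auto
qed


section \<open>The mean value inequality\<close>

text \<open>Cauchy's formula is applied to the holomorphic function f^2, and absolute values are
  taken afterwards, since |f^2| = |f|^2.\<close>

lemma holomorphic_square_circle_mean:
  assumes f: "f holomorphic_on cball 0 1"
  shows "ennreal ((cmod (f 0))\<^sup>2) \<le>
    (\<integral>\<^sup>+t. indicator {0..1} t * ennreal ((cmod (f (cis (2 * pi * t))))\<^sup>2) \<partial>lborel)"
proof -
  define g where "g z = (f z)\<^sup>2" for z
  have g: "g holomorphic_on cball 0 1" unfolding g_def by (intro holomorphic_intros f)
  have cp: "circlepath 0 1 t = cis (2 * pi * t)" for t
    by (simp add: circlepath cis_conv_exp mult_ac)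
  have vd: "vector_derivative (circlepath 0 1) (at t within {0..1}) = 2 * pi * \<i> * cis (2 * pi * t)"
    if "t \<in> {0..1}" for t
    using that by (simp add: vector_derivative_circlepath01 cis_conv_exp mult_ac)
  have "((\<lambda>u. g u / (u - 0)) has_contour_integral (2 * of_real pi * \<i> * g 0)) (circlepath 0 1)"
    by (rule Cauchy_integral_circlepath_simple[OF g]) simp
  then have "((\<lambda>t. g (cis (2*pi*t)) / cis (2*pi*t) * vector_derivative (circlepath 0 1) (at t within {0..1}))
      has_integral (2 * of_real pi * \<i> * g 0)) {0..1}"
    by (simp add: has_contour_integral_def cp)
  then have "((\<lambda>t. (2 * of_real pi * \<i>) * g (cis (2*pi*t))) has_integral (2 * of_real pi * \<i> * g 0)) {0..1}"
    by (rule has_integral_eq[rotated]) (simp add: vd)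
  from has_integral_mult_right[OF this, of "1 / (2 * of_real pi * \<i>)"]
  have I: "((\<lambda>t. g (cis (2*pi*t))) has_integral g 0) {0..1}" by simp
  have cont: "continuous_on {0..1} (\<lambda>t. g (cis (2*pi*t)))"
    by (rule continuous_on_compose2[OF holomorphic_on_imp_continuous_on[OF g]])
      (auto intro!: continuous_intros)
  have "(\<lambda>t. cmod (g (cis (2*pi*t)))) integrable_on {0..1}"
    by (rule integrable_continuous_real) (intro continuous_intros cont)
  then obtain J where J: "((\<lambda>t. cmod (g (cis (2*pi*t)))) has_integral J) {0..1}" by blast
  have "cmod (g 0) \<le> J"
    using integral_norm_bound_integral[of "\<lambda>t. g (cis (2*pi*t))" "{0..1}" "\<lambda>t. cmod (g (cis (2*pi*t)))"] I J
    by (auto simp: has_integral_iff)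
  moreover have "(\<integral>\<^sup>+t. ennreal (indicator {0..1} t * cmod (g (cis (2*pi*t)))) \<partial>lborel) = ennreal J"
    by (rule nn_integral_has_integral_lebesgue[OF _ J]) simp
  ultimately show ?thesis by (simp add: g_def norm_power ennreal_mult' ennreal_leI ennreal_indicator)
qed

text \<open>For |c| = 1 this makes \<open>cscale c\<close> an isometry, hence volume
  preserving.\<close>

lemma norm_cscale: "norm (cscale c w) = cmod c * norm (w :: 'a::euclidean_space \<times> 'a)"
proof -
  have "(norm (cscale c w))\<^sup>2 = (cmod c * norm w)\<^sup>2"
    by (simp only: power_mult_distrib cmod_power2 power2_norm_eq_inner inner_prod_def cscale_def
        fst_conv snd_conv inner_diff_left inner_diff_right inner_add_left inner_add_right
        inner_scaleR_left inner_scaleR_right inner_commute[of "snd w" "fst w"])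
      (simp only: algebra_simps power2_eq_square)
  then show ?thesis by simp
qed

lemma linear_cscale: "linear (cscale c)"
  by (rule linearI) (simp_all add: cscale_def algebra_simps)

lemma linear_cscale_left: "linear (\<lambda>c. cscale c w)"
  by (rule linearI) (simp_all add: cscale_def algebra_simps)

lemma complexification_holomorphic_on_imp_continuous_on:
  "complexification_holomorphic_on F S \<Longrightarrow> continuous_on S F"
  unfolding complexification_holomorphic_on_def continuous_on_eq_continuous_within
  by (meson continuous_at_imp_continuous_at_within has_derivative_continuous)

lemma complexification_holomorphic_on_mult:
  assumes "complexification_holomorphic_on F S" "complexification_holomorphic_on G S"
  shows "complexification_holomorphic_on (\<lambda>z. F z * G z) S"
  unfolding complexification_holomorphic_on_def
proof
  fix z assume "z \<in> S"
  then obtain D E where D: "(F has_derivative D) (at z)" "\<forall>c v. D (cscale c v) = c * D v"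
    and E: "(G has_derivative E) (at z)" "\<forall>c v. E (cscale c v) = c * E v"
    using assms unfolding complexification_holomorphic_on_def by blast
  show "\<exists>D. ((\<lambda>z. F z * G z) has_derivative D) (at z) \<and> (\<forall>c v. D (cscale c v) = c * D v)"
    by (rule exI, rule conjI, rule has_derivative_mult[OF D(1) E(1)])
      (simp add: D(2) E(2) algebra_simps)
qed

lemma holomorphic_on_complex_line:
  assumes F: "complexification_holomorphic_on F S"
    and sub: "\<And>c. c \<in> U \<Longrightarrow> z + cscale c w \<in> S"
  shows "(\<lambda>c. F (z + cscale c w)) holomorphic_on U"
proof (rule holomorphic_onI)
  fix c assume "c \<in> U"
  then obtain D where D: "(F has_derivative D) (at (z + cscale c w))" "\<And>c v. D (cscale c v) = c * D v"
    using F sub unfolding complexification_holomorphic_on_def by blast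
  have "((\<lambda>c. cscale c w) has_derivative (\<lambda>c. cscale c w)) (at c)"
    by (rule bounded_linear_imp_has_derivative)
      (simp flip: linear_conv_bounded_linear add: linear_cscale_left)
  then have "((\<lambda>c. z + cscale c w) has_derivative (\<lambda>c. cscale c w)) (at c)"
    by (auto intro!: derivative_eq_intros)
  from has_derivative_compose[OF this D(1)]
  have "((\<lambda>c. F (z + cscale c w)) has_derivative (\<lambda>h. h * D w)) (at c)" by (simp add: D(2))
  then have "((\<lambda>c. F (z + cscale c w)) has_field_derivative D w) (at c)"
    by (simp add: has_field_derivative_def mult_commute_abs)
  then show "(\<lambda>c. F (z + cscale c w)) field_differentiable at c within U"
    using field_differentiable_at_within field_differentiable_def by blast
qed

text \<open>Each w in the ball gives a disc z + c (A w), |c| \<le> 1, inside \<open>S\<close>, on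
  which the circle mean inequality holds. Averaging over w, exchanging the integrals and using that
  rotations preserve the ball and the measure turns all circle means into one integral over the
  ball.\<close>

lemma sub_mean_value_square:
  fixes F :: "'a::euclidean_space \<times> 'a \<Rightarrow> complex"
  assumes F: "complexification_holomorphic_on F S" and A: "linear (A :: 'a \<Rightarrow> 'a)"
    and sub: "\<And>w. w \<in> ball 0 e \<Longrightarrow> z + (A (fst w), A (snd w)) \<in> S"
  shows "ennreal ((cmod (F z))\<^sup>2) * emeasure lborel (ball (0::'a \<times> 'a) e) \<le>
    (\<integral>\<^sup>+w. indicator (ball 0 e) w * ennreal ((cmod (F (z + (A (fst w), A (snd w)))))\<^sup>2) \<partial>lborel)"
proof -
  define G :: "'a \<times> 'a \<Rightarrow> complex" where "G w = F (z + (A (fst w), A (snd w)))" for w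
  \<comment> \<open>The indicator extends the integrand measurably to the whole space, as nothing is
    known of \<open>F\<close> outside \<open>S\<close>.\<close>
  define h where "h w = indicator (ball 0 e) w * ennreal ((cmod (G w))\<^sup>2)" for w
  have contA: "continuous_on X A" for X
    using A by (simp add: linear_continuous_on linear_conv_bounded_linear)
  have contG: "continuous_on (ball 0 e) G"
    unfolding G_def
  proof (rule continuous_on_compose2[OF complexification_holomorphic_on_imp_continuous_on[OF F]])
    show "continuous_on (ball 0 e) (\<lambda>w. z + (A (fst w), A (snd w)))"
      by (intro continuous_intros continuous_on_compose2[OF contA[of UNIV]]) auto
    show "(\<lambda>w. z + (A (fst w), A (snd w))) ` ball 0 e \<subseteq> S" using sub by blast
  qed
  have hm[measurable]: "h \<in> borel_measurable borel"
  proof -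
    have [measurable]: "(\<lambda>w. indicator (ball 0 e) w *\<^sub>R G w) \<in> borel_measurable borel"
      by (rule borel_measurable_continuous_on_indicator[OF _ contG]) simp
    have "(\<lambda>w. ennreal ((cmod (indicator (ball 0 e) w *\<^sub>R G w))\<^sup>2)) \<in> borel_measurable borel"
      by measurable
    also have "(\<lambda>w. ennreal ((cmod (indicator (ball 0 e) w *\<^sub>R G w))\<^sup>2)) = h"
      by (auto simp: h_def indicator_def)
    finally show ?thesis .
  qed
  define R :: "real \<Rightarrow> 'a \<times> 'a \<Rightarrow> 'a \<times> 'a" where "R t = cscale (cis (2 * pi * t))" for t
  have Rm: "(\<lambda>p. R (snd p) (fst p)) \<in> borel_measurable (borel :: (('a \<times> 'a) \<times> real) measure)"
    unfolding R_def cscale_def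
    by (intro borel_measurable_continuous_onI continuous_intros)
  have [measurable]: "(\<lambda>(w, t). h (R t w)) \<in> borel_measurable (lborel \<Otimes>\<^sub>M lborel)"
    using measurable_compose[OF Rm hm] by (simp add: lborel_prod split_beta')
  have [measurable]: "R t \<in> borel_measurable borel" for t
    unfolding R_def by (rule linear_measurable_borel[OF linear_cscale])
  have nR: "norm (R t w) = norm w" for t w by (simp add: R_def norm_cscale)
  have point: "indicator (ball 0 e) w * ennreal ((cmod (F z))\<^sup>2) \<le> (\<integral>\<^sup>+t. indicator {0..1} t * h (R t w) \<partial>lborel)" for w
  proof (cases "w \<in> ball 0 e")
    case True
    define w' where "w' = (A (fst w), A (snd w))"
    \<comment> \<open>Acting by \<open>A\<close> on both components is complex linear.\<close>
    have cs: "(A (fst (cscale c w)), A (snd (cscale c w))) = cscale c w'" for c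
      by (simp add: cscale_def w'_def linear_add[OF A] linear_diff[OF A] linear_cmul[OF A])
    have "(\<lambda>c. F (z + cscale c w')) holomorphic_on cball 0 1"
    proof (rule holomorphic_on_complex_line[OF F])
      fix c :: complex assume "c \<in> cball 0 1"
      then have "cscale c w \<in> ball 0 e"
        using True mult_right_mono[of "cmod c" 1 "norm w"] by (simp add: norm_cscale)
      from sub[OF this] show "z + cscale c w' \<in> S" by (simp add: cs)
    qed
    from holomorphic_square_circle_mean[OF this] have
      "ennreal ((cmod (F z))\<^sup>2) \<le> (\<integral>\<^sup>+t. indicator {0..1} t * ennreal ((cmod (F (z + cscale (cis (2 * pi * t)) w')))\<^sup>2) \<partial>lborel)"
      by (simp add: cscale_def[of 0] flip: zero_prod_def)
    also have "\<dots> = (\<integral>\<^sup>+t. indicator {0..1} t * h (R t w) \<partial>lborel)"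
    proof (rule nn_integral_cong)
      fix t :: real
      have "R t w \<in> ball 0 e" using True by (simp add: nR)
      then show "indicator {0..1} t * ennreal ((cmod (F (z + cscale (cis (2 * pi * t)) w')))\<^sup>2) = indicator {0..1} t * h (R t w)"
        by (simp add: h_def G_def cs R_def)
    qed
    finally show ?thesis using True by simp
  qed simp
  have "ennreal ((cmod (F z))\<^sup>2) * emeasure lborel (ball (0::'a \<times> 'a) e)
      = (\<integral>\<^sup>+w. indicator (ball 0 e) (w::'a \<times> 'a) * ennreal ((cmod (F z))\<^sup>2) \<partial>lborel)"
    by (subst nn_integral_multc) (simp_all add: mult.commute borel_measurable_indicator)
  also have "\<dots> \<le> (\<integral>\<^sup>+w. \<integral>\<^sup>+t. indicator {0..1} t * h (R t w) \<partial>lborel \<partial>lborel)"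
    by (rule nn_integral_mono) (rule point)
  also have "\<dots> = (\<integral>\<^sup>+t. \<integral>\<^sup>+w. indicator {0..1} t * h (R t w) \<partial>lborel \<partial>lborel)"
    by (rule lborel_pair.Fubini'[symmetric]) measurable
  also have "\<dots> = (\<integral>\<^sup>+t. indicator {0..1} (t::real) * (\<integral>\<^sup>+w. h w \<partial>lborel) \<partial>lborel)"
  proof (rule nn_integral_cong)
    fix t :: real
    have "(\<integral>\<^sup>+w. h (R t w) \<partial>lborel) = (\<integral>\<^sup>+w. h w \<partial>lborel)"
      by (rule nn_integral_lborel_isometry) (simp_all add: R_def linear_cscale norm_cscale hm)
    then show "(\<integral>\<^sup>+w. indicator {0..1} t * h (R t w) \<partial>lborel) = indicator {0..1} t * (\<integral>\<^sup>+w. h w \<partial>lborel)"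
      by (subst nn_integral_cmult) simp_all
  qed
  also have "\<dots> = (\<integral>\<^sup>+w. h w \<partial>lborel)"
    by (subst nn_integral_multc) simp_all
  finally show ?thesis by (simp add: h_def G_def)
qed


section \<open>Spectral decomposition in Euclidean Jordan algebras\<close>

lemma lagrange_poly:
  fixes L :: "real set"
  assumes "finite L" "a \<in> L"
  obtains p where "poly p a = 1" "\<And>b. b \<in> L \<Longrightarrow> b \<noteq> a \<Longrightarrow> poly p b = 0"
proof -
  define q where "q = (\<Prod>b\<in>L - {a}. [:- b, 1:])"
  have q: "poly q y = (\<Prod>b\<in>L - {a}. y - b)" for y by (simp add: q_def poly_prod)
  show ?thesis
  proof (rule that[of "smult (1 / poly q a) q"])
    have "poly q a \<noteq> 0" unfolding q using assms by simp
    then show "poly (smult (1 / poly q a) q) a = 1" by simp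
    show "poly (smult (1 / poly q a) q) b = 0" if "b \<in> L" "b \<noteq> a" for b
      using that assms unfolding poly_smult q by (auto simp: prod_zero_iff)
  qed
qed

context jordan_algebra
begin

lemmas jmul_scale_left = bilinear_lmul[OF bilinear_jmul]
lemmas jmul_scale_right = bilinear_rmul[OF bilinear_jmul]
lemmas jmul_diff_left = bilinear_lsub[OF bilinear_jmul]
lemmas jmul_diff_right = bilinear_rsub[OF bilinear_jmul]
lemmas jmul_zero_left = bilinear_lzero[OF bilinear_jmul]
lemmas jmul_zero_right = bilinear_rzero[OF bilinear_jmul]

lemma jmul_sum_right: "x \<odot> (\<Sum>i\<in>I. f i) = (\<Sum>i\<in>I. x \<odot> f i)"
  by (rule linear_sum[OF linear_jmul])

lemma jmul_sum_left: "(\<Sum>i\<in>I. f i) \<odot> x = (\<Sum>i\<in>I. f i \<odot> x)"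
  using jmul_sum_right[of x f I] by (simp add: jmul_commute)

lemmas jmul_simps = jmul_add_left jmul_add_right jmul_minus_left jmul_minus_right
  jmul_scale_left jmul_scale_right jmul_diff_left jmul_diff_right jmul_zero_left jmul_zero_right

lemma trace_form_commute: "trace_form x y = trace_form y x"
  by (simp add: trace_form_def jmul_commute)

lemma bilinear_trace_form: "bilinear trace_form"
  unfolding bilinear_def trace_form_def op_trace_def
  by (safe; rule linearI)
    (simp_all add: jmul_simps inner_add_left sum.distrib sum_distrib_left)

lemmas trace_form_add_left = bilinear_ladd[OF bilinear_trace_form]
lemmas trace_form_add_right = bilinear_radd[OF bilinear_trace_form]
lemmas trace_form_scale_left = bilinear_lmul[OF bilinear_trace_form]
lemmas trace_form_scale_right = bilinear_rmul[OF bilinear_trace_form]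
lemmas trace_form_diff_left = bilinear_lsub[OF bilinear_trace_form]
lemmas trace_form_diff_right = bilinear_rsub[OF bilinear_trace_form]
lemmas trace_form_zero_left = bilinear_lzero[OF bilinear_trace_form]
lemmas trace_form_zero_right = bilinear_rzero[OF bilinear_trace_form]

lemmas trace_form_simps = trace_form_add_left trace_form_add_right trace_form_scale_left
  trace_form_scale_right trace_form_diff_left trace_form_diff_right trace_form_zero_left
  trace_form_zero_right

lemma trace_form_sum_left: "trace_form (\<Sum>i\<in>I. f i) x = (\<Sum>i\<in>I. trace_form (f i) x)"
  using bilinear_trace_form linear_sum[of "\<lambda>y. trace_form y x"] by (simp add: bilinear_def)

lemma trace_form_sum_right: "trace_form x (\<Sum>i\<in>I. f i) = (\<Sum>i\<in>I. trace_form x (f i))"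
  using bilinear_trace_form linear_sum[of "trace_form x"] by (simp add: bilinear_def)

text \<open>The polarised Jordan identity read as an identity of operators: L((ac)b) is a
  noncommutative polynomial in L(a), L(b), L(c) and L of their pairwise products. With powers of x
  it gives power associativity, with a single idempotent the Peirce relation.\<close>

lemma jmul_operator_identity:
  "((a \<odot> c) \<odot> b) \<odot> w = (c \<odot> b) \<odot> (a \<odot> w) + (a \<odot> b) \<odot> (c \<odot> w) + (a \<odot> c) \<odot> (b \<odot> w)
     - c \<odot> (b \<odot> (a \<odot> w)) - a \<odot> (b \<odot> (c \<odot> w))"
proof -
  have "b \<odot> (a \<odot> w) = (a \<odot> w) \<odot> b" "b \<odot> (c \<odot> w) = (w \<odot> c) \<odot> b"
    "((a \<odot> c) \<odot> b) \<odot> w = w \<odot> ((a \<odot> c) \<odot> b)"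
    "(c \<odot> b) \<odot> (a \<odot> w) = (a \<odot> w) \<odot> (c \<odot> b)"
    "(a \<odot> b) \<odot> (c \<odot> w) = (w \<odot> c) \<odot> (a \<odot> b)" "b \<odot> w = w \<odot> b"
    by (simp_all add: jmul_commute)
  with jordan_identity_polar[of c a w b] show ?thesis by (simp add: algebra_simps)
qed

end

section \<open>Power associativity and spectral decomposition\<close>

context euclidean_jordan_algebra
begin

lemma unit_right: "x \<odot> unit = x"
  using unit_left jmul_commute by metis

text \<open>L(x^(k+2)) is a polynomial in L(x), L(x^2), L(x^k) and L(x^(k+1)), so the induction goes
  back two steps and carries commutation with both L(x) and L(x^2).\<close>

lemma jpower_operators_commute:
  "(\<forall>w. x \<odot> (jpower x k \<odot> w) = jpower x k \<odot> (x \<odot> w)) \<and>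
   (\<forall>w. (x \<odot> x) \<odot> (jpower x k \<odot> w) = jpower x k \<odot> ((x \<odot> x) \<odot> w))"
proof (induction k rule: induct_nat_012)
  case (ge2 k)
  define s p q where "s = x \<odot> x" and "p = jpower x k" and "q = jpower x (Suc k)"
  have comm: "x \<odot> (p \<odot> w) = p \<odot> (x \<odot> w)" "s \<odot> (p \<odot> w) = p \<odot> (s \<odot> w)"
    "x \<odot> (q \<odot> w) = q \<odot> (x \<odot> w)" "s \<odot> (q \<odot> w) = q \<odot> (s \<odot> w)"
    "x \<odot> (s \<odot> w) = s \<odot> (x \<odot> w)" for w
    using ge2 jordan_identity[of x w] unfolding s_def p_def q_def by blast+
  have pq: "x \<odot> p = q" "p \<odot> x = q" "x \<odot> q = jpower x (Suc (Suc k))" "q \<odot> x = jpower x (Suc (Suc k))"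
    unfolding p_def q_def by (simp_all add: jmul_commute)
  have r: "jpower x (Suc (Suc k)) \<odot> w = q \<odot> (x \<odot> w) + s \<odot> (p \<odot> w) + q \<odot> (x \<odot> w)
     - p \<odot> (x \<odot> (x \<odot> w)) - x \<odot> (x \<odot> (p \<odot> w))" for w
    using jmul_operator_identity[of x p x w] unfolding pq s_def[symmetric] by simp
  show ?case unfolding r s_def[symmetric] by (simp add: jmul_simps comm)
qed (simp_all add: unit_left unit_right jordan_identity)

lemma jpower_add: "jpower x i \<odot> jpower x j = jpower x (i + j)"
proof (induction i)
  case (Suc i)
  have "jpower x (Suc i) \<odot> jpower x j = jpower x j \<odot> (x \<odot> jpower x i)"
    by (simp add: jmul_commute)
  also have "\<dots> = x \<odot> (jpower x j \<odot> jpower x i)" using jpower_operators_commute[of x j] by simp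
  also have "jpower x j \<odot> jpower x i = jpower x (i + j)" using Suc by (simp add: jmul_commute)
  finally show ?case by simp
qed (simp add: unit_left)

lemma jpoly_eq_sum:
  assumes "\<And>k. jpower x k = (\<Sum>i\<in>I. f i ^ k *\<^sub>R c i)"
  shows "jpoly p x = (\<Sum>i\<in>I. poly p (f i) *\<^sub>R c i)"
proof -
  have "jpoly p x = (\<Sum>k\<le>degree p. \<Sum>i\<in>I. (coeff p k * f i ^ k) *\<^sub>R c i)"
    by (simp add: jpoly_def assms scaleR_sum_right)
  also have "\<dots> = (\<Sum>i\<in>I. \<Sum>k\<le>degree p. (coeff p k * f i ^ k) *\<^sub>R c i)" by (rule sum.swap)
  also have "\<dots> = (\<Sum>i\<in>I. poly p (f i) *\<^sub>R c i)" by (simp add: poly_altdef scaleR_sum_left)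
  finally show ?thesis .
qed

lemma jpoly_mult: "jpoly p x \<odot> jpoly q x = jpoly (p * q) x"
proof -
  have ext: "jpoly p x = (\<Sum>k\<le>n. coeff p k *\<^sub>R jpower x k)" if "degree p \<le> n" for p n
    unfolding jpoly_def using that
    by (intro sum.mono_neutral_left) (auto simp: coeff_eq_0)
  let ?N = "degree p + degree q"
  have "jpoly (p * q) x = (\<Sum>k\<le>?N. \<Sum>i\<le>k. (coeff p i * coeff q (k - i)) *\<^sub>R jpower x k)"
    by (simp add: ext[OF degree_mult_le] coeff_mult scaleR_sum_left)
  also have "\<dots> = (\<Sum>(i, j) \<in> {(i, j). i + j \<le> ?N}. (coeff p i * coeff q j) *\<^sub>R jpower x (i + j))"
    by (subst sum.triangle_reindex_eq) simp
  also have "\<dots> = (\<Sum>(i, j) \<in> {..degree p} \<times> {..degree q}. (coeff p i * coeff q j) *\<^sub>R jpower x (i + j))"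
  proof (rule sum.mono_neutral_right)
    show "finite {(i, j). i + j \<le> ?N}"
      by (rule finite_subset[of _ "{..?N} \<times> {..?N}"]) auto
  qed (auto intro: le_degree)
  also have "\<dots> = jpoly p x \<odot> jpoly q x"
    unfolding sum.cartesian_product[symmetric]
    by (simp only: jpoly_def jmul_sum_left)
      (simp only: jmul_sum_right jmul_scale_left jmul_scale_right jpower_add scaleR_scaleR,
        simp only: mult.commute)
  finally show ?thesis by simp
qed

text \<open>A complete system of orthogonal idempotents. Excluding 0 makes coefficients unique and
  lets \<open>card\<close> measure how fine the system is.\<close>

definition orthosystem :: "'a set \<Rightarrow> bool" where
  "orthosystem S \<longleftrightarrow> finite S \<and> 0 \<notin> S \<and>
     (\<forall>c\<in>S. \<forall>d\<in>S. c \<odot> d = (if c = d then c else 0)) \<and> \<Sum>S = unit"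

lemma selfadjoint_jmul: "trace_form (x \<odot> u) v = trace_form u (x \<odot> v)"
  using trace_form_assoc[of u x v] by (simp add: jmul_commute)

lemma jmul_eigenbasis:
  obtains T :: "'a \<Rightarrow> 'a" and m :: "'a \<Rightarrow> real" where "linear T" "bij T"
    "\<And>u v. trace_form (T u) (T v) = u \<bullet> v" "\<And>b. b \<in> Basis \<Longrightarrow> x \<odot> T b = m b *\<^sub>R T b"
proof -
  obtain T :: "'a \<Rightarrow> 'a" and m :: "'a \<Rightarrow> real" where T: "linear T"
    "\<And>u v. trace_form (T u) (T v) = u \<bullet> v" "\<And>b. b \<in> Basis \<Longrightarrow> x \<odot> T b = m b *\<^sub>R T b"
    using selfadjoint_eigenbasis[OF bilinear_trace_form trace_form_commute trace_form_pos
        linear_jmul[of x] selfadjoint_jmul[of x]] by blast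
  have "inj T" unfolding linear_injective_0[OF T(1)]
  proof (intro allI impI)
    fix a assume "T a = 0"
    then show "a = 0" using T(2)[of a a] by (simp add: trace_form_zero_left)
  qed
  then have "bij T" using linear_inj_imp_surj[OF T(1)] by (simp add: bij_def)
  show ?thesis by (rule that[OF T(1) \<open>bij T\<close> T(2) T(3)])
qed

text \<open>The idempotents are the components of \<open>unit\<close> in the eigenspaces of L(x).
  Then x^k is the sum of the a^k \<open>c a\<close>, so a Lagrange polynomial evaluated at x returns
  a single \<open>c a\<close>, and multiplicativity of \<open>jpoly\<close> makes these components
  orthogonal idempotents.\<close>

lemma spectral_decomposition:
  obtains S f where "orthosystem S" "x = (\<Sum>c\<in>S. f c *\<^sub>R c)"
proof -
  obtain T :: "'a \<Rightarrow> 'a" and m :: "'a \<Rightarrow> real" where T: "linear T" "bij T"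
    "\<And>u v. trace_form (T u) (T v) = u \<bullet> v" "\<And>b. b \<in> Basis \<Longrightarrow> x \<odot> T b = m b *\<^sub>R T b"
    by (rule jmul_eigenbasis[of x]) (rule that)
  define u where "u = inv T unit"
  have Tu: "T u = unit" using T(2) by (simp add: u_def bij_def surj_f_inv_f)
  define L where "L = m ` Basis"
  have finL: "finite L" by (simp add: L_def)
  define c where "c a = (\<Sum>b\<in>{b\<in>Basis. m b = a}. (u \<bullet> b) *\<^sub>R T b)" for a
  have xc: "x \<odot> c a = a *\<^sub>R c a" for a
  proof -
    have "x \<odot> c a = (\<Sum>b\<in>{b\<in>Basis. m b = a}. (u \<bullet> b) *\<^sub>R (x \<odot> T b))"
      by (simp add: c_def jmul_sum_right jmul_scale_right)
    also have "\<dots> = (\<Sum>b\<in>{b\<in>Basis. m b = a}. a *\<^sub>R (u \<bullet> b) *\<^sub>R T b)"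
      by (rule sum.cong) (auto simp: T(4) mult.commute)
    finally show ?thesis by (simp add: c_def scaleR_sum_right)
  qed
  have pow: "jpower x k = (\<Sum>a\<in>L. a ^ k *\<^sub>R c a)" for k
  proof (induction k)
    case 0
    have "unit = T (\<Sum>b\<in>Basis. (u \<bullet> b) *\<^sub>R b)" by (simp add: euclidean_representation Tu)
    also have "\<dots> = (\<Sum>b\<in>Basis. (u \<bullet> b) *\<^sub>R T b)" by (simp add: linear_sum[OF T(1)] linear_cmul[OF T(1)])
    also have "\<dots> = (\<Sum>a\<in>L. c a)" unfolding c_def L_def by (rule sum.image_gen) simp
    finally show ?case by simp
  next
    case (Suc k)
    then show ?case by (simp add: jmul_sum_right jmul_scale_right xc mult.commute)
  qed
  have orth: "c a \<odot> c b = (if a = b then c a else 0)" if ab: "a \<in> L" "b \<in> L" for a b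
  proof -
    obtain p where p: "poly p a = 1" "\<And>b. b \<in> L \<Longrightarrow> b \<noteq> a \<Longrightarrow> poly p b = 0"
      by (rule lagrange_poly[OF finL ab(1)]) (rule that)
    obtain q where q: "poly q b = 1" "\<And>a. a \<in> L \<Longrightarrow> a \<noteq> b \<Longrightarrow> poly q a = 0"
      by (rule lagrange_poly[OF finL ab(2)]) (rule that)
    have delta: "jpoly p x = c a" if "a \<in> L" "poly p a = 1" "\<And>b. b \<in> L \<Longrightarrow> b \<noteq> a \<Longrightarrow> poly p b = 0" for p a
    proof -
      have "jpoly p x = (\<Sum>b\<in>L. if b = a then c a else 0)"
        unfolding jpoly_eq_sum[OF pow] using that by (intro sum.cong) auto
      then show ?thesis using that finL by simp
    qed
    have "c a \<odot> c b = jpoly (p * q) x"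
      using delta[OF ab(1) p] delta[OF ab(2) q] by (simp add: jpoly_mult[symmetric])
    also have "\<dots> = (if a = b then c a else 0)"
    proof (cases "a = b")
      case True
      then show ?thesis using delta[of a "p * q"] ab p q by simp
    next
      case False
      have "poly p t * poly q t = 0" if "t \<in> L" for t using p q that False by fastforce
      then show ?thesis using False unfolding jpoly_eq_sum[OF pow] by (auto intro!: sum.neutral)
    qed
    finally show ?thesis .
  qed
  \<comment> \<open>L(x) can have eigenvalues, such as half-sums of spectral values, whose
    eigenspace carries no part of \<open>unit\<close>; they are discarded.\<close>
  define K where "K = {a \<in> L. c a \<noteq> 0}"
  have inj: "inj_on c K"
  proof (rule inj_onI)
    fix a b assume ab: "a \<in> K" "b \<in> K" "c a = c b"
    then have "c a \<odot> c b \<noteq> 0" using orth[of a a] by (simp add: K_def)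
    then show "a = b" using orth[of a b] ab by (simp add: K_def split: if_splits)
  qed
  have sumK: "(\<Sum>a\<in>L. g a *\<^sub>R c a) = (\<Sum>s\<in>c ` K. g (the_inv_into K c s) *\<^sub>R s)" for g
  proof -
    have "(\<Sum>s\<in>c ` K. g (the_inv_into K c s) *\<^sub>R s) = (\<Sum>a\<in>K. g a *\<^sub>R c a)"
      by (simp add: sum.reindex[OF inj] the_inv_into_f_f[OF inj])
    also have "\<dots> = (\<Sum>a\<in>L. g a *\<^sub>R c a)"
      using finL by (intro sum.mono_neutral_left) (auto simp: K_def)
    finally show ?thesis by simp
  qed
  show ?thesis
  proof (rule that)
    have "\<Sum>(c ` K) = unit" using sumK[of "\<lambda>_. 1"] pow[of 0] by simp
    moreover have "s \<odot> t = (if s = t then s else 0)" if "s \<in> c ` K" "t \<in> c ` K" for s t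
      using that orth inj_on_eq_iff[OF inj] by (auto simp: K_def)
    ultimately show "orthosystem (c ` K)" using finL by (auto simp: orthosystem_def K_def)
    show "x = (\<Sum>s\<in>c ` K. the_inv_into K c s *\<^sub>R s)"
      using sumK[of "\<lambda>a. a"] pow[of 1] by (simp add: unit_right)
  qed
qed

section \<open>Idempotents and the trace form\<close>

lemma trace_form_nonneg: "trace_form x x \<ge> 0"
  using trace_form_pos[of x] by (cases "x = 0") (auto simp: trace_form_simps)

lemma trace_form_eq_0_iff: "trace_form x x = 0 \<longleftrightarrow> x = 0"
  using trace_form_pos[of x] by (cases "x = 0") (auto simp: trace_form_simps)

lemma trace_form_unit_unit: "trace_form unit unit = DIM('a)"
  by (simp add: trace_form_def op_trace_def unit_left)

lemma trace_form_bounded_below: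
  obtains k where "k > 0" "\<And>v. k * (norm v)\<^sup>2 \<le> trace_form v v"
proof -
  obtain T :: "'a \<Rightarrow> 'a" and m :: "'a \<Rightarrow> real" where T: "linear T" "bij T"
    "\<And>u v. trace_form (T u) (T v) = u \<bullet> v" "\<And>b. b \<in> Basis \<Longrightarrow> unit \<odot> T b = m b *\<^sub>R T b"
    by (rule jmul_eigenbasis[of unit]) (rule that)
  obtain B where B: "B > 0" "\<And>x. norm (T x) \<le> B * norm x"
    using linear_bounded_pos[OF T(1)] by blast
  show ?thesis
  proof
    show "1 / B\<^sup>2 > 0" using B by simp
    fix v
    define u where "u = inv T v"
    have v: "v = T u" using T(2) by (simp add: u_def bij_is_surj surj_f_inv_f)
    have "(norm v)\<^sup>2 \<le> (B * norm u)\<^sup>2" unfolding v by (intro power_mono B(2)) simp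
    then show "1 / B\<^sup>2 * (norm v)\<^sup>2 \<le> trace_form v v"
      using B(1) by (simp add: v T(3) power2_norm_eq_inner power_mult_distrib field_simps)
  qed
qed

text \<open>The case a = b = c of \<open>jmul_operator_identity\<close>; in factored form L(c) (2
  L(c) - 1) (L(c) - 1) = 0.\<close>

lemma idempotent_cubic:
  assumes "c \<odot> c = c"
  shows "c \<odot> w = 3 *\<^sub>R (c \<odot> (c \<odot> w)) - 2 *\<^sub>R (c \<odot> (c \<odot> (c \<odot> w)))"
proof -
  have "c \<odot> w = c \<odot> (c \<odot> w) + c \<odot> (c \<odot> w) + c \<odot> (c \<odot> w) - c \<odot> (c \<odot> (c \<odot> w)) - c \<odot> (c \<odot> (c \<odot> w))"
    using jmul_operator_identity[of c c c w] unfolding assms by simp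
  moreover have "3 *\<^sub>R z = z + z + z" for z :: 'a
    using scaleR_left.add[of 2 1 z] by (simp add: scaleR_2)
  ultimately show ?thesis by (simp only: scaleR_2 diff_diff_eq)
qed

text \<open>By the cubic relation, multiplication by an idempotent has its eigenvalues \<open>t\<close> in
  \<open>{0, 1/2, 1}\<close>, where \<open>t = t\<^sup>2 + 4 (t\<^sup>2 - t)\<^sup>2\<close>.\<close>

lemma trace_form_idempotent_eq:
  assumes "c \<odot> c = c"
  shows "trace_form (c \<odot> v) v = trace_form (c \<odot> v) (c \<odot> v)
    + 4 * trace_form (c \<odot> (c \<odot> v) - c \<odot> v) (c \<odot> (c \<odot> v) - c \<odot> v)"
proof -
  define t1 t2 t3 t4 where "t1 = trace_form v (c \<odot> v)" and "t2 = trace_form v (c \<odot> (c \<odot> v))"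
    and "t3 = trace_form v (c \<odot> (c \<odot> (c \<odot> v)))" and "t4 = trace_form v (c \<odot> (c \<odot> (c \<odot> (c \<odot> v))))"
  have 1: "t1 = 3 * t2 - 2 * t3"
    unfolding t1_def t2_def t3_def by (subst idempotent_cubic[OF assms]) (simp add: trace_form_simps)
  have 2: "t2 = 3 * t3 - 2 * t4"
    unfolding t2_def t3_def t4_def by (subst idempotent_cubic[OF assms]) (simp add: trace_form_simps)
  have "trace_form (c \<odot> v) (c \<odot> v) = t2"
    "trace_form (c \<odot> (c \<odot> v) - c \<odot> v) (c \<odot> (c \<odot> v) - c \<odot> v) = t4 - 2 * t3 + t2"
    by (simp_all add: selfadjoint_jmul trace_form_simps t1_def t2_def t3_def t4_def)
  moreover have "trace_form (c \<odot> v) v = t1" by (simp add: t1_def trace_form_commute)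
  ultimately show ?thesis using 1 2 by simp
qed

text \<open>As d = d^2, the value equals \<open>trace_form (c \<odot> d) d\<close>, which the
  preceding identity writes as a sum of squares, the first being the squared length of
  \<open>c \<odot> d\<close>.\<close>

lemma trace_form_idempotent_nonneg:
  assumes "c \<odot> c = c" "d \<odot> d = d"
  shows "trace_form c d \<ge> 0" and "trace_form c d = 0 \<Longrightarrow> c \<odot> d = 0"
proof -
  have "trace_form c d = trace_form (c \<odot> d) d"
    using trace_form_assoc[of c d d] assms(2) by simp
  then have eq: "trace_form c d = trace_form (c \<odot> d) (c \<odot> d)
    + 4 * trace_form (c \<odot> (c \<odot> d) - c \<odot> d) (c \<odot> (c \<odot> d) - c \<odot> d)"
    using trace_form_idempotent_eq[OF assms(1)] by simp
  show "trace_form c d \<ge> 0" unfolding eq by (simp add: trace_form_nonneg)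
  assume "trace_form c d = 0"
  then have "trace_form (c \<odot> d) (c \<odot> d) = 0"
    using eq trace_form_nonneg[of "c \<odot> d"] trace_form_nonneg[of "c \<odot> (c \<odot> d) - c \<odot> d"] by linarith
  then show "c \<odot> d = 0" by (simp add: trace_form_eq_0_iff)
qed

lemma idempotent_complement: "c \<odot> c = c \<Longrightarrow> (unit - c) \<odot> (unit - c) = unit - c"
  by (simp add: jmul_simps unit_left unit_right)

lemma trace_form_idempotent_unit: "c \<odot> c = c \<Longrightarrow> trace_form c unit = trace_form c c"
  using trace_form_assoc[of c c unit] by (simp add: unit_right)

text \<open>If |xy| \<le> K |x| |y|, a nonzero idempotent satisfies |c| \<ge> 1/K. Since the traces
  in an orthosystem add up to the dimension, this limits its size; it also fixes the radius in
  \<open>unit_plus_small_in_pcone\<close>.\<close>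

lemma idempotent_trace_form_bounded_below:
  obtains k where "k > 0" "\<And>c. c \<odot> c = c \<Longrightarrow> c \<noteq> 0 \<Longrightarrow> k \<le> trace_form c c"
proof -
  obtain k where k: "k > 0" "\<And>v. k * (norm v)\<^sup>2 \<le> trace_form v v"
    by (rule trace_form_bounded_below) (rule that)
  obtain K where K: "K > 0" "\<And>x y. norm (x \<odot> y) \<le> norm x * norm y * K"
    using bounded_bilinear.pos_bounded[OF bilinear_jmul[unfolded bilinear_conv_bounded_bilinear]] by blast
  show ?thesis
  proof
    show "k * (1 / K)\<^sup>2 > 0" using k K by simp
    fix c assume c: "c \<odot> c = c" "c \<noteq> 0"
    have "norm c \<le> norm c * norm c * K" using K(2)[of c c] c by simp
    then have "1 / K \<le> norm c" using c K(1) by (simp add: field_simps)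
    then have "(1 / K)\<^sup>2 \<le> (norm c)\<^sup>2" using K(1) by (intro power_mono) auto
    then have "k * (1 / K)\<^sup>2 \<le> k * (norm c)\<^sup>2" using k(1) by simp
    then show "k * (1 / K)\<^sup>2 \<le> trace_form c c" using k(2)[of c] by linarith
  qed
qed

lemma orthosystemD:
  assumes "orthosystem S"
  shows "finite S" "c \<in> S \<Longrightarrow> c \<noteq> 0" "c \<in> S \<Longrightarrow> c \<odot> c = c"
    "c \<in> S \<Longrightarrow> d \<in> S \<Longrightarrow> c \<noteq> d \<Longrightarrow> c \<odot> d = 0" "\<Sum>S = unit"
  using assms by (auto simp: orthosystem_def)

lemma orthosystem_sum_mult:
  assumes S: "orthosystem S"
  shows "(\<Sum>c\<in>S. f c *\<^sub>R c) \<odot> (\<Sum>c\<in>S. g c *\<^sub>R c) = (\<Sum>c\<in>S. (f c * g c) *\<^sub>R c)"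
proof -
  have "(f c *\<^sub>R c) \<odot> (\<Sum>d\<in>S. g d *\<^sub>R d) = (f c * g c) *\<^sub>R c" if "c \<in> S" for c
  proof -
    have "(f c *\<^sub>R c) \<odot> (\<Sum>d\<in>S. g d *\<^sub>R d) = (\<Sum>d\<in>S. if d = c then (f c * g c) *\<^sub>R c else 0)"
      unfolding jmul_sum_right
      by (rule sum.cong) (use orthosystemD[OF S] that in \<open>auto simp: jmul_simps\<close>)
    then show ?thesis using that orthosystemD(1)[OF S] by simp
  qed
  then show ?thesis by (simp add: jmul_sum_left)
qed

lemma orthosystem_trace_form_sum:
  assumes S: "orthosystem S"
  shows "trace_form (\<Sum>c\<in>S. f c *\<^sub>R c) (\<Sum>c\<in>S. g c *\<^sub>R c) = (\<Sum>c\<in>S. f c * g c * trace_form c c)"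
proof -
  have "trace_form (\<Sum>c\<in>S. f c *\<^sub>R c) (\<Sum>c\<in>S. g c *\<^sub>R c)
    = trace_form ((\<Sum>c\<in>S. f c *\<^sub>R c) \<odot> (\<Sum>c\<in>S. g c *\<^sub>R c)) unit"
    by (simp add: trace_form_assoc unit_right)
  also have "\<dots> = (\<Sum>c\<in>S. f c * g c * trace_form c c)"
    unfolding orthosystem_sum_mult[OF S] trace_form_sum_left
    by (intro sum.cong) (simp_all add: trace_form_simps trace_form_idempotent_unit orthosystemD(3)[OF S])
  finally show ?thesis .
qed

lemma orthosystem_sum_trace_form:
  assumes S: "orthosystem S"
  shows "(\<Sum>c\<in>S. trace_form c c) = DIM('a)"
  using orthosystem_trace_form_sum[OF S, of "\<lambda>_. 1" "\<lambda>_. 1"] orthosystemD(5)[OF S]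
  by (simp add: trace_form_unit_unit)

section \<open>Primitive idempotents and Jordan frames\<close>

definition primitive :: "'a \<Rightarrow> bool" where
  "primitive c \<longleftrightarrow> c \<noteq> 0 \<and> c \<odot> c = c \<and>
     (\<forall>a b. a \<odot> a = a \<and> b \<odot> b = b \<and> a \<odot> b = 0 \<and> c = a + b \<longrightarrow> a = 0 \<or> b = 0)"

definition jordan_frame :: "'a set \<Rightarrow> bool" where
  "jordan_frame S \<longleftrightarrow> orthosystem S \<and> (\<forall>c\<in>S. primitive c)"

text \<open>If c = a + b splits and d is another member, then \<open>trace_form a d\<close> and
  \<open>trace_form b d\<close> are nonnegative with sum 0, so a and b are orthogonal to d and can
  replace c, both inheriting its coefficient.\<close>

lemma orthosystem_refine:
  assumes S: "orthosystem S" and x: "x = (\<Sum>c\<in>S. f c *\<^sub>R c)" and c: "c \<in> S" "\<not> primitive c"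
  obtains S' f' where "orthosystem S'" "x = (\<Sum>c\<in>S'. f' c *\<^sub>R c)" "card S < card S'"
proof -
  note D = orthosystemD[OF S]
  obtain a b where ab: "a \<odot> a = a" "b \<odot> b = b" "a \<odot> b = 0" "c = a + b" "a \<noteq> 0" "b \<noteq> 0"
    using c D unfolding primitive_def by blast
  have ba: "b \<odot> a = 0" using ab(3) jmul_commute by simp
  have orth: "a \<odot> d = 0" "b \<odot> d = 0" if "d \<in> S - {c}" for d
  proof -
    have d: "d \<odot> d = d" "c \<odot> d = 0" using that c D by auto
    have "trace_form c d = trace_form (c \<odot> d) unit" by (simp add: trace_form_assoc unit_right)
    then have "trace_form a d + trace_form b d = 0"
      using d by (simp add: ab trace_form_simps)
    then have "trace_form a d = 0" "trace_form b d = 0"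
      using trace_form_idempotent_nonneg(1)[OF ab(1) d(1)] trace_form_idempotent_nonneg(1)[OF ab(2) d(1)] by auto
    then show "a \<odot> d = 0" "b \<odot> d = 0"
      using trace_form_idempotent_nonneg(2)[OF _ d(1)] ab by auto
  qed
  have nin: "a \<notin> S - {c}" "b \<notin> S - {c}" "a \<noteq> b"
    using orth[of a] orth[of b] ab by auto
  define S' where "S' = insert a (insert b (S - {c}))"
  have fin: "finite (S - {c})" using D(1) by simp
  have sum': "(\<Sum>s\<in>S'. g s) = g a + g b + (\<Sum>s\<in>S - {c}. g s)" for g :: "'a \<Rightarrow> 'a"
    unfolding S'_def using fin nin by (simp add: add.assoc)
  define f' where "f' s = (if s \<in> S - {c} then f s else f c)" for s
  show ?thesis
  proof
    have "\<Sum>S' = unit"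
      using sum'[of "\<lambda>s. s"] sum.remove[OF D(1) c(1), of "\<lambda>s. s"] ab(4) D(5) by simp
    moreover have "s \<odot> t = (if s = t then s else 0)" if "s \<in> S'" "t \<in> S'" for s t
    proof -
      have "d \<odot> a = 0" "d \<odot> b = 0" if "d \<in> S - {c}" for d using orth[OF that] jmul_commute by simp_all
      then show ?thesis using that ab ba nin D orth unfolding S'_def by auto
    qed
    ultimately show "orthosystem S'" using fin ab D unfolding orthosystem_def S'_def by auto
    have "(\<Sum>s\<in>S - {c}. f' s *\<^sub>R s) = (\<Sum>s\<in>S - {c}. f s *\<^sub>R s)"
      by (rule sum.cong) (auto simp: f'_def)
    moreover have "f' a = f c" "f' b = f c" using nin by (simp_all add: f'_def)
    ultimately show "x = (\<Sum>s\<in>S'. f' s *\<^sub>R s)"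
      using sum'[of "\<lambda>s. f' s *\<^sub>R s"] sum.remove[OF D(1) c(1), of "\<lambda>s. f s *\<^sub>R s"] ab(4) x
      by (simp add: scaleR_add_right)
    have "card S' = Suc (Suc (card (S - {c})))" using fin nin by (simp add: S'_def)
    then show "card S < card S'" using card_Suc_Diff1[OF D(1) c(1)] by simp
  qed
qed

text \<open>Among the orthosystems in which x is diagonal there is one of largest cardinality, as
  the cardinality is at most the dimension over \<open>k\<close>; by
  \<open>orthosystem_refine\<close> its members are primitive.\<close>

lemma jordan_frame_decomposition:
  obtains S f where "jordan_frame S" "x = (\<Sum>c\<in>S. f c *\<^sub>R c)"
proof -
  define P where "P p \<longleftrightarrow> orthosystem (fst p) \<and> x = (\<Sum>c\<in>fst p. snd p c *\<^sub>R c)"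
    for p :: "'a set \<times> ('a \<Rightarrow> real)"
  obtain k where k: "k > 0" "\<And>c. c \<odot> c = c \<Longrightarrow> c \<noteq> 0 \<Longrightarrow> k \<le> trace_form c c"
    by (rule idempotent_trace_form_bounded_below) (rule that)
  have bound: "card (fst p) < nat \<lceil>DIM('a) / k\<rceil> + 1" if "P p" for p
  proof -
    have S: "orthosystem (fst p)" using that by (simp add: P_def)
    have "card (fst p) * k \<le> (\<Sum>c\<in>fst p. trace_form c c)"
      by (rule sum_bounded_below) (use k orthosystemD[OF S] in auto)
    then have "card (fst p) \<le> DIM('a) / k"
      using k(1) by (simp add: orthosystem_sum_trace_form[OF S] field_simps)
    then show ?thesis by linarith
  qed
  obtain S0 f0 where "orthosystem S0" "x = (\<Sum>c\<in>S0. f0 c *\<^sub>R c)"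
    by (rule spectral_decomposition[of x]) (rule that)
  then have "P (S0, f0)" by (simp add: P_def)
  then obtain p where p: "P p" "\<And>q. P q \<Longrightarrow> card (fst q) \<le> card (fst p)"
    using ex_has_greatest_nat[of P "(S0, f0)" "\<lambda>p. card (fst p)"] bound by (metis less_imp_le)
  then have S: "orthosystem (fst p)" and x: "x = (\<Sum>c\<in>fst p. snd p c *\<^sub>R c)" by (simp_all add: P_def)
  have "primitive c" if cS: "c \<in> fst p" for c
  proof (rule ccontr)
    assume np: "\<not> primitive c"
    obtain S' f' where "orthosystem S'" "x = (\<Sum>c\<in>S'. f' c *\<^sub>R c)" "card (fst p) < card S'"
      by (rule orthosystem_refine[OF S x cS np]) (rule that)
    with p(2)[of "(S', f')"] show False by (simp add: P_def)
  qed
  then show ?thesis using that[of "fst p" "snd p"] p(1) by (simp add: P_def jordan_frame_def)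
qed

text \<open>The Peirce space V_1(c) is a line: each idempotent d occurring in u satisfies d (unit -
  c) = 0, so c = d + (c - d) is an orthogonal splitting and primitivity gives d = c.\<close>

lemma primitive_eigenspace:
  assumes c: "primitive c" and u: "c \<odot> u = u"
  obtains t where "u = t *\<^sub>R c"
proof -
  have cc: "c \<odot> c = c" using c by (simp add: primitive_def)
  obtain S f where S: "orthosystem S" and uS: "u = (\<Sum>d\<in>S. f d *\<^sub>R d)"
    by (rule spectral_decomposition[of u]) (rule that)
  note D = orthosystemD[OF S]
  note ec = idempotent_complement[OF cc]
  have "u \<odot> (unit - c) = 0" using u jmul_commute[of u c] by (simp add: jmul_simps unit_right)
  \<comment> \<open>Passing to u^2 makes the coefficients nonnegative, so that a vanishing sum
    forces each term to vanish.\<close>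
  then have "trace_form (u \<odot> u) (unit - c) = 0"
    by (simp only: trace_form_assoc trace_form_zero_right)
  moreover have "u \<odot> u = (\<Sum>d\<in>S. (f d * f d) *\<^sub>R d)"
    using orthosystem_sum_mult[OF S, of f f] by (simp add: uS)
  ultimately have "(\<Sum>d\<in>S. (f d * f d) * trace_form d (unit - c)) = 0"
    by (simp add: trace_form_sum_left trace_form_scale_left)
  moreover have "(f d * f d) * trace_form d (unit - c) \<ge> 0" if "d \<in> S" for d
    using trace_form_idempotent_nonneg(1)[OF D(3)[OF that] ec] by simp
  ultimately have z: "(f d * f d) * trace_form d (unit - c) = 0" if "d \<in> S" for d
    using that D(1) by (simp add: sum_nonneg_eq_0_iff)
  have dc: "d = c" if d: "d \<in> S" "f d \<noteq> 0" for d
  proof -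
    have "trace_form d (unit - c) = 0" using z[OF d(1)] d(2) by simp
    then have "d \<odot> (unit - c) = 0" using trace_form_idempotent_nonneg(2)[OF D(3)[OF d(1)] ec] by simp
    then have "d \<odot> c = d" "c \<odot> d = d" by (simp_all add: jmul_simps unit_right jmul_commute)
    then have "(c - d) \<odot> (c - d) = c - d" "d \<odot> (c - d) = 0"
      using cc D(3)[OF d(1)] by (simp_all add: jmul_simps)
    then have "d = 0 \<or> c - d = 0"
      using c D(3)[OF d(1)] unfolding primitive_def by (metis add_diff_cancel_left' diff_add_cancel add.commute)
    then show ?thesis using D(2)[OF d(1)] by simp
  qed
  have "u = (\<Sum>d\<in>S. if d = c then f c *\<^sub>R c else 0)"
    unfolding uS by (rule sum.cong) (use dc in auto)
  then have "u = (if c \<in> S then f c else 0) *\<^sub>R c" using D(1) by simp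
  then show ?thesis by (rule that)
qed

text \<open>The Peirce projection \<open>2 L(c)\<^sup>2 - L(c)\<close> onto \<open>V\<^sub>1(c) = \<real>c\<close>.\<close>

lemma primitive_projection:
  assumes c: "primitive c"
  shows "2 *\<^sub>R (c \<odot> (c \<odot> v)) - c \<odot> v = (trace_form v c / trace_form c c) *\<^sub>R c"
proof -
  let ?u = "2 *\<^sub>R (c \<odot> (c \<odot> v)) - c \<odot> v"
  have cc: "c \<odot> c = c" "c \<noteq> 0" using c by (auto simp: primitive_def)
  have "c \<odot> ?u - ?u = c \<odot> v - (3 *\<^sub>R (c \<odot> (c \<odot> v)) - 2 *\<^sub>R (c \<odot> (c \<odot> (c \<odot> v))))"
    using scaleR_left.add[of 2 1 "c \<odot> (c \<odot> v)"] by (simp add: jmul_simps)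
  then have "c \<odot> ?u = ?u" using idempotent_cubic[OF cc(1), of v] by simp
  then obtain t where t: "?u = t *\<^sub>R c" by (rule primitive_eigenspace[OF c])
  have "trace_form ?u c = trace_form v c"
    using cc by (simp add: trace_form_simps selfadjoint_jmul)
  then have "t * trace_form c c = trace_form v c" unfolding t by (simp add: trace_form_simps)
  then have "t = trace_form v c / trace_form c c"
    using trace_form_pos[OF cc(2)] by (simp add: field_simps)
  with t show ?thesis by simp
qed

text \<open>The symmetric quantity \<open>2 * trace_form (c \<odot> d) (c \<odot> d)\<close> is
  computed with the Peirce projection of c and again with that of d; the results differ only in the
  denominators \<open>trace_form c c\<close> and \<open>trace_form d d\<close>.\<close>

lemma primitive_trace_form_eq:
  assumes c: "primitive c" and d: "primitive d" and cd: "trace_form c d \<noteq> 0"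
  shows "trace_form c c = trace_form d d"
proof -
  have key: "2 * trace_form (c \<odot> d) (c \<odot> d) = (trace_form c d)\<^sup>2 / trace_form c c + trace_form c d"
    if c: "primitive c" and d: "primitive d" for c d
  proof -
    have cc: "c \<odot> c = c" and dd: "d \<odot> d = d" using c d by (auto simp: primitive_def)
    have "2 * trace_form (c \<odot> d) (c \<odot> d) = trace_form (2 *\<^sub>R (c \<odot> (c \<odot> d)) - c \<odot> d) d + trace_form (c \<odot> d) d"
      by (simp add: trace_form_simps selfadjoint_jmul)
    also have "trace_form (c \<odot> d) d = trace_form c d" using dd by (simp add: trace_form_assoc)
    also have "trace_form (2 *\<^sub>R (c \<odot> (c \<odot> d)) - c \<odot> d) d = (trace_form c d)\<^sup>2 / trace_form c c"
      unfolding primitive_projection[OF c]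
      by (simp add: trace_form_simps trace_form_commute[of d c] power2_eq_square)
    finally show ?thesis .
  qed
  have pos: "trace_form c c > 0" "trace_form d d > 0"
    using c d trace_form_pos by (auto simp: primitive_def)
  have "(trace_form c d)\<^sup>2 / trace_form c c = (trace_form c d)\<^sup>2 / trace_form d d"
    using key[OF c d] key[OF d c] by (simp add: jmul_commute[of d c] trace_form_commute[of d c])
  then show ?thesis using cd pos by (simp add: field_simps)
qed

lemma span_jmul_zero:
  assumes "\<And>a b. a \<in> A \<Longrightarrow> b \<in> B \<Longrightarrow> a \<odot> b = 0" "x \<in> span A" "y \<in> span B"
  shows "x \<odot> y = 0"
proof -
  have 1: "a \<odot> y = 0" if "a \<in> A" for a
    using assms(3) by (induction rule: span_induct_alt) (simp_all add: jmul_simps assms(1) that)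
  show ?thesis using assms(2)
    by (induction rule: span_induct_alt) (simp_all add: jmul_simps 1)
qed

end

text \<open>Primitive idempotents of different trace are orthogonal, so those of one given trace
  span an ideal.\<close>

lemma (in simple_euclidean_jordan_algebra) primitive_trace_form_const:
  assumes c: "primitive c" and d: "primitive d"
  shows "trace_form c c = trace_form d d"
proof (rule ccontr)
  assume ne: "trace_form c c \<noteq> trace_form d d"
  define P where "P = {a. primitive a \<and> trace_form a a = trace_form c c}"
  define Q where "Q = {a. primitive a \<and> trace_form a a \<noteq> trace_form c c}"
  have PQ: "x \<odot> y = 0" if "x \<in> span P" "y \<in> span Q" for x y
  proof (rule span_jmul_zero[OF _ that])
    fix a b assume "a \<in> P" "b \<in> Q"
    then show "a \<odot> b = 0"
      using primitive_trace_form_eq[of a b] trace_form_idempotent_nonneg(2)[of a b]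
      by (auto simp: P_def Q_def primitive_def)
  qed
  have dec: "\<exists>p\<in>span P. \<exists>q\<in>span Q. x = p + q" for x
  proof -
    obtain S f where S: "jordan_frame S" and x: "x = (\<Sum>s\<in>S. f s *\<^sub>R s)"
      by (rule jordan_frame_decomposition[of x]) (rule that)
    have fin: "finite S" and prim: "\<And>s. s \<in> S \<Longrightarrow> primitive s"
      using S by (auto simp: jordan_frame_def orthosystem_def)
    have "x = (\<Sum>s\<in>S \<inter> P. f s *\<^sub>R s) + (\<Sum>s\<in>S - P. f s *\<^sub>R s)"
      unfolding x by (rule sum.Int_Diff[OF fin])
    moreover have "(\<Sum>s\<in>S \<inter> P. f s *\<^sub>R s) \<in> span P"
      by (intro span_sum span_scale span_base) auto
    moreover have "(\<Sum>s\<in>S - P. f s *\<^sub>R s) \<in> span Q"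
      by (intro span_sum span_scale span_base) (use prim in \<open>auto simp: P_def Q_def\<close>)
    ultimately show ?thesis by blast
  qed
  have "ideal (span P)"
    unfolding ideal_def
  proof (intro conjI allI ballI)
    fix x y assume y: "y \<in> span P"
    obtain a b where ab: "a \<in> span P" "b \<in> span Q" "x = a + b" using dec by blast
    obtain p q where pq: "p \<in> span P" "q \<in> span Q" "a \<odot> y = p + q" using dec by blast
    \<comment> \<open>By associativity of the trace form, q is orthogonal to
      \<open>a \<odot> y\<close> and to p, hence to itself.\<close>
    have "trace_form (a \<odot> y) q = 0"
      using PQ[OF y pq(2)] by (simp add: trace_form_assoc trace_form_simps)
    moreover have "trace_form p q = trace_form (p \<odot> q) unit" by (simp add: trace_form_assoc unit_right)
    then have "trace_form p q = 0" using PQ[OF pq(1,2)] by (simp add: trace_form_simps)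
    ultimately have "q = 0" unfolding pq(3) by (simp add: trace_form_simps trace_form_eq_0_iff)
    moreover have "b \<odot> y = 0" using PQ[OF y ab(2)] jmul_commute by simp
    ultimately show "x \<odot> y \<in> span P" using pq ab by (simp add: jmul_simps)
  qed simp
  moreover have "c \<in> span P" using c by (auto simp: P_def intro: span_base)
  then have "span P \<noteq> {0}" using c by (auto simp: primitive_def)
  ultimately have "span P = UNIV" using simple by blast
  then have "d \<in> span P" by simp
  moreover have "d \<in> span Q" using d ne by (auto simp: Q_def intro: span_base)
  ultimately have "d \<odot> d = 0" by (rule PQ)
  then show False using d by (auto simp: primitive_def)
qed


section \<open>Rank, determinant and cone\<close>

text \<open>Logarithmic derivative: with G a = a / (1 - a X), whose coefficient at X^k is a^(k+1),
  the derivative of \<open>E\<close> is -\<open>E\<close> times the sum of the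
  \<open>G (f c)\<close>, and coefficients at X^k are compared. Coefficient j of \<open>E\<close> is
  (-1)^j times the j-th elementary symmetric function.\<close>

lemma newton_identity:
  fixes f :: "'i \<Rightarrow> real"
  assumes "finite S"
  defines "E \<equiv> (\<Prod>c\<in>S. 1 - fps_const (f c) * fps_X)"
  shows "of_nat (Suc k) * fps_nth E (Suc k) = - (\<Sum>j\<le>k. fps_nth E j * (\<Sum>c\<in>S. f c ^ (Suc k - j)))"
proof -
  define G where "G a = Abs_fps (\<lambda>k. a ^ Suc k)" for a :: real
  have G: "(1 - fps_const a * fps_X) * G a = fps_const a" for a
    by (rule fps_ext) (auto simp: G_def algebra_simps fps_X_mult_nth mult.assoc split: nat.split dest: gr0_implies_Suc)
  have "fps_deriv E = - E * (\<Sum>c\<in>S. G (f c))"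
    unfolding E_def using assms(1)
  proof (induction S rule: finite_induct)
    case (insert c S)
    let ?E = "\<Prod>c\<in>S. 1 - fps_const (f c) * fps_X" and ?P = "\<Sum>c\<in>S. G (f c)"
      and ?l = "1 - fps_const (f c) * fps_X"
    have "fps_deriv (?l * ?E) = ?l * (- ?E * ?P) - fps_const (f c) * ?E"
      using insert.IH by (simp add: algebra_simps)
    also have "\<dots> = ?l * (- ?E * ?P) - (?l * G (f c)) * ?E" by (simp add: G)
    also have "\<dots> = - (?l * ?E) * (G (f c) + ?P)" by (simp add: algebra_simps)
    finally show ?case using insert.hyps by simp
  qed simp
  then have "fps_nth (fps_deriv E) k = fps_nth (- E * (\<Sum>c\<in>S. G (f c))) k" by simp
  then show ?thesis
    by (simp add: fps_mult_nth fps_sum_nth G_def atLeast0AtMost Suc_diff_le sum_negf)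
qed

lemma fps_prod_linear_nth_card:
  fixes f :: "'i \<Rightarrow> real"
  assumes "finite S"
  shows "fps_nth (\<Prod>c\<in>S. 1 - fps_const (f c) * fps_X) (card S) = (-1) ^ card S * (\<Prod>c\<in>S. f c)"
proof -
  \<comment> \<open>The vanishing of higher coefficients is added because the induction step meets
    coefficient \<open>Suc (card S)\<close> of the shorter product.\<close>
  have "(\<forall>k>card S. fps_nth (\<Prod>c\<in>S. 1 - fps_const (f c) * fps_X) k = 0) \<and> ?thesis"
    using assms
  proof (induction S rule: finite_induct)
    case (insert c S)
    let ?E = "\<Prod>c\<in>S. 1 - fps_const (f c) * fps_X"
    have "fps_nth ((1 - fps_const (f c) * fps_X) * ?E) (Suc k) = fps_nth ?E (Suc k) - f c * fps_nth ?E k" for k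
      by (simp add: algebra_simps fps_X_mult_nth mult.assoc)
    then show ?case using insert by (auto simp: Suc_less_eq2)
  qed simp
  then show ?thesis ..
qed

section \<open>Minimal polynomials, polynomial functions and the closed cone\<close>

context euclidean_jordan_algebra
begin

lemma orthosystem_jpower:
  assumes S: "orthosystem S"
  shows "jpower (\<Sum>c\<in>S. f c *\<^sub>R c) k = (\<Sum>c\<in>S. f c ^ k *\<^sub>R c)"
  by (induction k) (simp_all add: orthosystem_sum_mult[OF S] orthosystemD(5)[OF S])

lemma orthosystem_jpoly:
  assumes S: "orthosystem S"
  shows "jpoly p (\<Sum>c\<in>S. f c *\<^sub>R c) = (\<Sum>c\<in>S. poly p (f c) *\<^sub>R c)"
  by (rule jpoly_eq_sum) (rule orthosystem_jpower[OF S])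

lemma orthosystem_trace_form_pos: "orthosystem S \<Longrightarrow> c \<in> S \<Longrightarrow> trace_form c c > 0"
  using orthosystemD(2) trace_form_pos by blast

lemma orthosystem_sum_eq_0_iff:
  assumes S: "orthosystem S"
  shows "(\<Sum>c\<in>S. g c *\<^sub>R c) = 0 \<longleftrightarrow> (\<forall>c\<in>S. g c = 0)"
proof
  assume "(\<Sum>c\<in>S. g c *\<^sub>R c) = 0"
  then have "(\<Sum>c\<in>S. g c * g c * trace_form c c) = 0"
    using orthosystem_trace_form_sum[OF S, of g g] by (simp add: trace_form_simps)
  moreover have "g c * g c * trace_form c c \<ge> 0" if "c \<in> S" for c
    by (simp add: trace_form_nonneg)
  ultimately have "g c * g c * trace_form c c = 0" if "c \<in> S" for c
    using that orthosystemD(1)[OF S] by (simp add: sum_nonneg_eq_0_iff)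
  then show "\<forall>c\<in>S. g c = 0" using orthosystem_trace_form_pos[OF S] by fastforce
qed simp

lemma orthosystem_sum_cong_iff:
  assumes S: "orthosystem S"
  shows "(\<Sum>c\<in>S. f c *\<^sub>R c) = (\<Sum>c\<in>S. g c *\<^sub>R c) \<longleftrightarrow> (\<forall>c\<in>S. f c = g c)"
  using orthosystem_sum_eq_0_iff[OF S, of "\<lambda>c. f c - g c"]
  by (simp add: scaleR_diff_left sum_subtractf)

text \<open>A polynomial annihilates x exactly if it vanishes at every coefficient. The product runs
  over the set of values of \<open>f\<close>, so repeated coefficients count once.\<close>

lemma minimal_poly_eq:
  assumes S: "orthosystem S"
  shows "minimal_poly (\<Sum>c\<in>S. f c *\<^sub>R c) = (\<Prod>t\<in>f ` S. [:- t, 1:])"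
proof -
  let ?x = "\<Sum>c\<in>S. f c *\<^sub>R c" and ?q = "\<Prod>t\<in>f ` S. [:- t, 1:]"
  have fin: "finite (f ` S)" using orthosystemD(1)[OF S] by simp
  have zero: "jpoly p ?x = 0 \<longleftrightarrow> (\<forall>t\<in>f ` S. poly p t = 0)" for p
    by (simp add: orthosystem_jpoly[OF S] orthosystem_sum_eq_0_iff[OF S])
  have deg: "degree ?q = card (f ` S)"
    by (subst degree_prod_eq_sum_degree) auto
  have lead: "lead_coeff ?q = 1" by (simp add: lead_coeff_prod)
  have q0: "jpoly ?q ?x = 0" using fin by (auto simp: zero poly_prod)
  have low: "card (f ` S) \<le> degree p" if "p \<noteq> 0" "jpoly p ?x = 0" for p
  proof -
    have "card (f ` S) \<le> card {t. poly p t = 0}"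
      by (rule card_mono[OF poly_roots_finite[OF that(1)]]) (use that zero in auto)
    also have "\<dots> \<le> degree p" by (rule card_poly_roots_bound[OF that(1)])
    finally show ?thesis .
  qed
  show ?thesis
    unfolding minimal_poly_def
  proof (rule the_equality)
    show "lead_coeff ?q = 1 \<and> jpoly ?q ?x = 0 \<and> (\<forall>q. q \<noteq> 0 \<and> jpoly q ?x = 0 \<longrightarrow> degree ?q \<le> degree q)"
      using lead q0 low deg by metis
    fix p assume p: "lead_coeff p = 1 \<and> jpoly p ?x = 0 \<and> (\<forall>q. q \<noteq> 0 \<and> jpoly q ?x = 0 \<longrightarrow> degree p \<le> degree q)"
    then have "p \<noteq> 0" by auto
    have qn: "?q \<noteq> 0" using lead by force
    have dp: "degree p = degree ?q"
      using p q0 qn low[OF \<open>p \<noteq> 0\<close>] deg by (metis le_antisym)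
    show "p = ?q"
    proof (rule ccontr)
      assume "p \<noteq> ?q"
      then have ne: "p - ?q \<noteq> 0" by simp
      have "coeff (p - ?q) (degree ?q) = 0" using p lead dp by simp
      moreover have "degree (p - ?q) \<le> degree ?q" using dp by (intro degree_diff_le) auto
      ultimately have "degree (p - ?q) < degree ?q"
        using ne by (metis leading_coeff_0_iff le_neq_implies_less)
      moreover have "jpoly (p - ?q) ?x = 0" using p q0 unfolding zero by simp
      ultimately show False using low[OF ne] deg by simp
    qed
  qed
qed

lemma degree_minimal_poly:
  assumes S: "orthosystem S"
  shows "degree (minimal_poly (\<Sum>c\<in>S. f c *\<^sub>R c)) = card (f ` S)"
  unfolding minimal_poly_eq[OF S] by (subst degree_prod_eq_sum_degree) auto

lemma polynomial_function_jmul: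
  assumes "polynomial_function p" "polynomial_function q"
  shows "polynomial_function (\<lambda>x. p x \<odot> q x :: 'a)"
proof -
  have eq: "p x \<odot> q x = (\<Sum>b\<in>Basis. \<Sum>b'\<in>Basis. ((p x \<bullet> b) * (q x \<bullet> b')) *\<^sub>R (b \<odot> b'))" for x
  proof -
    have "p x \<odot> q x = (\<Sum>b\<in>Basis. (p x \<bullet> b) *\<^sub>R b) \<odot> (\<Sum>b\<in>Basis. (q x \<bullet> b) *\<^sub>R b)"
      by (simp add: euclidean_representation)
    also have "\<dots> = (\<Sum>b\<in>Basis. \<Sum>b'\<in>Basis. ((p x \<bullet> b) * (q x \<bullet> b')) *\<^sub>R (b \<odot> b'))"
      by (simp only: jmul_sum_left) (simp only: jmul_sum_right jmul_scale_left jmul_scale_right scaleR_scaleR, simp only: mult.commute)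
    finally show ?thesis .
  qed
  have "real_polynomial_function (\<lambda>x. p x \<bullet> b)" "real_polynomial_function (\<lambda>x. q x \<bullet> b)" if "b \<in> Basis" for b
    using assms that by (auto simp: polynomial_function_iff_Basis_inner[of p] polynomial_function_iff_Basis_inner[of q])
  then have pq: "polynomial_function (\<lambda>x. (p x \<bullet> b) * (q x \<bullet> b'))" if "b \<in> Basis" "b' \<in> Basis" for b b'
    using that by (simp flip: real_polynomial_function_eq add: real_polynomial_function.intros(4))
  show ?thesis
    unfolding eq by (intro polynomial_function_sum polynomial_function_mult pq polynomial_function_const finite_Basis)
qed

lemma polynomial_function_jpower: "polynomial_function (\<lambda>x. jpower x k)"
  by (induction k) (simp_all add: polynomial_function_jmul)

lemma real_polynomial_function_power_trace:
  "real_polynomial_function (\<lambda>x. trace_form (jpower x k) unit)"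
proof -
  have "bounded_linear (\<lambda>y. trace_form y unit)"
    using bilinear_trace_form by (simp add: bilinear_def linear_conv_bounded_linear)
  then show ?thesis
    using polynomial_function_jpower[of k] unfolding polynomial_function_def o_def by blast
qed

text \<open>The closed cone of squares, encoded as the dual of the idempotents: sums, nonnegative
  multiples and limits are then immediate, and \<open>orthosystem_pcone_iff\<close> recovers the
  spectral description.\<close>

definition pcone :: "'a set" where
  "pcone = {x. \<forall>d. d \<odot> d = d \<longrightarrow> trace_form x d \<ge> 0}"

lemma pcone_add: "x \<in> pcone \<Longrightarrow> y \<in> pcone \<Longrightarrow> x + y \<in> pcone"
  by (simp add: pcone_def trace_form_simps)

lemma pcone_scale: "x \<in> pcone \<Longrightarrow> t \<ge> 0 \<Longrightarrow> t *\<^sub>R x \<in> pcone"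
  by (simp add: pcone_def trace_form_simps)

lemma closed_pcone: "closed pcone"
proof -
  have "pcone = (\<Inter>d\<in>{d. d \<odot> d = d}. {x. 0 \<le> trace_form x d})" by (auto simp: pcone_def)
  moreover have "closed {x. 0 \<le> trace_form x d}" for d
  proof (rule closed_Collect_le)
    have "bounded_linear (\<lambda>x. trace_form x d)"
      using bilinear_trace_form by (simp add: bilinear_def linear_conv_bounded_linear)
    then show "continuous_on UNIV (\<lambda>x. trace_form x d)" by (rule linear_continuous_on)
  qed simp
  ultimately show ?thesis by (simp only:) (intro closed_INT ballI)
qed

lemma orthosystem_pcone_iff:
  assumes S: "orthosystem S"
  shows "(\<Sum>c\<in>S. f c *\<^sub>R c) \<in> pcone \<longleftrightarrow> (\<forall>c\<in>S. f c \<ge> 0)"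
proof
  assume x: "(\<Sum>c\<in>S. f c *\<^sub>R c) \<in> pcone"
  show "\<forall>c\<in>S. f c \<ge> 0"
  proof
    fix c assume c: "c \<in> S"
    have "trace_form (\<Sum>c\<in>S. f c *\<^sub>R c) (\<Sum>d\<in>S. (if d = c then 1 else 0) *\<^sub>R d)
      = (\<Sum>d\<in>S. if d = c then f c * trace_form c c else 0)"
      unfolding orthosystem_trace_form_sum[OF S] by (rule sum.cong) auto
    also have "\<dots> = f c * trace_form c c" using c orthosystemD(1)[OF S] by simp
    also have "(\<Sum>d\<in>S. (if d = c then 1 else 0) *\<^sub>R d) = (\<Sum>d\<in>S. if d = c then c else 0)"
      by (rule sum.cong) auto
    also have "\<dots> = c" using c orthosystemD(1)[OF S] by simp
    finally have "f c * trace_form c c \<ge> 0"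
      using x orthosystemD(3)[OF S c] unfolding pcone_def by auto
    then show "f c \<ge> 0" using orthosystem_trace_form_pos[OF S c] by (simp add: zero_le_mult_iff)
  qed
next
  assume "\<forall>c\<in>S. f c \<ge> 0"
  then show "(\<Sum>c\<in>S. f c *\<^sub>R c) \<in> pcone"
    unfolding pcone_def using trace_form_idempotent_nonneg(1) orthosystemD(3)[OF S]
    by (auto simp: trace_form_sum_left trace_form_scale_left intro!: sum_nonneg)
qed

lemma orthosystem_interior_pcone_iff:
  assumes S: "orthosystem S"
  shows "(\<exists>s>0. (\<Sum>c\<in>S. f c *\<^sub>R c) - s *\<^sub>R unit \<in> pcone) \<longleftrightarrow> (\<forall>c\<in>S. f c > 0)"
proof -
  have "(\<Sum>c\<in>S. f c *\<^sub>R c) - s *\<^sub>R unit = (\<Sum>c\<in>S. (f c - s) *\<^sub>R c)" for s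
    by (simp add: scaleR_diff_left sum_subtractf scaleR_sum_right[symmetric] orthosystemD(5)[OF S])
  then have "(\<exists>s>0. (\<Sum>c\<in>S. f c *\<^sub>R c) - s *\<^sub>R unit \<in> pcone) \<longleftrightarrow> (\<exists>s>0. \<forall>c\<in>S. s \<le> f c)"
    by (simp add: orthosystem_pcone_iff[OF S])
  also have "\<dots> \<longleftrightarrow> (\<forall>c\<in>S. f c > 0)"
  proof
    assume pos: "\<forall>c\<in>S. f c > 0"
    \<comment> \<open>The inserted 1 keeps the minimum meaningful for empty
      \<open>S\<close>.\<close>
    define s where "s = Min (insert 1 (f ` S))"
    have fin: "finite (insert 1 (f ` S))" using orthosystemD(1)[OF S] by simp
    have "s > 0" unfolding s_def using fin pos by (subst Min_gr_iff) auto
    moreover have "\<forall>c\<in>S. s \<le> f c" unfolding s_def using fin by (auto intro: Min_le)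
    ultimately show "\<exists>s>0. \<forall>c\<in>S. s \<le> f c" by blast
  qed (use less_le_trans in blast)
  finally show ?thesis .
qed

lemma orthosystem_invertible_iff:
  assumes S: "orthosystem S"
  shows "invertible (\<Sum>c\<in>S. f c *\<^sub>R c) \<longleftrightarrow> (\<forall>c\<in>S. f c \<noteq> 0)"
proof -
  have unit: "unit = (\<Sum>c\<in>S. 1 *\<^sub>R c)" using orthosystemD(5)[OF S] by simp
  have inv: "invertible (\<Sum>c\<in>S. f c *\<^sub>R c) \<longleftrightarrow> (\<exists>p. \<forall>c\<in>S. f c * poly p (f c) = 1)"
    unfolding invertible_def orthosystem_jpoly[OF S] orthosystem_sum_mult[OF S] unit
      orthosystem_sum_cong_iff[OF S] ..
  show ?thesis
  proof
    assume nz: "\<forall>c\<in>S. f c \<noteq> 0"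
    \<comment> \<open>\<open>q\<close> vanishes at every \<open>f c\<close> and has constant term 1,
      so 1 - q = t p(t) and p(x) is the inverse of x.\<close>
    define q where "q = (\<Prod>t\<in>f ` S. [:1, - 1 / t:])"
    have fin: "finite (f ` S)" using orthosystemD(1)[OF S] by simp
    have "poly q 0 = 1" by (simp add: q_def poly_prod)
    then have "[:- 0, 1:] dvd (1 - q)" by (subst poly_eq_0_iff_dvd[symmetric]) simp
    then obtain p where p: "1 - q = [:0, 1:] * p" by (auto elim: dvdE)
    have "f c * poly p (f c) = 1" if "c \<in> S" for c
    proof -
      have "f c * poly p (f c) = poly (1 - q) (f c)" by (simp add: p)
      moreover have "poly q (f c) = 0"
        unfolding q_def poly_prod using fin that nz by (intro prod_zero) auto
      ultimately show ?thesis by simp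
    qed
    then show "invertible (\<Sum>c\<in>S. f c *\<^sub>R c)" unfolding inv by blast
  qed (auto simp: inv)
qed

text \<open>Both sides consist of the elements with positive spectral values. The right-hand side
  refers to no orthosystem, so it can be handled under sums and linear maps.\<close>

lemma cone_eq: "cone = {x. \<exists>s>0. x - s *\<^sub>R unit \<in> pcone}"
proof (intro set_eqI iffI)
  fix x assume "x \<in> cone"
  then obtain y where y: "invertible y" "x = y \<odot> y" by (auto simp: cone_def)
  obtain S g where S: "orthosystem S" and yS: "y = (\<Sum>c\<in>S. g c *\<^sub>R c)"
    by (rule spectral_decomposition[of y]) (rule that)
  have "\<forall>c\<in>S. g c * g c > 0"
    using y(1) unfolding yS orthosystem_invertible_iff[OF S] by (auto simp: zero_less_mult_iff)
  then show "x \<in> {x. \<exists>s>0. x - s *\<^sub>R unit \<in> pcone}"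
    using orthosystem_interior_pcone_iff[OF S, of "\<lambda>c. g c * g c"]
    by (simp add: y(2) yS orthosystem_sum_mult[OF S])
next
  fix x assume x: "x \<in> {x. \<exists>s>0. x - s *\<^sub>R unit \<in> pcone}"
  obtain S f where S: "orthosystem S" and xS: "x = (\<Sum>c\<in>S. f c *\<^sub>R c)"
    by (rule spectral_decomposition[of x]) (rule that)
  have pos: "\<forall>c\<in>S. f c > 0"
    using x orthosystem_interior_pcone_iff[OF S, of f] by (simp add: xS)
  let ?y = "\<Sum>c\<in>S. sqrt (f c) *\<^sub>R c"
  have "invertible ?y" unfolding orthosystem_invertible_iff[OF S] using pos by fastforce
  moreover have "x = ?y \<odot> ?y"
    unfolding xS orthosystem_sum_mult[OF S] orthosystem_sum_cong_iff[OF S] using pos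
    by (simp add: less_imp_le)
  ultimately show "x \<in> cone" unfolding cone_def by blast
qed

lemma orthosystem_cone_iff:
  assumes S: "orthosystem S"
  shows "(\<Sum>c\<in>S. f c *\<^sub>R c) \<in> cone \<longleftrightarrow> (\<forall>c\<in>S. f c > 0)"
  unfolding cone_eq using orthosystem_interior_pcone_iff[OF S] by simp

text \<open>With \<open>k\<close> a lower bound for traces of idempotents and \<open>K\<close> a
  bound for the trace form, norm v < sqrt (k / K) gives k f(c)^2 \<le> \<open>trace_form v v\<close>
  \<le> k for each spectral value f(c) of v, so |f(c)| \<le> 1.\<close>

lemma unit_plus_small_in_pcone:
  obtains e where "e > 0" "\<And>v :: 'a. norm v < e \<Longrightarrow> unit + v \<in> pcone"
proof -
  obtain k where k: "k > 0" "\<And>c. c \<odot> c = c \<Longrightarrow> c \<noteq> 0 \<Longrightarrow> k \<le> trace_form c c"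
    by (rule idempotent_trace_form_bounded_below) (rule that)
  obtain K where K: "K > 0" "\<And>x y. norm (trace_form x y) \<le> norm x * norm y * K"
    using bounded_bilinear.pos_bounded[OF bilinear_trace_form[unfolded bilinear_conv_bounded_bilinear]] by blast
  show ?thesis
  proof
    show "sqrt (k / K) > 0" using k K by simp
    fix v :: 'a assume v: "norm v < sqrt (k / K)"
    obtain S f where S: "orthosystem S" and vS: "v = (\<Sum>c\<in>S. f c *\<^sub>R c)"
      by (rule spectral_decomposition[of v]) (rule that)
    have "(norm v)\<^sup>2 \<le> k / K" using v k K
      by (metis less_imp_le norm_ge_zero power_mono real_sqrt_pow2 zero_le_divide_iff)
    then have "norm v * norm v * K \<le> k" using K(1) by (simp add: field_simps power2_eq_square)
    then have tv: "trace_form v v \<le> k" using K(2)[of v v] by simp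
    have "1 + f c \<ge> 0" if c: "c \<in> S" for c
    proof -
      have "f c * f c * trace_form c c \<le> (\<Sum>c\<in>S. f c * f c * trace_form c c)"
        by (rule member_le_sum[OF c]) (auto simp: trace_form_nonneg orthosystemD(1)[OF S])
      also have "\<dots> = trace_form v v" unfolding vS orthosystem_trace_form_sum[OF S] ..
      finally have "f c * f c * trace_form c c \<le> k" using tv by simp
      moreover have "f c * f c * k \<le> f c * f c * trace_form c c"
        using k(2)[of c] orthosystemD[OF S] c by (intro mult_left_mono) auto
      ultimately have "f c * f c * k \<le> 1 * k" by simp
      then have "(f c)\<^sup>2 \<le> 1" using k(1) by (simp add: power2_eq_square)
      then have "\<bar>f c\<bar> \<le> 1" by (simp add: abs_square_le_1)
      then show ?thesis by linarith
    qed
    moreover have "unit + v = (\<Sum>c\<in>S. (1 + f c) *\<^sub>R c)"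
      by (simp add: vS scaleR_add_left sum.distrib orthosystemD(5)[OF S])
    ultimately show "unit + v \<in> pcone" using orthosystem_pcone_iff[OF S] by simp
  qed
qed

lemma open_cone: "open cone"
proof (rule openI)
  fix x assume "x \<in> cone"
  then obtain s where s: "s > 0" "x - s *\<^sub>R unit \<in> pcone" by (auto simp: cone_eq)
  obtain e where e: "e > 0" "\<And>v. norm v < e \<Longrightarrow> unit + v \<in> pcone"
    by (rule unit_plus_small_in_pcone) (rule that)
  show "\<exists>r>0. ball x r \<subseteq> cone"
  proof (intro exI conjI subsetI)
    \<comment> \<open>Half of the margin \<open>s\<close> absorbs the displacement
      \<open>y - x\<close>; the other half remains as the margin of \<open>y\<close>.\<close>
    show "s / 2 * e > 0" using s e by simp
    fix y assume "y \<in> ball x (s / 2 * e)"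
    then have "norm (y - x) < s / 2 * e" by (simp add: dist_norm norm_minus_commute)
    then have "norm ((2 / s) *\<^sub>R (y - x)) < e" using s(1) unfolding norm_scaleR by (simp add: field_simps)
    from pcone_scale[OF e(2)[OF this], of "s / 2"] s
    have "(s / 2) *\<^sub>R unit + (y - x) \<in> pcone" by (simp add: scaleR_add_right)
    from pcone_add[OF s(2) this] have "y - (s / 2) *\<^sub>R unit \<in> pcone"
      using scaleR_left.add[of "s / 2" "s / 2" unit] by (simp add: algebra_simps)
    then show "y \<in> cone" using s(1) unfolding cone_eq by (auto intro!: exI[of _ "s / 2"])
  qed
qed

end

text \<open>Two distinct indices collide for at most one parameter t; \<open>F\<close> collects
  these finitely many values.\<close>

lemma eventually_inj_on_perturbation:
  fixes f g :: "'i \<Rightarrow> real"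
  assumes "finite S" "inj_on g S"
  shows "eventually (\<lambda>t. inj_on (\<lambda>c. f c + t * g c) S) (at 0)"
proof -
  define F where "F = (\<lambda>(c, d). (f d - f c) / (g c - g d)) ` (S \<times> S)"
  have "finite F" using assms(1) by (simp add: F_def)
  \<comment> \<open>Pairs with c = d put 0 into \<open>F\<close> by division by zero; 0 is removed
    here, as \<open>at 0\<close> ignores it.\<close>
  then have "open (- (F - {0}))" by (intro open_Compl finite_imp_closed) simp
  then have "eventually (\<lambda>t. t \<in> - (F - {0})) (nhds 0)"
    by (rule eventually_nhds_in_open) simp
  then have "eventually (\<lambda>t. t \<notin> F) (at 0)"
    unfolding eventually_at_filter by eventually_elim auto
  then show ?thesis
  proof eventually_elim
    case (elim t)
    show ?case
    proof (rule inj_onI, rule ccontr)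
      fix c d assume cd: "c \<in> S" "d \<in> S" "f c + t * g c = f d + t * g d" "c \<noteq> d"
      then have "g c - g d \<noteq> 0" using assms(2) by (auto simp: inj_on_eq_iff)
      then have "t = (f d - f c) / (g c - g d)" using cd(3) by (simp add: field_simps)
      then have "t \<in> F" using cd(1,2) by (force simp: F_def)
      with elim show False by simp
    qed
  qed
qed

section \<open>Rank and determinant through Jordan frames\<close>

context simple_euclidean_jordan_algebra
begin

lemma unit_neq_0: "unit \<noteq> 0"
  using trace_form_unit_unit by (auto simp: trace_form_simps)

lemma jordan_frame_card_trace:
  assumes S: "jordan_frame S" and c: "primitive c"
  shows "card S * trace_form c c = DIM('a)"
proof -
  have "(\<Sum>d\<in>S. trace_form d d) = (\<Sum>d\<in>S. trace_form c c)"
    by (intro sum.cong primitive_trace_form_const[OF _ c]) (use S in \<open>auto simp: jordan_frame_def\<close>)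
  then show ?thesis
    using orthosystem_sum_trace_form[of S] S by (simp add: jordan_frame_def)
qed

text \<open>Members of all frames have equal trace and those of one frame add up to the dimension,
  so all frames have equal size. The degree of a minimal polynomial counts distinct coefficients in
  a frame; injective coefficients attain the maximum.\<close>

lemma rank_eq_card:
  assumes S: "jordan_frame S"
  shows "rank = card S"
proof -
  have oS: "orthosystem S" using S by (simp add: jordan_frame_def)
  then have fin: "finite S" and "S \<noteq> {}" using orthosystemD(1,5)[of S] unit_neq_0 by auto
  then obtain c where c: "c \<in> S" by blast
  then have pc: "primitive c" and "c \<noteq> 0" using S by (auto simp: jordan_frame_def primitive_def)
  then have pos: "trace_form c c > 0" using trace_form_pos by simp
  have card: "card S' = card S" if "jordan_frame S'" for S'
    using jordan_frame_card_trace[OF that pc] jordan_frame_card_trace[OF S pc] pos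
    by (metis mult_right_cancel of_nat_eq_iff less_irrefl)
  have le: "degree (minimal_poly x) \<le> card S" for x
  proof -
    obtain S' f where S': "jordan_frame S'" and x: "x = (\<Sum>c\<in>S'. f c *\<^sub>R c)"
      by (rule jordan_frame_decomposition[of x]) (rule that)
    then have oS': "orthosystem S'" by (simp add: jordan_frame_def)
    show ?thesis
      unfolding x degree_minimal_poly[OF oS'] card[OF S', symmetric]
      by (rule card_image_le[OF orthosystemD(1)[OF oS']])
  qed
  obtain g :: "'a \<Rightarrow> nat" where g: "inj_on g S"
    using finite_imp_inj_to_nat_seg[OF fin] by blast
  then have "inj_on (\<lambda>c. real (g c)) S" by (auto simp: inj_on_def)
  then have "degree (minimal_poly (\<Sum>c\<in>S. real (g c) *\<^sub>R c)) = card S"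
    unfolding degree_minimal_poly[OF oS] by (rule card_image)
  then have mem: "card S \<in> range (\<lambda>x. degree (minimal_poly x))" by (metis rangeI)
  have "finite (range (\<lambda>x. degree (minimal_poly x)))"
    by (rule finite_subset[of _ "{..card S}"]) (use le in auto)
  then show ?thesis unfolding rank_def using mem le by (intro Max_eqI) auto
qed

lemma rank_pos: "rank > 0"
proof -
  obtain S f where S: "jordan_frame S" "unit = (\<Sum>c\<in>S. f c *\<^sub>R c)"
    by (rule jordan_frame_decomposition[of unit]) (rule that)
  then have "S \<noteq> {}" "finite S" using unit_neq_0 orthosystemD(1) by (auto simp: jordan_frame_def)
  then show ?thesis using rank_eq_card[OF S(1)] by (simp add: card_gt_0_iff)
qed

text \<open>Every primitive idempotent has trace n/r; \<open>trace_form x unit\<close> is Tr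
  L(x).\<close>

lemma jordan_frame_trace_form:
  assumes S: "jordan_frame S"
  shows "trace_form (\<Sum>c\<in>S. f c *\<^sub>R c) unit = DIM('a) / rank * (\<Sum>c\<in>S. f c)"
proof -
  have oS: "orthosystem S" using S by (simp add: jordan_frame_def)
  have t: "trace_form c unit = DIM('a) / rank" if "c \<in> S" for c
  proof -
    have "primitive c" using that S by (simp add: jordan_frame_def)
    from jordan_frame_card_trace[OF S this] rank_eq_card[OF S] rank_pos
    have "trace_form c c = DIM('a) / rank" by (simp add: field_simps)
    then show ?thesis using trace_form_idempotent_unit orthosystemD(3)[OF oS that] by simp
  qed
  have "trace_form (\<Sum>c\<in>S. f c *\<^sub>R c) unit = (\<Sum>c\<in>S. f c * (DIM('a) / rank))"
    unfolding trace_form_sum_left by (rule sum.cong) (simp_all add: trace_form_simps t)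
  then show ?thesis by (simp only: sum_distrib_right[symmetric] mult.commute)
qed

lemma regular_iff:
  assumes S: "jordan_frame S"
  shows "regular (\<Sum>c\<in>S. f c *\<^sub>R c) \<longleftrightarrow> inj_on f S"
proof -
  have oS: "orthosystem S" using S by (simp add: jordan_frame_def)
  then show ?thesis
    unfolding regular_def degree_minimal_poly[OF oS] rank_eq_card[OF S]
    using orthosystemD(1) by (metis card_image eq_card_imp_inj_on)
qed

text \<open>One polynomial must serve all frames. The traces of the powers of x are defined without
  a frame and depend only on the spectral values; Newton's identities express coefficient
  \<open>k\<close> through them and earlier coefficients.\<close>

lemma elementary_symmetric_polynomial_function:
  "\<exists>g. real_polynomial_function g \<and> (\<forall>S f. jordan_frame S \<longrightarrow>
     g (\<Sum>c\<in>S. f c *\<^sub>R c) = fps_nth (\<Prod>c\<in>S. 1 - fps_const (f c) * fps_X) k)"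
proof (induction k rule: less_induct)
  case (less k)
  show ?case
  proof (cases k)
    case 0
    have "fps_nth (\<Prod>c\<in>S. 1 - fps_const (f c) * fps_X) 0 = 1" for S and f :: "'a \<Rightarrow> real"
      by (induction S rule: infinite_finite_induct) simp_all
    then show ?thesis
      unfolding 0 by (intro exI[of _ "\<lambda>_. 1"] conjI real_polynomial_function.intros(2)) simp
  next
    case (Suc l)
    from less have "\<forall>j\<in>{..l}. \<exists>g. real_polynomial_function g \<and> (\<forall>S f. jordan_frame S \<longrightarrow>
       g (\<Sum>c\<in>S. f c *\<^sub>R c) = fps_nth (\<Prod>c\<in>S. 1 - fps_const (f c) * fps_X) j)"
      by (simp add: Suc)
    from bchoice[OF this] obtain G where "\<forall>j\<in>{..l}. real_polynomial_function (G j) \<and> (\<forall>S f. jordan_frame S \<longrightarrow>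
       G j (\<Sum>c\<in>S. f c *\<^sub>R c) = fps_nth (\<Prod>c\<in>S. 1 - fps_const (f c) * fps_X) j)" ..
    then have G: "\<And>j. j \<le> l \<Longrightarrow> real_polynomial_function (G j)"
      "\<And>j S f. j \<le> l \<Longrightarrow> jordan_frame S \<Longrightarrow>
       G j (\<Sum>c\<in>S. f c *\<^sub>R c) = fps_nth (\<Prod>c\<in>S. 1 - fps_const (f c) * fps_X) j"
      by simp_all
    \<comment> \<open>The factor r/n turns the trace of L(x^j) into the power sum of the spectral
      values.\<close>
    define g where "g x = (- 1 / Suc l) * (\<Sum>j\<le>l. G j x *
        (rank / DIM('a) * trace_form (jpower x (Suc l - j)) unit))" for x
    have "real_polynomial_function g"
      unfolding g_def
      by (intro real_polynomial_function.intros(2-4) real_polynomial_function_sum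
          real_polynomial_function_power_trace finite_atMost) (simp add: G(1))
    moreover have "g (\<Sum>c\<in>S. f c *\<^sub>R c) = fps_nth (\<Prod>c\<in>S. 1 - fps_const (f c) * fps_X) k"
      if S: "jordan_frame S" for S f
    proof -
      have oS: "orthosystem S" using S by (simp add: jordan_frame_def)
      have "g (\<Sum>c\<in>S. f c *\<^sub>R c) = (- 1 / Suc l) *
          (\<Sum>j\<le>l. fps_nth (\<Prod>c\<in>S. 1 - fps_const (f c) * fps_X) j * (\<Sum>c\<in>S. f c ^ (Suc l - j)))"
        unfolding g_def orthosystem_jpower[OF oS] jordan_frame_trace_form[OF S]
        using rank_pos G(2)[OF _ S] by simp
      also have "\<dots> = fps_nth (\<Prod>c\<in>S. 1 - fps_const (f c) * fps_X) (Suc l)"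
        using newton_identity[OF orthosystemD(1)[OF oS], of l f] by (simp add: field_simps)
      finally show ?thesis by (simp add: Suc)
    qed
    ultimately show ?thesis by blast
  qed
qed

text \<open>Moving x in a direction \<open>u\<close> with distinct coefficients in the same frame
  makes it regular for small nonzero t; continuity gives equality at t = 0.\<close>

lemma real_polynomial_function_eq_if_eq_on_regular:
  assumes "real_polynomial_function g" "real_polynomial_function h"
    and eq: "\<And>x. regular x \<Longrightarrow> g x = h x"
  shows "g = h"
proof
  fix x
  obtain S f where S: "jordan_frame S" and x: "x = (\<Sum>c\<in>S. f c *\<^sub>R c)"
    by (rule jordan_frame_decomposition[of x]) (rule that)
  have fin: "finite S" using S by (simp add: jordan_frame_def orthosystem_def)
  obtain k :: "'a \<Rightarrow> nat" where k: "inj_on k S"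
    using finite_imp_inj_to_nat_seg[OF fin] by blast
  define u where "u = (\<Sum>c\<in>S. real (k c) *\<^sub>R c)"
  have xu: "x + t *\<^sub>R u = (\<Sum>c\<in>S. (f c + t * real (k c)) *\<^sub>R c)" for t
    by (simp add: x u_def scaleR_add_left sum.distrib scaleR_sum_right)
  have "eventually (\<lambda>t. inj_on (\<lambda>c. f c + t * real (k c)) S) (at 0)"
    by (rule eventually_inj_on_perturbation[OF fin]) (use k in \<open>auto simp: inj_on_def\<close>)
  then have ev: "eventually (\<lambda>t. g (x + t *\<^sub>R u) = h (x + t *\<^sub>R u)) (at 0)"
    by eventually_elim (auto intro!: eq simp: xu regular_iff[OF S])
  have lim: "((\<lambda>t. p (x + t *\<^sub>R u)) \<longlongrightarrow> p x) (at 0)" if "real_polynomial_function p" for p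
  proof -
    have "isCont p (x + 0 *\<^sub>R u)" by (rule continuous_real_polymonial_function[OF that])
    then have "((\<lambda>t. p (x + t *\<^sub>R u)) \<longlongrightarrow> p (x + 0 *\<^sub>R u)) (at 0)"
      by (rule isCont_tendsto_compose) (intro tendsto_intros)
    then show ?thesis by simp
  qed
  have "((\<lambda>t. h (x + t *\<^sub>R u)) \<longlongrightarrow> g x) (at 0)"
    by (rule Lim_transform_eventually[OF lim[OF assms(1)] ev])
  then show "g x = h x"
    using lim[OF assms(2)] tendsto_unique by (metis trivial_limit_at)
qed

text \<open>\<open>h\<close>, the top elementary symmetric function of the spectral values,
  satisfies both clauses of the description defining \<open>det\<close>, and the preceding lemma
  makes it the only such function. The formula thus also covers repeated coefficients.\<close>

lemma
  shows real_polynomial_function_det: "real_polynomial_function det"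
    and det_jordan_frame: "jordan_frame S \<Longrightarrow> det (\<Sum>c\<in>S. f c *\<^sub>R c) = (\<Prod>c\<in>S. f c)"
proof -
  obtain g where g: "real_polynomial_function g" "\<And>S f. jordan_frame S \<Longrightarrow>
     g (\<Sum>c\<in>S. f c *\<^sub>R c) = fps_nth (\<Prod>c\<in>S. 1 - fps_const (f c) * fps_X) rank"
    using elementary_symmetric_polynomial_function[of rank] by blast
  define h where "h x = (-1) ^ rank * g x" for x
  have h: "real_polynomial_function h"
    unfolding h_def by (intro real_polynomial_function.intros(2,4) g(1))
  have hS: "h (\<Sum>c\<in>S. f c *\<^sub>R c) = (\<Prod>c\<in>S. f c)" if S: "jordan_frame S" for S f
  proof -
    have "finite S" using S by (simp add: jordan_frame_def orthosystem_def)
    from fps_prod_linear_nth_card[OF this, of f] show ?thesis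
      unfolding h_def g(2)[OF S] rank_eq_card[OF S]
      by (simp flip: mult.assoc power_mult_distrib)
  qed
  have hreg: "h x = (-1) ^ rank * coeff (minimal_poly x) 0" if "regular x" for x
  proof -
    obtain S f where S: "jordan_frame S" and x: "x = (\<Sum>c\<in>S. f c *\<^sub>R c)"
      by (rule jordan_frame_decomposition[of x]) (rule that)
    have oS: "orthosystem S" using S by (simp add: jordan_frame_def)
    have inj: "inj_on f S" using that regular_iff[OF S] by (simp add: x)
    have "coeff (minimal_poly x) 0 = (\<Prod>c\<in>S. - f c)"
      unfolding x minimal_poly_eq[OF oS] poly_0_coeff_0[symmetric] poly_prod prod.reindex[OF inj] by simp
    also have "\<dots> = (-1) ^ rank * (\<Prod>c\<in>S. f c)"
      unfolding rank_eq_card[OF S] by (simp add: prod_uminus)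
    finally show ?thesis by (simp add: x hS[OF S] flip: mult.assoc power_mult_distrib)
  qed
  have "det = h"
    unfolding det_def
  proof (rule the_equality)
    show "real_polynomial_function h \<and> (\<forall>x. regular x \<longrightarrow> h x = (- 1) ^ rank * coeff (minimal_poly x) 0)"
      using h hreg by blast
    fix f assume "real_polynomial_function f \<and> (\<forall>x. regular x \<longrightarrow> f x = (- 1) ^ rank * coeff (minimal_poly x) 0)"
    then show "f = h" using real_polynomial_function_eq_if_eq_on_regular[of f h] h hreg by simp
  qed
  then show "real_polynomial_function det" "jordan_frame S \<Longrightarrow> det (\<Sum>c\<in>S. f c *\<^sub>R c) = (\<Prod>c\<in>S. f c)"
    using h hS by simp_all
qed

lemma det_unit: "det unit = 1"
proof -
  obtain S f where S: "jordan_frame S" "unit = (\<Sum>c\<in>S. f c *\<^sub>R c)"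
    by (rule jordan_frame_decomposition[of unit]) (rule that)
  then have "unit = (\<Sum>c\<in>S. 1 *\<^sub>R c)" by (simp add: jordan_frame_def orthosystem_def)
  then show ?thesis using det_jordan_frame[OF S(1), of "\<lambda>_. 1"] by simp
qed

lemma cone_log:
  assumes "y \<in> cone"
  obtains S f where "jordan_frame S" "y = (\<Sum>c\<in>S. exp (f c) *\<^sub>R c)" "det y = exp (\<Sum>c\<in>S. f c)"
proof -
  obtain S g where S: "jordan_frame S" and y: "y = (\<Sum>c\<in>S. g c *\<^sub>R c)"
    by (rule jordan_frame_decomposition[of y]) (rule that)
  have oS: "orthosystem S" using S by (simp add: jordan_frame_def)
  have pos: "\<forall>c\<in>S. g c > 0" using assms unfolding y orthosystem_cone_iff[OF oS] .
  have y': "y = (\<Sum>c\<in>S. exp (ln (g c)) *\<^sub>R c)"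
    unfolding y orthosystem_sum_cong_iff[OF oS] using pos by simp
  show ?thesis
  proof (rule that[OF S y'])
    show "det y = exp (\<Sum>c\<in>S. ln (g c))"
      unfolding y' det_jordan_frame[OF S] by (simp add: exp_sum orthosystemD(1)[OF oS])
  qed
qed

lemma det_pos: "y \<in> cone \<Longrightarrow> det y > 0"
  by (erule cone_log) simp

end


section \<open>Automorphisms of the cone\<close>

text \<open>T diag(p) T^-1. For an eigenbasis \<open>T\<close> of L(x) with eigenvalues m,
  \<open>diag_op T (\<lambda>b. g (m b))\<close> is g(L(x)).\<close>

definition diag_op :: "('a::euclidean_space \<Rightarrow> 'a) \<Rightarrow> ('a \<Rightarrow> real) \<Rightarrow> 'a \<Rightarrow> 'a" where
  "diag_op T p v = T (\<Sum>b\<in>Basis. (p b * (inv T v \<bullet> b)) *\<^sub>R b)"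

lemma diag_op_apply:
  "bij T \<Longrightarrow> diag_op T p (T u) = T (\<Sum>b\<in>Basis. (p b * (u \<bullet> b)) *\<^sub>R b)"
  by (simp add: diag_op_def bij_is_inj)

lemma diag_op_diag_op:
  assumes "bij T"
  shows "diag_op T p (diag_op T q v) = diag_op T (\<lambda>b. p b * q b) v"
proof -
  have "(\<Sum>b\<in>Basis. (p b * ((\<Sum>c\<in>Basis. (q c * (inv T v \<bullet> c)) *\<^sub>R c) \<bullet> b)) *\<^sub>R b)
    = (\<Sum>b\<in>Basis. (p b * q b * (inv T v \<bullet> b)) *\<^sub>R b)"
    by (rule sum.cong) (simp_all add: mult.assoc)
  then show ?thesis using assms by (simp add: diag_op_def bij_is_inj)
qed

lemma diag_op_1:
  assumes "bij T"
  shows "diag_op T (\<lambda>_. 1) v = v"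
  using assms by (simp add: diag_op_def euclidean_representation bij_is_surj surj_f_inv_f)

lemma linear_inv_bij: "linear T \<Longrightarrow> bij T \<Longrightarrow> linear (inv T)"
  for T :: "'a::euclidean_space \<Rightarrow> 'a"
  by (simp add: inj_linear_imp_inv_linear bij_is_inj)

lemma linear_diag:
  "linear (\<lambda>u. \<Sum>b\<in>Basis. (p b * (u \<bullet> b)) *\<^sub>R b :: 'a::euclidean_space)"
  by (rule linearI) (simp_all add: inner_add_left distrib_left scaleR_add_left sum.distrib
      scaleR_sum_right mult.left_commute)

lemma linear_diag_op:
  fixes T :: "'a::euclidean_space \<Rightarrow> 'a"
  assumes "linear T" "bij T"
  shows "linear (diag_op T p)"
  using linear_compose[OF linear_compose[OF linear_inv_bij[OF assms] linear_diag] assms(1)]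
  by (simp add: o_def diag_op_def[abs_def])

lemma diag_op_eq_sum:
  fixes T :: "'a::euclidean_space \<Rightarrow> 'a"
  assumes "linear T"
  shows "diag_op T p v = (\<Sum>b\<in>Basis. (p b * (inv T v \<bullet> b)) *\<^sub>R T b)"
  by (simp add: diag_op_def linear_sum[OF assms] linear_cmul[OF assms])

text \<open>In the basis given by \<open>T\<close> an eigenvector has nonzero coordinates only where
  \<open>p b = t\<close>, so \<open>g (p b)\<close> acts on it as \<open>g t\<close>.\<close>

lemma diag_op_eigenvector:
  fixes T :: "'a::euclidean_space \<Rightarrow> 'a"
  assumes T: "linear T" "bij T" and v: "diag_op T p v = t *\<^sub>R v"
  shows "diag_op T (\<lambda>b. g (p b)) v = g t *\<^sub>R v"
proof -
  define u where "u = inv T v"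
  have vu: "v = T u" using T(2) by (simp add: u_def bij_is_surj surj_f_inv_f)
  have "T (\<Sum>b\<in>Basis. (p b * (u \<bullet> b)) *\<^sub>R b) = T (t *\<^sub>R u)"
    using v unfolding vu diag_op_apply[OF T(2)] by (simp add: linear_cmul[OF T(1)])
  then have eq: "(\<Sum>b\<in>Basis. (p b * (u \<bullet> b)) *\<^sub>R b) = t *\<^sub>R u"
    using T(2) by (simp add: bij_is_inj inj_eq)
  have comp: "p b * (u \<bullet> b) = t * (u \<bullet> b)" if "b \<in> Basis" for b
    using arg_cong[OF eq, of "\<lambda>w. w \<bullet> b"] that by simp
  have "g (p b) * (u \<bullet> b) = g t * (u \<bullet> b)" if "b \<in> Basis" for b
    using comp[OF that] by (cases "u \<bullet> b = 0") auto
  then have "(\<Sum>b\<in>Basis. (g (p b) * (u \<bullet> b)) *\<^sub>R b) = (\<Sum>b\<in>Basis. g t *\<^sub>R (u \<bullet> b) *\<^sub>R b)"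
    by (intro sum.cong) simp_all
  also have "\<dots> = g t *\<^sub>R u" by (simp only: scaleR_sum_right[symmetric] euclidean_representation)
  finally show ?thesis unfolding vu diag_op_apply[OF T(2)] by (simp add: linear_cmul[OF T(1)])
qed

lemma op_trace_diag_op:
  fixes T :: "'a::euclidean_space \<Rightarrow> 'a"
  assumes T: "linear T" "bij T"
  shows "op_trace (diag_op T p) = (\<Sum>b\<in>Basis. p b)"
proof -
  let ?D = "\<lambda>u :: 'a. \<Sum>b\<in>Basis. (p b * (u \<bullet> b)) *\<^sub>R b"
  have lin: "linear (\<lambda>v. ?D (inv T v))"
    using linear_compose[OF linear_inv_bij[OF T] linear_diag] by (simp add: o_def)
  have "op_trace (diag_op T p) = op_trace (\<lambda>v. T (?D (inv T v)))" by (simp add: diag_op_def[abs_def])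
  also have "\<dots> = op_trace (\<lambda>v. ?D (inv T (T v)))" by (rule op_trace_commute[OF T(1) lin])
  also have "\<dots> = (\<Sum>b\<in>Basis. p b)"
    using T(2) by (simp add: op_trace_def bij_is_inj)
  finally show ?thesis .
qed

context euclidean_jordan_algebra
begin

text \<open>Positivity of the resolvent \<open>(1 - h L(x))\<^sup>-\<^sup>1\<close>: if \<open>w = u - h x u\<close> is in the cone and
  \<open>u = p - v\<close> is the decomposition into positive and negative part, then \<open>p v = 0\<close> and pairing
  \<open>w\<close> with \<open>v\<close> gives \<open>\<beta>(v, v) \<le> h \<beta>(x v, v)\<close>, so \<open>v = 0\<close>.\<close>

lemma pcone_resolvent:
  assumes T: "linear T" "bij T" "\<And>u v. trace_form (T u) (T v) = u \<bullet> v"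
    and x: "\<And>v. x \<odot> v = diag_op T m v"
    and h: "\<And>b. b \<in> Basis \<Longrightarrow> h * m b < 1"
    and w: "u - h *\<^sub>R (x \<odot> u) \<in> pcone"
  shows "u \<in> pcone"
proof -
  obtain S f where S: "orthosystem S" and u: "u = (\<Sum>c\<in>S. f c *\<^sub>R c)"
    by (rule spectral_decomposition[of u]) (rule that)
  define p v where "p = (\<Sum>c\<in>S. max (f c) 0 *\<^sub>R c)" and "v = (\<Sum>c\<in>S. max (- f c) 0 *\<^sub>R c)"
  have upv: "u = p - v"
    unfolding u p_def v_def sum_subtractf[symmetric] scaleR_diff_left[symmetric]
    by (rule sum.cong) (auto simp: max_def)
  have "p \<odot> v = (\<Sum>c\<in>S. 0 *\<^sub>R c)"
    unfolding p_def v_def orthosystem_sum_mult[OF S] by (rule sum.cong) (auto simp: max_def)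
  then have pv: "p \<odot> v = 0" by simp
  have "trace_form p v = trace_form (p \<odot> v) unit" by (simp add: trace_form_assoc unit_right)
  then have tpv: "trace_form p v = 0" by (simp add: pv trace_form_simps)
  have "trace_form (x \<odot> p) v = trace_form x (p \<odot> v)" by (rule trace_form_assoc)
  then have txpv: "trace_form (x \<odot> p) v = 0" by (simp add: pv trace_form_simps)
  have "0 \<le> trace_form (u - h *\<^sub>R (x \<odot> u)) v"
    unfolding v_def trace_form_sum_right trace_form_scale_right
    using w orthosystemD(3)[OF S] by (intro sum_nonneg mult_nonneg_nonneg) (auto simp: pcone_def)
  also have "\<dots> = h * trace_form (x \<odot> v) v - trace_form v v"
    by (simp add: upv jmul_simps trace_form_simps tpv txpv algebra_simps)
  finally have le: "trace_form v v \<le> h * trace_form (x \<odot> v) v" by simp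
  define v' where "v' = inv T v"
  have vT: "v = T v'" using T(2) by (simp add: v'_def bij_is_surj surj_f_inv_f)
  have "(\<Sum>b\<in>Basis. (v' \<bullet> b) * (v' \<bullet> b)) \<le> h * (\<Sum>b\<in>Basis. m b * (v' \<bullet> b) * (v' \<bullet> b))"
    using le unfolding x unfolding vT diag_op_apply[OF T(2)] T(3) euclidean_inner[of _ v'] by simp
  then have "(\<Sum>b\<in>Basis. (1 - h * m b) * (v' \<bullet> b)\<^sup>2) \<le> 0"
    by (simp add: algebra_simps sum_subtractf sum_distrib_left power2_eq_square)
  moreover have nn: "(1 - h * m b) * (v' \<bullet> b)\<^sup>2 \<ge> 0" if "b \<in> Basis" for b
    using h[OF that] by simp
  ultimately have "(\<Sum>b\<in>Basis. (1 - h * m b) * (v' \<bullet> b)\<^sup>2) = 0"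
    by (intro antisym sum_nonneg) auto
  then have "\<forall>b\<in>Basis. (1 - h * m b) * (v' \<bullet> b)\<^sup>2 = 0" using nn by (simp add: sum_nonneg_eq_0_iff)
  then have "v' \<bullet> b = 0" if "b \<in> Basis" for b using h[OF that] that by auto
  then have "v' = 0" by (simp add: euclidean_eq_iff[of v'])
  then have "u = p" using upv vT by (simp add: linear_0[OF T(1)])
  then show ?thesis using orthosystem_pcone_iff[OF S, of "\<lambda>c. max (f c) 0"] by (simp add: p_def)
qed

text \<open>exp L(x) is the limit of (1 - L(x)/k)^-k; for large k each resolvent preserves
  \<open>pcone\<close>, which is closed.\<close>

lemma pcone_diag_op_exp:
  assumes T: "linear T" "bij T" "\<And>u v. trace_form (T u) (T v) = u \<bullet> v"
    and x: "\<And>v. x \<odot> v = diag_op T m v"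
    and w: "w \<in> pcone"
  shows "diag_op T (\<lambda>b. exp (m b)) w \<in> pcone"
proof -
  define q where "q k b = inverse (1 + - m b / real k)" for k :: nat and b
  have small: "eventually (\<lambda>k. \<forall>b\<in>Basis. m b / real k < 1) sequentially"
  proof (rule eventually_ball_finite)
    show "\<forall>b\<in>Basis. eventually (\<lambda>k. m b / real k < 1) sequentially"
    proof
      fix b :: 'a
      have "(\<lambda>k. m b / real k) \<longlonglongrightarrow> 0" by (rule lim_const_over_n)
      then show "eventually (\<lambda>k. m b / real k < 1) sequentially" by (rule order_tendstoD) simp
    qed
  qed simp
  have mem: "diag_op T (\<lambda>b. q k b ^ j) w \<in> pcone" if k: "\<forall>b\<in>Basis. m b / real k < 1" for k j
  proof (induction j)
    case 0
    then show ?case using w by (simp add: diag_op_1[OF T(2)])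
  next
    case (Suc j)
    let ?w = "diag_op T (\<lambda>b. q k b ^ j) w" and ?u = "diag_op T (\<lambda>b. q k b ^ Suc j) w"
    \<comment> \<open>Applying 1 - L(x)/k lowers the power of the resolvent by one, so
      \<open>pcone_resolvent\<close> leads from power j to power j + 1.\<close>
    have "?u - (1 / real k) *\<^sub>R (x \<odot> ?u) = ?w"
    proof -
      have "?u - (1 / real k) *\<^sub>R (x \<odot> ?u) =
        (\<Sum>b\<in>Basis. (q k b ^ Suc j * (inv T w \<bullet> b) - (1 / real k) * (m b * q k b ^ Suc j * (inv T w \<bullet> b))) *\<^sub>R T b)"
        unfolding x diag_op_diag_op[OF T(2)] unfolding diag_op_eq_sum[OF T(1)]
        by (simp only: scaleR_sum_right sum_subtractf scaleR_diff_left scaleR_scaleR)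
      also have "\<dots> = (\<Sum>b\<in>Basis. (q k b ^ j * (inv T w \<bullet> b)) *\<^sub>R T b)"
      proof (rule sum.cong)
        fix b :: 'a assume b: "b \<in> Basis"
        have "1 + - m b / real k > 0" using bspec[OF k b] by (simp only: minus_divide_left[symmetric] diff_gt_0_iff_gt diff_conv_add_uminus[symmetric])
        then have "1 + - m b / real k \<noteq> 0" by (rule less_imp_neq[symmetric])
        then have "q k b * (1 + - m b / real k) = 1" unfolding q_def by (rule left_inverse)
        moreover have "q k b ^ Suc j * (inv T w \<bullet> b) - (1 / real k) * (m b * q k b ^ Suc j * (inv T w \<bullet> b))
          = q k b ^ j * (q k b * (1 + - m b / real k)) * (inv T w \<bullet> b)"
          by (simp add: algebra_simps)
        ultimately show "(q k b ^ Suc j * (inv T w \<bullet> b) - (1 / real k) * (m b * q k b ^ Suc j * (inv T w \<bullet> b))) *\<^sub>R T b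
           = (q k b ^ j * (inv T w \<bullet> b)) *\<^sub>R T b"
          by (simp only: mult_1_right)
      qed simp
      finally show ?thesis by (simp only: diag_op_eq_sum[OF T(1)])
    qed
    then have r: "?u - (1 / real k) *\<^sub>R (x \<odot> ?u) \<in> pcone" using Suc by simp
    have "1 / real k * m b < 1" if "b \<in> Basis" for b using k that by simp
    then show ?case by (rule pcone_resolvent[OF T x _ r])
  qed
  have lim: "(\<lambda>k. diag_op T (\<lambda>b. q k b ^ k) w) \<longlonglongrightarrow> diag_op T (\<lambda>b. exp (m b)) w"
    unfolding diag_op_eq_sum[OF T(1)]
  proof (intro tendsto_intros)
    fix b :: 'a
    have "(\<lambda>k. inverse ((1 + - m b / real k) ^ k)) \<longlonglongrightarrow> inverse (exp (- m b))"
      by (intro tendsto_inverse tendsto_exp_limit_sequentially) simp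
    then show "(\<lambda>k. q k b ^ k) \<longlonglongrightarrow> exp (m b)"
      by (simp add: q_def power_inverse exp_minus)
  qed
  show ?thesis
    by (rule Lim_in_closed_set[OF closed_pcone _ _ lim])
      (use small in \<open>auto elim!: eventually_mono simp: mem\<close>)
qed

text \<open>\<open>A\<close> is exp L(x) and \<open>A'\<close> is exp L(-x); since both preserve
  \<open>pcone\<close>, membership is equivalent before and after \<open>A\<close>. The Jacobian is
  the product of the exponentials of the eigenvalues, exp Tr L(x).\<close>

lemma exp_jmul_operator:
  obtains A A' :: "'a \<Rightarrow> 'a"
  where "linear A" "linear A'" "\<And>v. A (A' v) = v" "\<And>v. A' (A v) = v"
    "\<And>v. v \<in> pcone \<Longrightarrow> A v \<in> pcone" "\<And>v. v \<in> pcone \<Longrightarrow> A' v \<in> pcone"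
    "\<And>v t. x \<odot> v = t *\<^sub>R v \<Longrightarrow> A v = exp t *\<^sub>R v"
    "\<And>f. f \<in> borel_measurable borel \<Longrightarrow>
      (\<integral>\<^sup>+v. f v \<partial>lborel) = ennreal (exp (trace_form x unit)) * (\<integral>\<^sup>+v. f (A v) \<partial>lborel)"
proof -
  obtain T :: "'a \<Rightarrow> 'a" and m :: "'a \<Rightarrow> real" where T: "linear T" "bij T"
    "\<And>u v. trace_form (T u) (T v) = u \<bullet> v" and Tb: "\<And>b. b \<in> Basis \<Longrightarrow> x \<odot> T b = m b *\<^sub>R T b"
    by (rule jmul_eigenbasis[of x]) (rule that)
  have x: "x \<odot> v = diag_op T m v" for v
  proof -
    have "v = T (inv T v)" using T(2) by (simp add: bij_is_surj surj_f_inv_f)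
    also have "\<dots> = T (\<Sum>b\<in>Basis. (inv T v \<bullet> b) *\<^sub>R b)" by (simp add: euclidean_representation)
    also have "\<dots> = (\<Sum>b\<in>Basis. (inv T v \<bullet> b) *\<^sub>R T b)" by (simp add: linear_sum[OF T(1)] linear_cmul[OF T(1)])
    finally have "x \<odot> v = x \<odot> (\<Sum>b\<in>Basis. (inv T v \<bullet> b) *\<^sub>R T b)" by simp
    also have "\<dots> = (\<Sum>b\<in>Basis. (m b * (inv T v \<bullet> b)) *\<^sub>R T b)"
      unfolding jmul_sum_right by (rule sum.cong) (simp_all add: jmul_scale_right Tb mult.commute)
    finally show ?thesis by (simp add: diag_op_eq_sum[OF T(1)])
  qed
  have x': "(- x) \<odot> v = diag_op T (\<lambda>b. - m b) v" for v
    by (simp add: jmul_minus_left x diag_op_eq_sum[OF T(1)] sum_negf)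
  have tr: "(\<Sum>b\<in>Basis. m b) = trace_form x unit"
    using op_trace_diag_op[OF T(1,2), of m] by (simp add: trace_form_def unit_right x)
  show ?thesis
  proof (rule that)
    show "linear (diag_op T (\<lambda>b. exp (m b)))" "linear (diag_op T (\<lambda>b. exp (- m b)))"
      by (rule linear_diag_op[OF T(1,2)])+
    show "diag_op T (\<lambda>b. exp (m b)) (diag_op T (\<lambda>b. exp (- m b)) v) = v"
      "diag_op T (\<lambda>b. exp (- m b)) (diag_op T (\<lambda>b. exp (m b)) v) = v" for v
      by (simp_all add: diag_op_diag_op[OF T(2)] diag_op_1[OF T(2)] flip: exp_add)
    show "diag_op T (\<lambda>b. exp (m b)) v \<in> pcone" if "v \<in> pcone" for v
      by (rule pcone_diag_op_exp[OF T x that])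
    show "diag_op T (\<lambda>b. exp (- m b)) v \<in> pcone" if "v \<in> pcone" for v
      by (rule pcone_diag_op_exp[OF T x' that])
    show "diag_op T (\<lambda>b. exp (m b)) v = exp t *\<^sub>R v" if "x \<odot> v = t *\<^sub>R v" for v t
      using diag_op_eigenvector[OF T(1,2), of m v t exp] that by (simp add: x)
    show "(\<integral>\<^sup>+v. f v \<partial>lborel) = ennreal (exp (trace_form x unit)) * (\<integral>\<^sup>+v. f (diag_op T (\<lambda>b. exp (m b)) v) \<partial>lborel)"
      if "f \<in> borel_measurable borel" for f
      using nn_integral_lborel_diagonalizable[OF T(1) bij_is_inj[OF T(2)], of "\<lambda>b. exp (m b)" f] that
      by (simp add: diag_op_def tr flip: exp_sum)
  qed
qed

text \<open>The interval [-y, y] of the order given by \<open>pcone\<close>; being defined by the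
  order alone, it is respected by linear automorphisms of \<open>pcone\<close>.\<close>

definition order_interval :: "'a \<Rightarrow> 'a set" where
  "order_interval y = {v. y - v \<in> pcone \<and> y + v \<in> pcone}"

lemma closed_order_interval: "closed (order_interval y)"
proof -
  have "order_interval y = (\<lambda>v. y - v) -` pcone \<inter> (\<lambda>v. y + v) -` pcone"
    by (auto simp: order_interval_def)
  then show ?thesis
    by (auto intro!: closed_Int closed_vimage closed_pcone continuous_intros)
qed

text \<open>A ball fits in by \<open>unit_plus_small_in_pcone\<close> for v and -v. Boundedness
  holds because the spectral values lie in [-1, 1], whence \<open>trace_form v v\<close> is at most
  the dimension.\<close>

lemma emeasure_order_interval_unit:
  "0 < emeasure lborel (order_interval unit)" "emeasure lborel (order_interval unit) < \<infinity>"
proof -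
  have meas: "order_interval unit \<in> sets borel" by (rule borel_closed[OF closed_order_interval])
  obtain e where e: "e > 0" "\<And>v :: 'a. norm v < e \<Longrightarrow> unit + v \<in> pcone"
    by (rule unit_plus_small_in_pcone) (rule that)
  have "ball 0 e \<subseteq> order_interval unit"
  proof
    fix v :: 'a assume "v \<in> ball 0 e"
    then show "v \<in> order_interval unit" using e(2)[of v] e(2)[of "- v"] by (simp add: order_interval_def)
  qed
  then have "emeasure lborel (ball (0::'a) e) \<le> emeasure lborel (order_interval unit)"
    using meas by (intro emeasure_mono) auto
  then show "0 < emeasure lborel (order_interval unit)"
    using emeasure_lborel_ball_pos_finite[OF e(1), of "0::'a"] by (auto intro: less_le_trans)
  obtain k where k: "k > 0" "\<And>v. k * (norm v)\<^sup>2 \<le> trace_form v v"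
    by (rule trace_form_bounded_below) (rule that)
  have "norm v \<le> sqrt (DIM('a) / k)" if v: "v \<in> order_interval unit" for v
  proof -
    obtain S f where S: "orthosystem S" and vS: "v = (\<Sum>c\<in>S. f c *\<^sub>R c)"
      by (rule spectral_decomposition[of v]) (rule that)
    have "unit - v = (\<Sum>c\<in>S. (1 - f c) *\<^sub>R c)" "unit + v = (\<Sum>c\<in>S. (1 + f c) *\<^sub>R c)"
      by (simp_all add: vS scaleR_add_left scaleR_diff_left sum.distrib sum_subtractf orthosystemD(5)[OF S])
    then have f: "\<forall>c\<in>S. 1 - f c \<ge> 0 \<and> 1 + f c \<ge> 0"
      using v orthosystem_pcone_iff[OF S, of "\<lambda>c. 1 - f c"] orthosystem_pcone_iff[OF S, of "\<lambda>c. 1 + f c"]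
      by (simp add: order_interval_def)
    have "trace_form v v = (\<Sum>c\<in>S. f c * f c * trace_form c c)"
      unfolding vS by (rule orthosystem_trace_form_sum[OF S])
    also have "\<dots> \<le> (\<Sum>c\<in>S. 1 * trace_form c c)"
    proof (intro sum_mono mult_right_mono trace_form_nonneg)
      fix c assume "c \<in> S"
      then have "\<bar>f c\<bar> \<le> 1" using f by (auto simp: abs_le_iff)
      then show "f c * f c \<le> 1" by (simp add: abs_square_le_1 flip: power2_eq_square)
    qed
    also have "\<dots> = DIM('a)" using orthosystem_sum_trace_form[OF S] by simp
    finally have "k * (norm v)\<^sup>2 \<le> DIM('a)" using k(2)[of v] by linarith
    then have "(norm v)\<^sup>2 \<le> DIM('a) / k" using k(1) by (simp add: field_simps)
    then show ?thesis by (rule real_le_rsqrt)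
  qed
  then have "bounded (order_interval unit)" by (auto simp: bounded_iff)
  then show "emeasure lborel (order_interval unit) < \<infinity>" by (rule emeasure_bounded_finite)
qed

end

context simple_euclidean_jordan_algebra
begin

text \<open>The volume of the order interval \<open>[-y, y]\<close> is a multiple of \<open>\<Delta>(y)\<close> to the power \<open>n/r\<close>; this
  makes \<open>\<Delta>\<close> multiplicative under the automorphisms \<open>exp L(x)\<close> of the cone.\<close>

lemma cone_transitive:
  assumes y: "y \<in> cone"
  obtains A :: "'a \<Rightarrow> 'a"
  where "linear A" "A unit = y" "\<And>w. w \<in> cone \<Longrightarrow> A w \<in> cone"
    "\<And>w. w \<in> cone \<Longrightarrow> det (A w) = det y * det w"
    "\<And>f. f \<in> borel_measurable borel \<Longrightarrow>
      (\<integral>\<^sup>+v. f v \<partial>lborel) = ennreal (det y powr (DIM('a) / rank)) * (\<integral>\<^sup>+v. f (A v) \<partial>lborel)"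
proof -
  define V where "V w = emeasure lborel (order_interval w)" for w
  have main: "\<exists>A :: 'a \<Rightarrow> 'a. linear A \<and> A unit = y \<and> (\<forall>v\<in>pcone. A v \<in> pcone) \<and>
    (\<forall>w. V (A w) = ennreal (det y powr (DIM('a) / rank)) * V w) \<and>
    (\<forall>f\<in>borel_measurable borel. (\<integral>\<^sup>+v. f v \<partial>lborel) = ennreal (det y powr (DIM('a) / rank)) * (\<integral>\<^sup>+v. f (A v) \<partial>lborel))"
    if y: "y \<in> cone" for y
  proof -
    obtain S f where S: "jordan_frame S" and yS: "y = (\<Sum>c\<in>S. exp (f c) *\<^sub>R c)" and d: "det y = exp (\<Sum>c\<in>S. f c)"
      by (rule cone_log[OF y]) (rule that)
    have oS: "orthosystem S" using S by (simp add: jordan_frame_def)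
    define x where "x = (\<Sum>c\<in>S. f c *\<^sub>R c)"
    have p: "exp (trace_form x unit) = det y powr (DIM('a) / rank)"
      unfolding d x_def jordan_frame_trace_form[OF S] by (simp add: powr_def)
    obtain A A' :: "'a \<Rightarrow> 'a" where A: "linear A" "linear A'" "\<And>v. A (A' v) = v" "\<And>v. A' (A v) = v"
      "\<And>v. v \<in> pcone \<Longrightarrow> A v \<in> pcone" "\<And>v. v \<in> pcone \<Longrightarrow> A' v \<in> pcone"
      "\<And>v t. x \<odot> v = t *\<^sub>R v \<Longrightarrow> A v = exp t *\<^sub>R v"
      "\<And>f. f \<in> borel_measurable borel \<Longrightarrow>
        (\<integral>\<^sup>+v. f v \<partial>lborel) = ennreal (exp (trace_form x unit)) * (\<integral>\<^sup>+v. f (A v) \<partial>lborel)"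
      by (rule exp_jmul_operator[of x]) (rule that)
    have "A c = exp (f c) *\<^sub>R c" if c: "c \<in> S" for c
    proof (rule A(7))
      have "x \<odot> c = (\<Sum>d\<in>S. if d = c then f c *\<^sub>R c else 0)"
        unfolding x_def jmul_sum_left
        by (rule sum.cong) (use orthosystemD[OF oS] c in \<open>auto simp: jmul_simps\<close>)
      then show "x \<odot> c = f c *\<^sub>R c" using c orthosystemD(1)[OF oS] by simp
    qed
    then have Au: "A unit = y"
      by (simp add: yS orthosystemD(5)[OF oS, symmetric] linear_sum[OF A(1)])
    have pc: "A v \<in> pcone \<longleftrightarrow> v \<in> pcone" for v using A(4,5,6) by metis
    have "V (A w) = ennreal (exp (trace_form x unit)) * V w" for w
    proof -
      have meas: "order_interval u \<in> sets borel" for u by (rule borel_closed[OF closed_order_interval])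
      have mem: "A v \<in> order_interval (A w) \<longleftrightarrow> v \<in> order_interval w" for v
        by (simp add: order_interval_def pc flip: linear_diff[OF A(1)] linear_add[OF A(1)])
      have "V (A w) = (\<integral>\<^sup>+v. indicator (order_interval (A w)) v \<partial>lborel)"
        using meas by (simp add: V_def)
      also have "\<dots> = ennreal (exp (trace_form x unit)) * (\<integral>\<^sup>+v. indicator (order_interval (A w)) (A v) \<partial>lborel)"
        by (rule A(8)) (simp add: borel_measurable_indicator meas)
      also have "(\<integral>\<^sup>+v. indicator (order_interval (A w)) (A v) \<partial>lborel) = (\<integral>\<^sup>+v. indicator (order_interval w) v \<partial>lborel)"
        by (rule nn_integral_cong) (simp add: indicator_def mem)
      also have "\<dots> = V w" using meas by (simp add: V_def)
      finally show ?thesis .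
    qed
    then show ?thesis using A(1,5,8) Au unfolding p by blast
  qed
  \<comment> \<open>\<open>main\<close> is used with w in place of y, so that w is the image of
    \<open>unit\<close> under its own automorphism. Using this for \<open>A w\<close> too gives two
    expressions for \<open>V (A w)\<close>, hence the product formula for
    \<open>det\<close>.\<close>
  have Vdet: "V w = ennreal (det w powr (DIM('a) / rank)) * V unit" if "w \<in> cone" for w
    using main[OF that] by metis
  obtain A :: "'a \<Rightarrow> 'a" where A: "linear A" "A unit = y" "\<And>v. v \<in> pcone \<Longrightarrow> A v \<in> pcone"
    "\<And>w. V (A w) = ennreal (det y powr (DIM('a) / rank)) * V w"
    "\<And>f. f \<in> borel_measurable borel \<Longrightarrow> (\<integral>\<^sup>+v. f v \<partial>lborel) = ennreal (det y powr (DIM('a) / rank)) * (\<integral>\<^sup>+v. f (A v) \<partial>lborel)"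
    using main[OF y] by blast
  have cone: "A w \<in> cone" if w: "w \<in> cone" for w
  proof -
    \<comment> \<open>In the order of \<open>pcone\<close>, w \<ge> s unit and y \<ge> t unit give A
      w \<ge> s y \<ge> s t unit.\<close>
    obtain s t where s: "s > 0" "w - s *\<^sub>R unit \<in> pcone" and t: "t > 0" "y - t *\<^sub>R unit \<in> pcone"
      using w y by (auto simp: cone_eq)
    have "A w - s *\<^sub>R y \<in> pcone"
      using A(3)[OF s(2)] by (simp add: linear_diff[OF A(1)] linear_cmul[OF A(1)] A(2))
    from pcone_add[OF this pcone_scale[OF t(2), of s]] s(1)
    have "A w - (s * t) *\<^sub>R unit \<in> pcone" by (simp add: scaleR_diff_right)
    then show ?thesis using s(1) t(1) unfolding cone_eq by (auto intro!: exI[of _ "s * t"])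
  qed
  show ?thesis
  proof (rule that[OF A(1,2) cone _ A(5)])
    fix w assume w: "w \<in> cone"
    have pos: "det (A w) > 0" "det y > 0" "det w > 0" using w y cone by (auto intro: det_pos)
    have nr: "DIM('a) / rank > 0" using rank_pos by simp
    have fin: "V unit \<noteq> 0" "V unit \<noteq> top" using emeasure_order_interval_unit by (auto simp: V_def)
    have "V unit * ennreal (det (A w) powr (DIM('a) / rank)) =
        V unit * ennreal (det y powr (DIM('a) / rank) * det w powr (DIM('a) / rank))"
      using Vdet[OF cone[OF w]] unfolding A(4) Vdet[OF w] by (simp add: ennreal_mult ac_simps)
    then have "ennreal (det (A w) powr (DIM('a) / rank)) = ennreal ((det y * det w) powr (DIM('a) / rank))"
      unfolding ennreal_mult_cancel_left using fin pos by (auto simp: powr_mult)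
    then have "det (A w) powr (DIM('a) / rank) = (det y * det w) powr (DIM('a) / rank)"
      by simp
    then have "ln (det (A w)) = ln (det y * det w)"
      using nr pos rank_pos by (simp add: powr_def)
    then show "det (A w) = det y * det w" using pos by simp
  qed
qed

end


section \<open>Pointwise bounds in weighted Bergman spaces\<close>

text \<open>The factor \<open>c\<close> occurs once for the real and once for the imaginary part;
  with the Jacobian from \<open>cone_transitive\<close> this is det y to the power 2n/r.\<close>

lemma nn_integral_lborel_pair_linear:
  fixes f :: "'a::euclidean_space \<times> 'a \<Rightarrow> ennreal"
  assumes A: "linear (A :: 'a \<Rightarrow> 'a)"
    and c: "\<And>f. f \<in> borel_measurable borel \<Longrightarrow> (\<integral>\<^sup>+v. f v \<partial>lborel) = c * (\<integral>\<^sup>+v. f (A v) \<partial>lborel)"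
    and f[measurable]: "f \<in> borel_measurable borel"
  shows "(\<integral>\<^sup>+w. f w \<partial>lborel) = c * c * (\<integral>\<^sup>+w. f (A (fst w), A (snd w)) \<partial>lborel)"
proof -
  have [measurable]: "A \<in> borel_measurable borel" by (rule linear_measurable_borel[OF A])
  have [measurable]: "f \<in> borel_measurable (borel \<Otimes>\<^sub>M borel)" by (simp add: borel_prod)
  have "(\<lambda>w. f (A (fst w), A (snd w))) \<in> borel_measurable (borel \<Otimes>\<^sub>M borel)" by measurable
  then have m2: "(\<lambda>w. f (A (fst w), A (snd w))) \<in> borel_measurable borel" by (simp add: borel_prod)
  have "(\<integral>\<^sup>+w. f w \<partial>lborel) = (\<integral>\<^sup>+u. \<integral>\<^sup>+v. f (u, v) \<partial>lborel \<partial>lborel)"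
    by (subst lborel.nn_integral_fst) (simp_all add: lborel_prod)
  also have "\<dots> = (\<integral>\<^sup>+u. c * (\<integral>\<^sup>+v. f (u, A v) \<partial>lborel) \<partial>lborel)"
    by (rule nn_integral_cong) (subst c; simp)
  also have "\<dots> = c * (\<integral>\<^sup>+u. c * (\<integral>\<^sup>+v. f (A u, A v) \<partial>lborel) \<partial>lborel)"
    by (rule c) measurable
  also have "\<dots> = c * c * (\<integral>\<^sup>+u. \<integral>\<^sup>+v. f (A u, A v) \<partial>lborel \<partial>lborel)"
    by (subst nn_integral_cmult) (simp_all add: mult.assoc)
  also have "(\<integral>\<^sup>+u. \<integral>\<^sup>+v. f (A u, A v) \<partial>lborel \<partial>lborel) = (\<integral>\<^sup>+w. f (A (fst w), A (snd w)) \<partial>lborel)"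
    using lborel.nn_integral_fst[of "\<lambda>w. f (A (fst w), A (snd w))" lborel] m2 by (simp add: lborel_prod)
  finally show ?thesis .
qed

context simple_euclidean_jordan_algebra
begin

lemma unit_in_cone: "unit \<in> cone"
proof -
  obtain S f where S: "jordan_frame S" "unit = (\<Sum>c\<in>S. f c *\<^sub>R c)"
    by (rule jordan_frame_decomposition[of unit]) (rule that)
  then have oS: "orthosystem S" by (simp add: jordan_frame_def)
  then show ?thesis using orthosystem_cone_iff[OF oS, of "\<lambda>_. 1"] orthosystemD(5)[OF oS] by simp
qed

lemma continuous_on_det: "continuous_on X det"
  using continuous_real_polymonial_function[OF real_polynomial_function_det]
  by (simp add: continuous_at_imp_continuous_on)

lemma open_tube_domain: "open tube_domain"
proof -
  have "tube_domain = UNIV \<times> cone" by (auto simp: tube_domain_def)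
  then show ?thesis using open_cone by (simp add: open_Times)
qed

lemma tube_domain_iff: "z \<in> tube_domain \<longleftrightarrow> snd z \<in> cone"
  by (cases z) (simp add: tube_domain_def)

lemma borel_measurable_bergman_integrand:
  assumes F: "complexification_holomorphic_on F tube_domain"
  shows "(\<lambda>z. ennreal ((cmod (F z))\<^sup>2 * det (snd z) powr a) * indicator tube_domain z) \<in> borel_measurable borel"
proof -
  have "continuous_on tube_domain (\<lambda>z. (cmod (F z))\<^sup>2 * det (snd z) powr a)"
    by (intro continuous_intros complexification_holomorphic_on_imp_continuous_on[OF F]
        continuous_on_compose2[OF continuous_on_det[of UNIV]])
      (simp_all add: tube_domain_iff det_pos[THEN less_imp_neq, symmetric])
  then have [measurable]: "(\<lambda>z. indicator tube_domain z *\<^sub>R ((cmod (F z))\<^sup>2 * det (snd z) powr a)) \<in> borel_measurable borel"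
    by (intro borel_measurable_continuous_on_indicator) (simp_all add: open_tube_domain)
  have eq: "(\<lambda>z. ennreal ((cmod (F z))\<^sup>2 * det (snd z) powr a) * indicator tube_domain z)
    = (\<lambda>z. ennreal (indicator tube_domain z *\<^sub>R ((cmod (F z))\<^sup>2 * det (snd z) powr a)))"
    by (auto simp: indicator_def)
  show ?thesis unfolding eq by measurable
qed

text \<open>Here \<open>det\<close> stays near \<open>det unit = 1\<close>. Carried along by the
  automorphisms, the same \<open>e\<close> serves every point of the tube, which makes the final
  constant uniform.\<close>

lemma unit_neighbourhood:
  obtains e where "e > 0" "\<And>v :: 'a. norm v < e \<Longrightarrow> unit + v \<in> cone \<and> 1/2 < det (unit + v) \<and> det (unit + v) < 2"
proof -
  have "open (cone \<inter> det -` {1/2<..<2})"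
    using continuous_on_det[of cone] open_cone by (rule continuous_open_preimage) simp
  moreover have "unit \<in> cone \<inter> det -` {1/2<..<2}" using unit_in_cone by (simp add: det_unit)
  ultimately obtain e where e: "e > 0" "ball unit e \<subseteq> cone \<inter> det -` {1/2<..<2}"
    using open_contains_ball by blast
  show ?thesis
  proof (rule that[OF e(1)])
    fix v :: 'a assume "norm v < e"
    then have "unit + v \<in> ball unit e" by (simp add: dist_norm)
    then show "unit + v \<in> cone \<and> 1/2 < det (unit + v) \<and> det (unit + v) < 2" using e(2) by auto
  qed
qed

lemma bergman_space_pointwise_bound:
  assumes F: "F \<in> bergman_space \<nu>"
  obtains C where "C \<ge> 0" "\<And>z. z \<in> tube_domain \<Longrightarrow> (cmod (F z))\<^sup>2 * det (snd z) powr \<nu> \<le> C"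
proof -
  define p where "p = real DIM('a) / real rank"
  define a where "a = \<nu> - 2 * real DIM('a) / real rank"
  have a: "a = \<nu> - 2 * p" by (simp add: a_def p_def)
  define g where "g z = ennreal ((cmod (F z))\<^sup>2 * det (snd z) powr a) * indicator tube_domain z" for z
  have hol: "complexification_holomorphic_on F tube_domain" using F by (simp add: bergman_space_def)
  have gm[measurable]: "g \<in> borel_measurable borel"
    unfolding g_def by (rule borel_measurable_bergman_integrand[OF hol])
  have "bergman_norm_sq \<nu> F < \<infinity>" using F by (simp add: bergman_space_def)
  then have "(\<integral>\<^sup>+z. g z \<partial>lborel) < top" by (simp add: bergman_norm_sq_def g_def a_def)
  then obtain N where N: "N \<ge> 0" "(\<integral>\<^sup>+z. g z \<partial>lborel) = ennreal N"
    by (cases "\<integral>\<^sup>+z. g z \<partial>lborel") auto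
  obtain e where e: "e > 0" "\<And>v :: 'a. norm v < e \<Longrightarrow> unit + v \<in> cone \<and> 1/2 < det (unit + v) \<and> det (unit + v) < 2"
    by (rule unit_neighbourhood) (rule that)
  define B where "B = ball (0 :: 'a \<times> 'a) e"
  obtain V where V: "V > 0" "emeasure lborel B = ennreal V"
    using emeasure_lborel_ball_pos_finite[OF e(1), of "0 :: 'a \<times> 'a"] unfolding B_def
    by (cases "emeasure lborel (ball (0 :: 'a \<times> 'a) e)") auto
  show ?thesis
  proof
    \<comment> \<open>\<open>N\<close> is the squared norm of \<open>F\<close>, \<open>V\<close> the
      volume of the ball, and 2^|a| bounds the variation of the weight over the ball.\<close>
    show "2 powr \<bar>a\<bar> * N / V \<ge> 0" using N V by simp
    fix z assume "z \<in> tube_domain"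
    then have y: "snd z \<in> cone" by (simp add: tube_domain_iff)
    define dy where "dy = det (snd z)"
    have dy: "dy > 0" unfolding dy_def by (rule det_pos[OF y])
    obtain A :: "'a \<Rightarrow> 'a" where A: "linear A" "A unit = snd z" "\<And>w. w \<in> cone \<Longrightarrow> A w \<in> cone"
      "\<And>w. w \<in> cone \<Longrightarrow> det (A w) = det (snd z) * det w"
      "\<And>f. f \<in> borel_measurable borel \<Longrightarrow>
        (\<integral>\<^sup>+v. f v \<partial>lborel) = ennreal (det (snd z) powr (DIM('a) / rank)) * (\<integral>\<^sup>+v. f (A v) \<partial>lborel)"
      by (rule cone_transitive[OF y]) (rule that)
    define s where "s w = z + (A (fst w), A (snd w))" for w
    have snd_s: "snd (s w) = A (unit + snd w)" for w
      by (simp add: s_def linear_add[OF A(1)] A(2))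
    have small: "norm (snd w) < e" if "w \<in> B" for w
      using that norm_snd_le[of "snd w" "fst w"] by (auto simp: B_def)
    have tube: "s w \<in> tube_domain" if "w \<in> B" for w
      using e(2)[OF small[OF that]] A(3) by (simp add: tube_domain_iff snd_s)
    have contA: "continuous_on X A" for X
      using A(1) by (simp add: linear_continuous_on linear_conv_bounded_linear)
    have sm: "s \<in> borel_measurable borel"
      unfolding s_def
      by (intro borel_measurable_continuous_onI continuous_intros continuous_on_compose2[OF contA[of UNIV]]) auto
    \<comment> \<open>Over \<open>B\<close> the determinant is \<open>dy * D\<close> with 1/2 < D <
      2, so its a-th power is at least dy^a 2^-|a|; \<open>K\<close> is the reciprocal of this
      bound.\<close>
    define K where "K = dy powr (- a) * 2 powr \<bar>a\<bar>"
    have K: "K > 0" using dy by (simp add: K_def)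
    have point: "indicator B w * ennreal ((cmod (F (s w)))\<^sup>2) \<le> ennreal K * g (s w)" for w
    proof (cases "w \<in> B")
      case True
      define D where "D = det (unit + snd w)"
      have D: "1/2 < D" "D < 2" and cone: "unit + snd w \<in> cone"
        using e(2)[OF small[OF True]] by (auto simp: D_def)
      have ds: "det (snd (s w)) = dy * D" by (simp add: snd_s A(4)[OF cone] dy_def D_def)
      have "1 \<le> K * (dy * D) powr a"
      proof -
        have "\<bar>ln D\<bar> \<le> ln 2"
        proof -
          have "ln (1/2) \<le> ln D" "ln D \<le> ln 2" using D by (subst ln_le_cancel_iff; simp)+
          then show ?thesis by (simp add: ln_div)
        qed
        then have "\<bar>a\<bar> * \<bar>ln D\<bar> \<le> \<bar>a\<bar> * ln 2" by (intro mult_left_mono) auto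
        then have "0 \<le> \<bar>a\<bar> * ln 2 + a * ln D" by (auto simp flip: abs_mult)
        then have "1 \<le> 2 powr \<bar>a\<bar> * D powr a" using D by (simp add: powr_def flip: exp_add)
        moreover have "K * (dy * D) powr a = (dy powr (- a) * dy powr a) * (2 powr \<bar>a\<bar> * D powr a)"
          using dy D by (simp add: K_def powr_mult)
        moreover have "dy powr (- a) * dy powr a = 1" using dy by (simp flip: powr_add)
        ultimately show ?thesis by simp
      qed
      then have "(cmod (F (s w)))\<^sup>2 * 1 \<le> (cmod (F (s w)))\<^sup>2 * (K * (dy * D) powr a)"
        by (intro mult_left_mono) auto
      then have "ennreal ((cmod (F (s w)))\<^sup>2) \<le> ennreal (K * ((cmod (F (s w)))\<^sup>2 * (dy * D) powr a))"
        by (intro ennreal_leI) (simp add: ac_simps)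
      also have "\<dots> = ennreal K * g (s w)"
        using tube[OF True] K by (simp add: g_def ds ennreal_mult')
      finally show ?thesis using True by simp
    qed simp
    have c2: "(\<integral>\<^sup>+w. g w \<partial>lborel) = ennreal (dy powr p) * ennreal (dy powr p) * (\<integral>\<^sup>+w. g (s w) \<partial>lborel)"
    proof -
      have "(\<integral>\<^sup>+w. g w \<partial>lborel) = (\<integral>\<^sup>+w. g (z + w) \<partial>lborel)"
        by (rule nn_integral_lborel_translate[symmetric]) measurable
      also have "\<dots> = ennreal (dy powr p) * ennreal (dy powr p) * (\<integral>\<^sup>+w. g (z + (A (fst w), A (snd w))) \<partial>lborel)"
        unfolding dy_def p_def
      proof (rule nn_integral_lborel_pair_linear[OF A(1,5)])
        show "(\<lambda>w. g (z + w)) \<in> borel_measurable borel"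
          by (rule measurable_compose[OF borel_measurable_continuous_onI gm]) (intro continuous_intros)
      qed
      finally show ?thesis by (simp add: s_def)
    qed
    have "ennreal ((cmod (F z))\<^sup>2) * ennreal V \<le> (\<integral>\<^sup>+w. indicator B w * ennreal ((cmod (F (s w)))\<^sup>2) \<partial>lborel)"
      unfolding V(2)[symmetric] B_def s_def
      by (rule sub_mean_value_square[OF hol A(1)]) (use tube in \<open>simp add: s_def B_def\<close>)
    also have "\<dots> \<le> (\<integral>\<^sup>+w. ennreal K * g (s w) \<partial>lborel)" by (rule nn_integral_mono) (rule point)
    also have "\<dots> = ennreal K * (\<integral>\<^sup>+w. g (s w) \<partial>lborel)"
      by (rule nn_integral_cmult) (use measurable_compose[OF sm gm] in simp)
    finally have "ennreal (dy powr p) * ennreal (dy powr p) * (ennreal ((cmod (F z))\<^sup>2) * ennreal V)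
      \<le> ennreal (dy powr p) * ennreal (dy powr p) * (ennreal K * (\<integral>\<^sup>+w. g (s w) \<partial>lborel))"
      by (rule mult_left_mono) simp
    also have "\<dots> = ennreal K * ennreal N" unfolding N(2)[symmetric] c2 by (simp add: ac_simps)
    finally have "ennreal (dy powr p * dy powr p * ((cmod (F z))\<^sup>2 * V)) \<le> ennreal (K * N)"
      using K V N by (simp add: ennreal_mult)
    then have "dy powr p * dy powr p * ((cmod (F z))\<^sup>2 * V) \<le> K * N"
      using K N by (simp add: ennreal_le_iff)
    \<comment> \<open>Multiplying by dy^a clears the factor dy^-a of \<open>K\<close>; on the left
      the exponents add up to a + 2p = nu.\<close>
    then have "dy powr a * (dy powr p * dy powr p * ((cmod (F z))\<^sup>2 * V)) \<le> dy powr a * (K * N)"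
      by (rule mult_left_mono) simp
    also have "dy powr a * (K * N) = 2 powr \<bar>a\<bar> * N" using dy by (simp add: K_def powr_minus field_simps)
    also have "dy powr a * (dy powr p * dy powr p * ((cmod (F z))\<^sup>2 * V))
      = (dy powr a * (dy powr p * dy powr p)) * ((cmod (F z))\<^sup>2 * V)"
      by (simp only: mult.assoc)
    also have "dy powr a * (dy powr p * dy powr p) = dy powr \<nu>" by (simp add: a flip: powr_add)
    finally have "(cmod (F z))\<^sup>2 * dy powr \<nu> * V \<le> 2 powr \<bar>a\<bar> * N" by (simp only: ac_simps)
    then show "(cmod (F z))\<^sup>2 * det (snd z) powr \<nu> \<le> 2 powr \<bar>a\<bar> * N / V"
      unfolding dy_def[symmetric] pos_le_divide_eq[OF V(1)] .
  qed
qed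

lemma bergman_space_mult:
  assumes F: "F \<in> bergman_space \<nu>" and G: "G \<in> bergman_space \<mu>"
  shows "(\<lambda>z. F z * G z) \<in> bergman_space (\<nu> + \<mu>)"
proof -
  obtain C where C: "C \<ge> 0" "\<And>z. z \<in> tube_domain \<Longrightarrow> (cmod (F z))\<^sup>2 * det (snd z) powr \<nu> \<le> C"
    by (rule bergman_space_pointwise_bound[OF F]) (rule that)
  have hF: "complexification_holomorphic_on F tube_domain"
    and hG: "complexification_holomorphic_on G tube_domain" and fin: "bergman_norm_sq \<mu> G < \<infinity>"
    using F G by (simp_all add: bergman_space_def)
  let ?q = "2 * real DIM('a) / real rank"
  define g where "g z = ennreal ((cmod (G z))\<^sup>2 * det (snd z) powr (\<mu> - ?q)) * indicator tube_domain z" for z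
  have "bergman_norm_sq (\<nu> + \<mu>) (\<lambda>z. F z * G z) \<le> (\<integral>\<^sup>+z. ennreal C * g z \<partial>lborel)"
    unfolding bergman_norm_sq_def
  proof (rule nn_integral_mono)
    fix z
    show "ennreal ((cmod (F z * G z))\<^sup>2 * det (snd z) powr (\<nu> + \<mu> - ?q)) * indicator tube_domain z \<le> ennreal C * g z"
    proof (cases "z \<in> tube_domain")
      case True
      \<comment> \<open>The whole shift by 2n/r goes to the factor of \<open>G\<close>, so the
        factor of \<open>F\<close> is exactly the quantity bounded by \<open>C\<close>.\<close>
      have "(cmod (F z * G z))\<^sup>2 * det (snd z) powr (\<nu> + \<mu> - ?q)
        = ((cmod (F z))\<^sup>2 * det (snd z) powr \<nu>) * ((cmod (G z))\<^sup>2 * det (snd z) powr (\<mu> - ?q))"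
        unfolding add_diff_eq[symmetric] powr_add by (simp add: norm_mult power_mult_distrib)
      also have "\<dots> \<le> C * ((cmod (G z))\<^sup>2 * det (snd z) powr (\<mu> - ?q))"
        by (intro mult_right_mono C(2)[OF True]) simp
      finally show ?thesis using True C(1) by (simp add: g_def flip: ennreal_mult')
    qed simp
  qed
  also have "\<dots> = ennreal C * (\<integral>\<^sup>+z. g z \<partial>lborel)"
    unfolding g_def by (rule nn_integral_cmult) (simp add: borel_measurable_bergman_integrand[OF hG])
  also have "\<dots> < \<infinity>"
    using fin by (simp add: bergman_norm_sq_def g_def ennreal_mult_less_top)
  finally show ?thesis
    using complexification_holomorphic_on_mult[OF hF hG] by (simp add: bergman_space_def)
qed

end

theorem theorem4p1:
  fixes jmul :: "'a::euclidean_space \<Rightarrow> 'a \<Rightarrow> 'a"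
    and n r :: nat and d \<nu>\<^sub>1 \<nu>\<^sub>2 :: real
    and F\<^sub>1 F\<^sub>2 :: "'a \<times> 'a \<Rightarrow> complex"
  assumes "simple_euclidean_jordan_algebra jmul"
    and dimension: "n = DIM('a)"
    and rank: "r = jordan_algebra.rank jmul"
    and peirce_multiplicity: "real n = real r + d / 2 * real r * (real r - 1)"
    and "\<nu>\<^sub>1 > 1 + d * (real r - 1)"
    and "\<nu>\<^sub>2 > 1 + d * (real r - 1)"
    and "F\<^sub>1 \<in> jordan_algebra.bergman_space jmul \<nu>\<^sub>1"
    and "F\<^sub>2 \<in> jordan_algebra.bergman_space jmul \<nu>\<^sub>2"
  shows "(\<lambda>z. F\<^sub>1 z * F\<^sub>2 z) \<in> jordan_algebra.bergman_space jmul (\<nu>\<^sub>1 + \<nu>\<^sub>2)"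
proof -
  interpret simple_euclidean_jordan_algebra jmul by fact
  show ?thesis using assms(7,8) by (rule bergman_space_mult)
qed

end
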